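(* For a semigroup $X$ the following conditions are equivalent: (1) $\lambda(X)$ is a commutative Clifford semigroup; (2) $\lambda(X)$ is an inverse semigroup; (3) the idempotents of the semigroup $\lambda(X)$ commute, and $\lambda(X)$ is sub-Clifford or $\lambda(X)$ is regular in $N_2(X)$; (4) $X$ is a finite commutative Clifford semigroup isomorphic to one of the following semigroups: $C_2$, $C_3$, $C_4$, $C_2\times C_2$, $L_2\times C_2$, $L_1\sqcup C_2$, $L_n$, or $C_2\sqcup L_n$ for some $n\in\omega$.
   Context: An upfamily on a set $X$ is a family $\mathcal F$ of nonempty subsets of $X$ such that $F\in\mathcal F$ and $F\subset E\subset X$ imply $E\in\mathcal F$. $\upsilon(X)$ is the set of all upfamilies on $X$. An upfamily $\mathcal F$ is linked if $A\cap B\neq\emptyset$ for all $A,B\in\mathcal F$; maximal linked if it equals every linked upfamily containing it; a filter if $A\cap B\in\mathcal F$ for all $A,B\in\mathcal F$; an ultrafilter if it is a maximal filter. $N_2(X)$, $\lambda(X)$, $\varphi(X)$, $\beta(X)$ denote the sets of linked upfamilies, maximal linked upfamilies, filters, and ultrafilters on $X$. Each $x\in X$ is identified with $\langle x\rangle=\{A\subset X: x\in A\}$. For a family $\mathcal C$ of nonempty subsets, $\langle\mathcal C\rangle=\{A\subset X:\exists C\in\mathcal C,\ C\subset A\}$. For a semigroup $(X,* )$ the operation is extended to $\upsilon(X)$ by $\mathcal A*\mathcal B=\big\langle \bigcup_{a\in A} a*B_a : A\in\mathcal A,\ \{B_a\}_{a\in A}\subset\mathcal B\big\rangle$; with it $\upsilon(X)$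 is a semigroup and $N_2(X),\lambda(X),\varphi(X),\beta(X)$ are subsemigroups. A semigroup $S$ is inverse if each $x$ has a unique $x^{-1}$ with $xx^{-1}x=x$, $x^{-1}xx^{-1}=x^{-1}$; regular if $x\in xSx$ for all $x$; Clifford if it is a union of groups; sub-Clifford if it is a union of cancellative subsemigroups. A subsemigroup $X\subset Y$ is regular in $Y$ if each $x\in X$ satisfies $x\in xYx$. $C_n=\{z\in\mathbb C: z^n=1\}$ is the cyclic group of order $n$; $L_n=\{0,\dots,n-1\}$ with the operation $\min$ ($L_0=\emptyset$). For semigroups $(X,* )$, $(Y,\star)$, the disjoint ordered union $X\sqcup Y$ is the disjoint union with operation $x\circ y=x*y$ for $x,y\in X$; $x\circ y=x$ if $x\in X,y\in Y$; $x\circ y=y$ if $x\in Y,y\in X$; $x\circ y=x\star y$ for $x,y\in Y$. *)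

theory Defs
  imports Complex_Main
begin

definition semigroup_on :: "'a set \<Rightarrow> ('a \<Rightarrow> 'a \<Rightarrow> 'a) \<Rightarrow> bool" where
  "semigroup_on S m \<longleftrightarrow> (\<forall>x\<in>S. \<forall>y\<in>S. m x y \<in> S) \<and>
     (\<forall>x\<in>S. \<forall>y\<in>S. \<forall>z\<in>S. m (m x y) z = m x (m y z))"

definition commutative_on :: "'a set \<Rightarrow> ('a \<Rightarrow> 'a \<Rightarrow> 'a) \<Rightarrow> bool" where
  "commutative_on S m \<longleftrightarrow> (\<forall>x\<in>S. \<forall>y\<in>S. m x y = m y x)"

definition group_in :: "'a set \<Rightarrow> ('a \<Rightarrow> 'a \<Rightarrow> 'a) \<Rightarrow> 'a set \<Rightarrow> bool" where
  "group_in S m G \<longleftrightarrow> G \<subseteq> S \<and> (\<forall>x\<in>G. \<forall>y\<in>G. m x y \<in> G) \<and>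
     (\<exists>e\<in>G. (\<forall>g\<in>G. m e g = g \<and> m g e = g) \<and> (\<forall>g\<in>G. \<exists>h\<in>G. m g h = e \<and> m h g = e))"

definition clifford_on :: "'a set \<Rightarrow> ('a \<Rightarrow> 'a \<Rightarrow> 'a) \<Rightarrow> bool" where
  "clifford_on S m \<longleftrightarrow> (\<forall>x\<in>S. \<exists>G. group_in S m G \<and> x \<in> G)"

definition cancellative_subsemigroup :: "'a set \<Rightarrow> ('a \<Rightarrow> 'a \<Rightarrow> 'a) \<Rightarrow> 'a set \<Rightarrow> bool" where
  "cancellative_subsemigroup S m T \<longleftrightarrow> T \<subseteq> S \<and> (\<forall>x\<in>T. \<forall>y\<in>T. m x y \<in> T) \<and>
     (\<forall>a\<in>T. \<forall>b\<in>T. \<forall>c\<in>T. (m a b = m a c \<longrightarrow> b = c) \<and> (m b a = m c a \<longrightarrow> b = c))"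

definition sub_clifford_on :: "'a set \<Rightarrow> ('a \<Rightarrow> 'a \<Rightarrow> 'a) \<Rightarrow> bool" where
  "sub_clifford_on S m \<longleftrightarrow> (\<forall>x\<in>S. \<exists>T. cancellative_subsemigroup S m T \<and> x \<in> T)"

definition inverse_on :: "'a set \<Rightarrow> ('a \<Rightarrow> 'a \<Rightarrow> 'a) \<Rightarrow> bool" where
  "inverse_on S m \<longleftrightarrow> (\<forall>x\<in>S. \<exists>!y. y \<in> S \<and> m (m x y) x = x \<and> m (m y x) y = y)"

definition regular_in :: "'a set \<Rightarrow> 'a set \<Rightarrow> ('a \<Rightarrow> 'a \<Rightarrow> 'a) \<Rightarrow> bool" where
  "regular_in X Y m \<longleftrightarrow> (\<forall>x\<in>X. \<exists>y\<in>Y. x = m (m x y) x)"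

definition idempotents_commute :: "'a set \<Rightarrow> ('a \<Rightarrow> 'a \<Rightarrow> 'a) \<Rightarrow> bool" where
  "idempotents_commute S m \<longleftrightarrow>
     (\<forall>e\<in>S. \<forall>f\<in>S. m e e = e \<and> m f f = f \<longrightarrow> m e f = m f e)"

definition sg_iso :: "'a set \<Rightarrow> ('a \<Rightarrow> 'a \<Rightarrow> 'a) \<Rightarrow> 'b set \<Rightarrow> ('b \<Rightarrow> 'b \<Rightarrow> 'b) \<Rightarrow> bool" where
  "sg_iso S m T n \<longleftrightarrow> (\<exists>h. bij_betw h S T \<and> (\<forall>x\<in>S. \<forall>y\<in>S. h (m x y) = n (h x) (h y)))"

definition upfamily :: "'a set \<Rightarrow> 'a set set \<Rightarrow> bool" where
  "upfamily X F \<longleftrightarrow> F \<subseteq> Pow X \<and> (\<forall>A\<in>F. A \<noteq> {}) \<and>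
     (\<forall>A\<in>F. \<forall>E. A \<subseteq> E \<and> E \<subseteq> X \<longrightarrow> E \<in> F)"

definition linked_up :: "'a set \<Rightarrow> 'a set set \<Rightarrow> bool" where
  "linked_up X F \<longleftrightarrow> upfamily X F \<and> (\<forall>A\<in>F. \<forall>B\<in>F. A \<inter> B \<noteq> {})"

definition maxlinked_up :: "'a set \<Rightarrow> 'a set set \<Rightarrow> bool" where
  "maxlinked_up X F \<longleftrightarrow> linked_up X F \<and> (\<forall>G. linked_up X G \<and> F \<subseteq> G \<longrightarrow> G = F)"

definition N2 :: "'a set \<Rightarrow> 'a set set set" where
  "N2 X = {F. linked_up X F}"

definition lam :: "'a set \<Rightarrow> 'a set set set" where
  "lam X = {F. maxlinked_up X F}"

definition upmult :: "'a set \<Rightarrow> ('a \<Rightarrow> 'a \<Rightarrow> 'a) \<Rightarrow> 'a set set \<Rightarrow> 'a set set \<Rightarrow> 'a set set" where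
  "upmult X m \<A> \<B> = {E. E \<subseteq> X \<and> (\<exists>A\<in>\<A>. \<exists>B. (\<forall>a\<in>A. B a \<in> \<B>) \<and>
       (\<Union>a\<in>A. m a ` B a) \<subseteq> E)}"

definition Cyc :: "nat \<Rightarrow> complex set" where
  "Cyc n = {z. z ^ n = 1}"

definition Lmin :: "nat \<Rightarrow> nat set" where
  "Lmin n = {0..<n}"

definition prod_op :: "('a \<Rightarrow> 'a \<Rightarrow> 'a) \<Rightarrow> ('b \<Rightarrow> 'b \<Rightarrow> 'b) \<Rightarrow> 'a \<times> 'b \<Rightarrow> 'a \<times> 'b \<Rightarrow> 'a \<times> 'b" where
  "prod_op m n p q = (m (fst p) (fst q), n (snd p) (snd q))"

definition ord_union :: "'a set \<Rightarrow> 'b set \<Rightarrow> ('a + 'b) set" where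
  "ord_union S T = Inl ` S \<union> Inr ` T"

fun ord_union_op :: "('a \<Rightarrow> 'a \<Rightarrow> 'a) \<Rightarrow> ('b \<Rightarrow> 'b \<Rightarrow> 'b) \<Rightarrow> 'a + 'b \<Rightarrow> 'a + 'b \<Rightarrow> 'a + 'b" where
  "ord_union_op m n (Inl x) (Inl y) = Inl (m x y)"
| "ord_union_op m n (Inl x) (Inr y) = Inl x"
| "ord_union_op m n (Inr x) (Inl y) = Inl y"
| "ord_union_op m n (Inr x) (Inr y) = Inr (n x y)"

end

theory Submission
  imports Defs
begin

text \<open>
  Membership in a product reads \<open>A \<in> U \<star> V \<longleftrightarrow> {x. {y. x \<cdot> y \<in> A} \<in> V} \<in> U\<close>, which turns every question
  about finitely supported maximal linked systems into propositional logic.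

  For (3) to (4): if the idempotents of \<open>lam X\<close> commute, then \<open>X\<close> has no sequence whose ordered
  products determine their first or their last index, for otherwise two idempotent ultrafilters carried by the
  products of even-indexed, respectively odd-indexed, terms would not commute. Hence elements have finite order, and
  chains of idempotents and subgroups are finite; majorities on triples show that idempotents form a
  chain. So \<open>X\<close> is a finite chain of finite groups and \<open>lam X\<close> is regular in \<open>N2 X\<close>. Explicit
  non-regular systems and non-commuting idempotents on at most five points exclude every
  configuration not on the list.

  For (4) to (1), the four-point cases are finite computations. In \<open>L\<^sub>n\<close> and \<open>C\<^sub>2 \<squnion> L\<^sub>n\<close>, a set
  in \<open>U \<star> V\<close> but not in \<open>V \<star> U\<close> would give two families of choices alternating between \<open>U\<close>-large and
  \<open>V\<close>-large sets, which clash at a least element.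
\<close>

section \<open>The extended operation\<close>

text \<open>The four conditions are proved in a cycle, and the delicate link starts from (3), whose
  two alternatives offer different tools. Regularity in \<open>N2 X\<close> supplies only a linked
  \<open>B\<close> with \<open>U = U \<star> B \<star> U\<close>; members of \<open>B\<close> are
  merely known to meet, so the arguments test one or two left factors against a single middle
  factor. Sub-Clifford offers cancellation and turns into regularity only once \<open>lam X\<close>
  is finite; hence comparability of idempotents and torsion are shown for each alternative.

  The source of finiteness is that ultrafilters are maximal linked. A filter stands for the closed
  set of ultrafilters above it, so idempotent ultrafilters are found by Zorn's lemma without any
  topology.

  The explicit finite witnesses are voting rules: three equal votes (\<open>majority\<close>) or
  votes 2, 1, 1, 1 (\<open>star\<close>). With the principal systems they exhaust
  \<open>lam X\<close> on four points, which explains why the same two shapes serve as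
  counterexamples and as case lists.\<close>

lemma upfamily_mono: "upfamily X F \<Longrightarrow> A \<in> F \<Longrightarrow> A \<subseteq> E \<Longrightarrow> E \<subseteq> X \<Longrightarrow> E \<in> F"
  unfolding upfamily_def by blast

lemma upfamily_sub: "upfamily X F \<Longrightarrow> A \<in> F \<Longrightarrow> A \<subseteq> X"
  unfolding upfamily_def by blast

lemma upfamily_nonempty: "upfamily X F \<Longrightarrow> A \<in> F \<Longrightarrow> A \<noteq> {}"
  unfolding upfamily_def by blast

lemma linked_meet: "linked_up X F \<Longrightarrow> A \<in> F \<Longrightarrow> B \<in> F \<Longrightarrow> \<exists>x. x \<in> A \<and> x \<in> B"
  unfolding linked_up_def by blast

lemma linked_upfamily: "linked_up X F \<Longrightarrow> upfamily X F"
  unfolding linked_up_def by blast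

lemma lam_linked: "U \<in> lam X \<Longrightarrow> linked_up X U"
  unfolding lam_def maxlinked_up_def by blast

lemma lam_upfamily: "U \<in> lam X \<Longrightarrow> upfamily X U"
  using lam_linked linked_upfamily by blast

lemma lam_N2: "lam X \<subseteq> N2 X"
  unfolding N2_def using lam_linked by blast

text \<open>Adjoining to \<open>U\<close> all supersets of such an \<open>A\<close> keeps it linked,
  so maximality absorbs them.\<close>

lemma lam_meetI:
  assumes U: "U \<in> lam X" and A: "A \<subseteq> X" "A \<noteq> {}" and meet: "\<And>B. B \<in> U \<Longrightarrow> A \<inter> B \<noteq> {}"
  shows "A \<in> U"
proof -
  define G where "G = U \<union> {E. A \<subseteq> E \<and> E \<subseteq> X}"
  have up: "upfamily X U" and l: "\<And>B C. B \<in> U \<Longrightarrow> C \<in> U \<Longrightarrow> B \<inter> C \<noteq> {}"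
    using lam_linked[OF U] unfolding linked_up_def by auto
  have "linked_up X G"
    unfolding linked_up_def
  proof
    show "upfamily X G"
      unfolding upfamily_def
    proof (intro conjI ballI allI impI)
      show "G \<subseteq> Pow X" using upfamily_sub[OF up] unfolding G_def by blast
      show "B \<noteq> {}" if "B \<in> G" for B using that upfamily_nonempty[OF up] A unfolding G_def by auto
      show "E \<in> G" if "B \<in> G" "B \<subseteq> E \<and> E \<subseteq> X" for B E
        using that upfamily_mono[OF up, of B E] unfolding G_def by auto
    qed
    show "\<forall>B\<in>G. \<forall>C\<in>G. B \<inter> C \<noteq> {}"
    proof (intro ballI)
      fix B C assume "B \<in> G" "C \<in> G"
      then consider "B \<in> U" "C \<in> U" | "B \<in> U" "A \<subseteq> C" | "A \<subseteq> B" "C \<in> U" | "A \<subseteq> B" "A \<subseteq> C"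
        unfolding G_def by auto
      then show "B \<inter> C \<noteq> {}"
      proof cases
        case 1 then show ?thesis using l by simp
      next
        case 2 then show ?thesis using meet[of B] by auto
      next
        case 3 then show ?thesis using meet[of C] by auto
      next
        case 4 then show ?thesis using A(2) by auto
      qed
    qed
  qed
  moreover have "U \<subseteq> G" unfolding G_def by simp
  ultimately have "G = U"
    using U unfolding lam_def maxlinked_up_def by simp
  then show ?thesis using A unfolding G_def by blast
qed

text \<open>When \<open>A\<close> is not a member, some member misses it and so lies in the
  complement. The empty carrier is a genuine exception: \<open>lam {}\<close> contains only the
  empty family, which decides nothing.\<close>

lemma lam_dichotomy:
  assumes "X \<noteq> {}" and U: "U \<in> lam X" and A: "A \<subseteq> X"
  shows "A \<in> U \<or> X - A \<in> U"
proof (rule ccontr)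
  assume n: "\<not> ?thesis"
  have up: "upfamily X U" using U lam_upfamily by blast
  have ne: "U \<noteq> {}"
  proof
    assume "U = {}"
    then have "X \<in> U" using lam_meetI[OF U] assms by blast
    with \<open>U = {}\<close> show False by simp
  qed
  then obtain B where "B \<in> U" by blast
  then have "X \<in> U" using upfamily_mono[OF up] upfamily_sub[OF up, of B] by simp
  then have "A \<noteq> {}" using n by auto
  then obtain B where "B \<in> U" "A \<inter> B = {}" using lam_meetI[OF U A] n by blast
  then have "X - A \<in> U" using up upfamily_sub[OF up] upfamily_mono[OF up, of B "X - A"] by blast
  with n show False by simp
qed

lemma lam_compl:
  assumes "X \<noteq> {}" and "U \<in> lam X" and "A \<subseteq> X"
  shows "X - A \<in> U \<longleftrightarrow> A \<notin> U"
  using lam_dichotomy[OF assms] linked_meet[OF lam_linked[OF assms(2)], of A "X - A"] by blast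

text \<open>A linked family deciding every set has no room to grow: a new member would be disjoint
  from its complement, which is already present.\<close>

lemma lamI:
  assumes l: "linked_up X U" and c: "\<And>A. A \<subseteq> X \<Longrightarrow> A \<in> U \<or> X - A \<in> U"
  shows "U \<in> lam X"
proof -
  have "G \<subseteq> U" if G: "linked_up X G" "U \<subseteq> G" for G
  proof
    fix A assume A: "A \<in> G"
    then have "A \<subseteq> X" using G(1) upfamily_sub linked_upfamily by blast
    moreover have "X - A \<notin> G" using linked_meet[OF G(1) A, of "X - A"] by blast
    ultimately show "A \<in> U" using c G(2) by blast
  qed
  then show ?thesis using l unfolding lam_def maxlinked_up_def by blast
qed

text \<open>Maximality makes one inclusion suffice, which halves every equality of systems checked
  by computation.\<close>

lemma lam_eqI:
  assumes "U \<in> lam X" "V \<in> lam X" "U \<subseteq> V"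
  shows "U = V"
  using assms unfolding lam_def maxlinked_up_def by blast

section \<open>Products of upfamilies: membership, maximality, associativity\<close>

locale sgrp =
  fixes X :: "'a set" and m :: "'a \<Rightarrow> 'a \<Rightarrow> 'a" (infixl "\<cdot>" 70)
  assumes sg: "semigroup_on X m"
begin

abbreviation um (infixl "\<star>" 70) where "U \<star> V \<equiv> upmult X m U V"

lemma closed [simp, intro]: "x \<in> X \<Longrightarrow> y \<in> X \<Longrightarrow> x \<cdot> y \<in> X"
  using sg unfolding semigroup_on_def by blast

lemma assoc: "x \<in> X \<Longrightarrow> y \<in> X \<Longrightarrow> z \<in> X \<Longrightarrow> (x \<cdot> y) \<cdot> z = x \<cdot> (y \<cdot> z)"
  using sg unfolding semigroup_on_def by blast

abbreviation pre where "pre x A \<equiv> {y \<in> X. x \<cdot> y \<in> A}"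

text \<open>The choice function in \<open>upmult\<close> can always be enlarged to the largest
  admissible one, \<open>pre x A\<close>, so the quantifier over choices disappears.\<close>

lemma um_iff:
  assumes U: "upfamily X U" and V: "upfamily X V"
  shows "A \<in> U \<star> V \<longleftrightarrow> A \<subseteq> X \<and> {x \<in> X. pre x A \<in> V} \<in> U"
proof
  assume "A \<in> U \<star> V"
  then obtain M B where *: "A \<subseteq> X" "M \<in> U" "\<forall>a\<in>M. B a \<in> V" "(\<Union>a\<in>M. m a ` B a) \<subseteq> A"
    unfolding upmult_def by blast
  have "M \<subseteq> {x \<in> X. pre x A \<in> V}"
  proof
    fix x assume x: "x \<in> M"
    have "B x \<subseteq> X" using x *(3) upfamily_sub[OF V] by simp
    moreover have "x \<cdot> y \<in> A" if "y \<in> B x" for y using *(4) x that by blast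
    ultimately have "B x \<subseteq> pre x A" by auto
    then show "x \<in> {x \<in> X. pre x A \<in> V}"
      using x * upfamily_mono[OF V, of "B x" "pre x A"] upfamily_sub[OF U *(2)] by auto
  qed
  then show "A \<subseteq> X \<and> {x \<in> X. pre x A \<in> V} \<in> U"
    using * upfamily_mono[OF U *(2)] by auto
next
  assume "A \<subseteq> X \<and> {x \<in> X. pre x A \<in> V} \<in> U"
  then show "A \<in> U \<star> V" unfolding upmult_def
    by (auto intro!: bexI[of _ "{x \<in> X. pre x A \<in> V}"] exI[of _ "\<lambda>x. pre x A"])
qed

lemma um_upfamily:
  assumes U: "upfamily X U" and V: "upfamily X V"
  shows "upfamily X (U \<star> V)"
  unfolding upfamily_def
proof (intro conjI ballI allI impI)
  show "U \<star> V \<subseteq> Pow X" unfolding upmult_def by blast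
  show "A \<noteq> {}" if "A \<in> U \<star> V" for A
  proof
    assume "A = {}"
    then have "{x \<in> X. {} \<in> V} \<in> U" using that um_iff[OF U V] by simp
    then show False using upfamily_nonempty[OF U] upfamily_nonempty[OF V] by fastforce
  qed
  show "E \<in> U \<star> V" if "A \<in> U \<star> V" "A \<subseteq> E \<and> E \<subseteq> X" for A E
    using that unfolding um_iff[OF U V]
  proof (elim conjE, intro conjI)
    assume "{x \<in> X. pre x A \<in> V} \<in> U" and *: "A \<subseteq> E" "E \<subseteq> X"
    moreover have "pre x A \<in> V \<Longrightarrow> pre x E \<in> V" for x
      using upfamily_mono[OF V, of "pre x A" "pre x E"] * by blast
    ultimately show "{x \<in> X. pre x E \<in> V} \<in> U"
      by (elim upfamily_mono[OF U]) auto
  qed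
qed

text \<open>Linkedness of \<open>U\<close> yields a left factor common to both sets; linkedness of
  \<open>V\<close> then yields a common right factor.\<close>

lemma um_linked:
  assumes U: "linked_up X U" and V: "linked_up X V"
  shows "linked_up X (U \<star> V)"
  unfolding linked_up_def
proof (intro conjI ballI)
  have u: "upfamily X U" "upfamily X V" using U V linked_upfamily by auto
  show "upfamily X (U \<star> V)" using um_upfamily[OF u] .
  fix A B assume "A \<in> U \<star> V" "B \<in> U \<star> V"
  then have "{x \<in> X. pre x A \<in> V} \<in> U" "{x \<in> X. pre x B \<in> V} \<in> U"
    using um_iff[OF u] by auto
  then obtain x where "pre x A \<in> V" "pre x B \<in> V" using linked_meet[OF U] by fastforce
  then show "A \<inter> B \<noteq> {}" using linked_meet[OF V] by fastforce
qed

lemma um_lam: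
  assumes U: "U \<in> lam X" and V: "V \<in> lam X"
  shows "U \<star> V \<in> lam X"
proof (cases "X = {}")
  case True
  have "linked_up X (U \<star> V)" using um_linked[OF assms[THEN lam_linked]] .
  moreover have "linked_up X G \<Longrightarrow> G = {}" for G
    using True unfolding linked_up_def upfamily_def by blast
  ultimately show ?thesis unfolding lam_def maxlinked_up_def by blast
next
  case False
  have u: "upfamily X U" "upfamily X V" using U V lam_upfamily by auto
  show ?thesis
  proof (rule lamI)
    show "linked_up X (U \<star> V)" using um_linked[OF assms[THEN lam_linked]] .
    fix A assume A: "A \<subseteq> X"
    \<comment> \<open>Complementation commutes with \<open>pre x\<close> and with membership in
      \<open>V\<close>, so it passes through both layers of the product.\<close>
    have e: "pre x (X - A) = X - pre x A" if "x \<in> X" for x using that by auto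
    have "{x \<in> X. pre x (X - A) \<in> V} = X - {x \<in> X. pre x A \<in> V}"
      using e lam_compl[OF False V] by auto
    moreover have "{x \<in> X. pre x A \<in> V} \<in> U \<or> X - {x \<in> X. pre x A \<in> V} \<in> U"
      by (rule lam_dichotomy[OF False U]) auto
    ultimately show "A \<in> U \<star> V \<or> X - A \<in> U \<star> V"
      using um_iff[OF u] A by auto
  qed
qed

text \<open>Both sides state the same nested condition on triples once
  \<open>pre (x \<cdot> y) A\<close> is rewritten as \<open>pre y (pre x A)\<close>.\<close>

lemma um_assoc:
  assumes U: "upfamily X U" and V: "upfamily X V" and W: "upfamily X W"
  shows "(U \<star> V) \<star> W = U \<star> (V \<star> W)"
proof -
  note uv = um_upfamily[OF U V] and vw = um_upfamily[OF V W]
  have "A \<in> (U \<star> V) \<star> W \<longleftrightarrow> A \<in> U \<star> (V \<star> W)" for A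
  proof -
    have e: "pre x {t \<in> X. pre t A \<in> W} = {y \<in> X. pre y (pre x A) \<in> W}" if x: "x \<in> X" for x
    proof -
      have "pre (x \<cdot> y) A = pre y (pre x A)" if "y \<in> X" for y
        using x that by (auto simp: assoc)
      then have *: "y \<in> X \<and> pre (x \<cdot> y) A \<in> W \<longleftrightarrow> y \<in> X \<and> pre y (pre x A) \<in> W" for y
        by (intro conj_cong refl) (simp only:)
      show ?thesis
      proof (rule set_eqI)
        fix y
        have "y \<in> pre x {t \<in> X. pre t A \<in> W} \<longleftrightarrow> y \<in> X \<and> pre (x \<cdot> y) A \<in> W"
          using x by auto
        also note *
        also have "y \<in> X \<and> pre y (pre x A) \<in> W \<longleftrightarrow> y \<in> {y \<in> X. pre y (pre x A) \<in> W}"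
          by (simp only: mem_Collect_eq)
        finally show "y \<in> pre x {t \<in> X. pre t A \<in> W} \<longleftrightarrow> y \<in> {y \<in> X. pre y (pre x A) \<in> W}" .
      qed
    qed
    have "A \<in> (U \<star> V) \<star> W \<longleftrightarrow> A \<subseteq> X \<and> {x \<in> X. pre x {t \<in> X. pre t A \<in> W} \<in> V} \<in> U"
      by (auto simp: um_iff[OF uv W] um_iff[OF U V])
    also have "{x \<in> X. pre x {t \<in> X. pre t A \<in> W} \<in> V} = {x \<in> X. pre x A \<in> V \<star> W}"
      using e by (auto simp: um_iff[OF V W])
    also have "A \<subseteq> X \<and> {x \<in> X. pre x A \<in> V \<star> W} \<in> U \<longleftrightarrow> A \<in> U \<star> (V \<star> W)"
      by (simp add: um_iff[OF U vw])
    finally show ?thesis .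
  qed
  then show ?thesis by blast
qed

lemma um_lam_assoc:
  "U \<in> lam X \<Longrightarrow> V \<in> lam X \<Longrightarrow> W \<in> lam X \<Longrightarrow> (U \<star> V) \<star> W = U \<star> (V \<star> W)"
  by (rule um_assoc[OF lam_upfamily lam_upfamily lam_upfamily])

lemma um_mono:
  assumes "U \<subseteq> U'" "V \<subseteq> V'"
  shows "U \<star> V \<subseteq> U' \<star> V'"
proof
  fix E assume "E \<in> U \<star> V"
  then obtain A B where "E \<subseteq> X" "A \<in> U" "\<forall>a\<in>A. B a \<in> V" "(\<Union>a\<in>A. m a ` B a) \<subseteq> E"
    unfolding upmult_def by auto
  moreover from this have "A \<in> U'" "\<forall>a\<in>A. B a \<in> V'" using assms by auto
  ultimately show "E \<in> U' \<star> V'" unfolding upmult_def by (intro CollectI conjI bexI exI) auto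
qed

section \<open>Systems with finite support\<close>

text \<open>The points need not be distinct: \<open>majority p p r = point p\<close>.\<close>

definition point where "point p = {A. A \<subseteq> X \<and> p \<in> A}"

definition majority where
  "majority p q r = {A. A \<subseteq> X \<and> (p \<in> A \<and> q \<in> A \<or> p \<in> A \<and> r \<in> A \<or> q \<in> A \<and> r \<in> A)}"

text \<open>A weighted vote: \<open>p\<close> counts twice, \<open>q\<close>, \<open>r\<close>,
  \<open>s\<close> once each, and three of the five votes win.\<close>

definition star where
  "star p q r s = {A. A \<subseteq> X \<and> (p \<in> A \<and> (q \<in> A \<or> r \<in> A \<or> s \<in> A) \<or> q \<in> A \<and> r \<in> A \<and> s \<in> A)}"

lemma point_lam [simp, intro]: "p \<in> X \<Longrightarrow> point p \<in> lam X"
  by (rule lamI) (auto simp: point_def linked_up_def upfamily_def)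

lemma majority_lam [simp, intro]: "p \<in> X \<Longrightarrow> q \<in> X \<Longrightarrow> r \<in> X \<Longrightarrow> majority p q r \<in> lam X"
  by (rule lamI) (auto simp: majority_def linked_up_def upfamily_def)

lemma star_lam [simp, intro]:
  "p \<in> X \<Longrightarrow> q \<in> X \<Longrightarrow> r \<in> X \<Longrightarrow> s \<in> X \<Longrightarrow> star p q r s \<in> lam X"
  by (rule lamI) (auto simp: star_def linked_up_def upfamily_def)

lemma in_point: "A \<subseteq> X \<Longrightarrow> A \<in> point p \<longleftrightarrow> p \<in> A"
  by (simp add: point_def)

lemma in_majority:
  "A \<subseteq> X \<Longrightarrow> A \<in> majority p q r \<longleftrightarrow> p \<in> A \<and> q \<in> A \<or> p \<in> A \<and> r \<in> A \<or> q \<in> A \<and> r \<in> A"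
  by (simp add: majority_def)

lemma in_star: "A \<subseteq> X \<Longrightarrow> A \<in> star p q r s \<longleftrightarrow>
    p \<in> A \<and> (q \<in> A \<or> r \<in> A \<or> s \<in> A) \<or> q \<in> A \<and> r \<in> A \<and> s \<in> A"
  by (simp add: star_def)

lemma in_um:
  "U \<in> lam X \<Longrightarrow> V \<in> lam X \<Longrightarrow> A \<subseteq> X \<Longrightarrow> A \<in> U \<star> V \<longleftrightarrow> {x \<in> X. pre x A \<in> V} \<in> U"
  using um_iff[OF lam_upfamily lam_upfamily] by simp

lemma point_inj: "p \<in> X \<Longrightarrow> q \<in> X \<Longrightarrow> point p = point q \<longleftrightarrow> p = q"
  using in_point[of "{p}" p] in_point[of "{p}" q] by auto

lemma lam_eqI':
  assumes "U \<in> lam X" "V \<in> lam X" "\<And>A. A \<subseteq> X \<Longrightarrow> A \<in> U \<Longrightarrow> A \<in> V"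
  shows "U = V"
  using lam_eqI[OF assms(1,2)] assms(3) upfamily_sub[OF lam_upfamily[OF assms(1)]] by (meson subsetI)

lemma point_um: "p \<in> X \<Longrightarrow> q \<in> X \<Longrightarrow> point p \<star> point q = point (p \<cdot> q)"
  by (rule lam_eqI') (auto simp: um_lam in_um in_point)

lemma lam_pointI:
  assumes "U \<in> lam X" "{p} \<in> U" shows "U = point p"
proof (rule lam_eqI'[symmetric])
  show "point p \<in> lam X" using upfamily_sub[OF lam_upfamily, OF assms] by auto
qed (use assms upfamily_mono[OF lam_upfamily[OF assms(1)] assms(2)] in \<open>auto simp: point_def\<close>)

end

section \<open>Inverse and Clifford semigroups\<close>

context sgrp
begin

text \<open>The group inverse \<open>y\<close> is the only candidate: for a second inverse
  \<open>z\<close>, commutativity rewrites \<open>z\<close> to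
  \<open>z \<cdot> (x \<cdot> y)\<close>, and then, expanding \<open>x\<close> as
  \<open>x \<cdot> z \<cdot> x\<close>, to \<open>y\<close>.\<close>

lemma commutative_clifford_inverse:
  assumes c: "commutative_on X m" and cl: "clifford_on X m"
  shows "inverse_on X m"
  unfolding inverse_on_def
proof
  have comm: "\<And>x y. x \<in> X \<Longrightarrow> y \<in> X \<Longrightarrow> x \<cdot> y = y \<cdot> x"
    using c unfolding commutative_on_def by blast
  fix x assume x: "x \<in> X"
  obtain G where G: "group_in X m G" "x \<in> G"
    using cl x unfolding clifford_on_def by blast
  then obtain e y where y: "e \<in> G" "y \<in> G" "x \<cdot> y = e" "y \<cdot> x = e" "e \<cdot> x = x" "e \<cdot> y = y"
    unfolding group_in_def by metis
  have yX: "y \<in> X" using G y unfolding group_in_def by blast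
  show "\<exists>!y. y \<in> X \<and> x \<cdot> y \<cdot> x = x \<and> y \<cdot> x \<cdot> y = y"
  proof (rule ex1I[of _ y])
    show "y \<in> X \<and> x \<cdot> y \<cdot> x = x \<and> y \<cdot> x \<cdot> y = y" using y yX by simp
    fix z assume z: "z \<in> X \<and> x \<cdot> z \<cdot> x = x \<and> z \<cdot> x \<cdot> z = z"
    have "z = z \<cdot> x \<cdot> z" using z by simp
    also have "\<dots> = z \<cdot> (x \<cdot> y \<cdot> x) \<cdot> z" using y by simp
    also have "\<dots> = (z \<cdot> x \<cdot> z) \<cdot> (x \<cdot> y)" using x yX z by (metis assoc closed comm)
    also have "\<dots> = z \<cdot> (x \<cdot> y)" using z by simp
    also have "\<dots> = (x \<cdot> z \<cdot> x) \<cdot> y \<cdot> y" using x yX z y by (metis assoc closed comm)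
    also have "\<dots> = y" using z y by simp
    finally show "z = y" .
  qed
qed

text \<open>The classical argument: products of idempotents are idempotent, and then
  \<open>e \<cdot> f\<close> and \<open>f \<cdot> e\<close> are both inverses of
  \<open>e \<cdot> f\<close>.\<close>

lemma inverse_idempotents_commute:
  assumes inv: "inverse_on X m"
  shows "idempotents_commute X m"
proof -
  have uniq: "y = z" if "x \<in> X" "y \<in> X" "z \<in> X" "x \<cdot> y \<cdot> x = x" "y \<cdot> x \<cdot> y = y"
    "x \<cdot> z \<cdot> x = x" "z \<cdot> x \<cdot> z = z" for x y z
    using inv that unfolding inverse_on_def by blast
  have idem: "(e \<cdot> f) \<cdot> (e \<cdot> f) = e \<cdot> f"
    if e: "e \<in> X" "e \<cdot> e = e" and f: "f \<in> X" "f \<cdot> f = f" for e f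
  proof -
    obtain x where x: "x \<in> X" "(e \<cdot> f) \<cdot> x \<cdot> (e \<cdot> f) = e \<cdot> f" "x \<cdot> (e \<cdot> f) \<cdot> x = x"
      using inv e f unfolding inverse_on_def by (metis closed)
    have x1: "e \<cdot> (f \<cdot> (x \<cdot> (e \<cdot> f))) = e \<cdot> f" using x e f by (simp add: assoc)
    have x2: "x \<cdot> (e \<cdot> (f \<cdot> x)) = x" using x e f by (simp add: assoc)
    have ee: "e \<cdot> (e \<cdot> y) = e \<cdot> y" "f \<cdot> (f \<cdot> y) = f \<cdot> y" if "y \<in> X" for y
      using e f that by (metis assoc)+
    have x2': "x \<cdot> (e \<cdot> (f \<cdot> (x \<cdot> y))) = x \<cdot> y" if "y \<in> X" for y
      using arg_cong[OF x2, of "\<lambda>t. t \<cdot> y"] that x(1) e f by (simp add: assoc)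
    \<comment> \<open>The left side is again an inverse of \<open>e \<cdot> f\<close>. Absorbing
      \<open>f\<close> on the left and \<open>e\<close> on the right forces \<open>x\<close> to be
      idempotent, hence its own inverse, hence equal to \<open>e \<cdot> f\<close>.\<close>
    have "f \<cdot> x \<cdot> e = x"
      by (rule uniq[of "e \<cdot> f"]) (use x1 x2 ee x2' x e f in \<open>simp_all add: assoc\<close>)
    then have fx: "f \<cdot> (x \<cdot> e) = x" using x e f by (simp add: assoc)
    then have "x \<cdot> x = x" using x2' [of e] x e f by (metis assoc closed)
    then have "x = e \<cdot> f"
      using uniq[of x x "e \<cdot> f"] x e f by simp
    with \<open>x \<cdot> x = x\<close> show ?thesis by simp
  qed
  show ?thesis
    unfolding idempotents_commute_def
  proof (intro ballI impI)
    fix e f assume ef: "e \<in> X" "f \<in> X" "e \<cdot> e = e \<and> f \<cdot> f = f"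
    have ee: "e \<cdot> (e \<cdot> y) = e \<cdot> y" "f \<cdot> (f \<cdot> y) = f \<cdot> y" if "y \<in> X" for y
      using ef that by (metis assoc)+
    show "e \<cdot> f = f \<cdot> e"
      by (rule uniq[of "e \<cdot> f"]) (use ee ef idem[of e f] idem[of f e] in \<open>simp_all add: assoc\<close>)
  qed
qed

lemma inverse_regular: "inverse_on X m \<Longrightarrow> regular_in X X m"
  unfolding inverse_on_def regular_in_def by metis

text \<open>If \<open>x = x \<cdot> y \<cdot> x\<close>, then \<open>x\<close> is a unit, with
  inverse \<open>e \<cdot> y\<close>, of the local monoid at the idempotent
  \<open>e = x \<cdot> y\<close>; \<open>G\<close> is the unit group of that monoid.\<close>

lemma commutative_regular_clifford:
  assumes c: "commutative_on X m" and r: "regular_in X X m"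
  shows "clifford_on X m"
  unfolding clifford_on_def
proof
  have comm: "\<And>x y. x \<in> X \<Longrightarrow> y \<in> X \<Longrightarrow> x \<cdot> y = y \<cdot> x"
    using c unfolding commutative_on_def by blast
  fix x assume x: "x \<in> X"
  obtain y where y: "y \<in> X" "x = x \<cdot> y \<cdot> x" using r x unfolding regular_in_def by blast
  define e where "e = x \<cdot> y"
  have e: "e \<in> X" "e \<cdot> x = x" "e \<cdot> e = e"
    using x y unfolding e_def by (auto simp flip: assoc)
  define G where "G = {g \<in> X. e \<cdot> g = g \<and> (\<exists>h\<in>X. e \<cdot> h = h \<and> g \<cdot> h = e)}"
  have "x \<cdot> (e \<cdot> y) = e" using x y e by (metis assoc comm closed e_def)
  then have "x \<in> G" unfolding G_def using x y e by (auto intro!: bexI[of _ "e \<cdot> y"] simp flip: assoc)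
  moreover have "group_in X m G"
    unfolding group_in_def
  proof (intro conjI ballI)
    show "G \<subseteq> X" unfolding G_def by blast
    have "e \<in> G" unfolding G_def using e by auto
    moreover have "e \<cdot> g = g \<and> g \<cdot> e = g" if "g \<in> G" for g
      using that comm[of e g] e unfolding G_def by auto
    moreover have "\<exists>h\<in>G. g \<cdot> h = e \<and> h \<cdot> g = e" if g: "g \<in> G" for g
    proof -
      obtain h where "h \<in> X" "e \<cdot> h = h" "g \<cdot> h = e" using g unfolding G_def by blast
      moreover have "h \<cdot> g = e" using comm g \<open>h \<in> X\<close> \<open>g \<cdot> h = e\<close> unfolding G_def by auto
      ultimately show ?thesis using g unfolding G_def by blast
    qed
    ultimately show "\<exists>e\<in>G. (\<forall>g\<in>G. e \<cdot> g = g \<and> g \<cdot> e = g) \<and> (\<forall>g\<in>G. \<exists>h\<in>G. g \<cdot> h = e \<and> h \<cdot> g = e)"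
      by blast
    fix g h assume "g \<in> G" "h \<in> G"
    then obtain g' h' where *: "g \<in> X" "h \<in> X" "g' \<in> X" "h' \<in> X" "e \<cdot> g = g" "e \<cdot> h = h" "e \<cdot> g' = g'"
      "e \<cdot> h' = h'" "g \<cdot> g' = e" "h \<cdot> h' = e"
      unfolding G_def by blast
    have "(g \<cdot> h) \<cdot> (h' \<cdot> g') = g \<cdot> (h \<cdot> h') \<cdot> g'" using *(1-4) by (simp add: assoc)
    also have "\<dots> = e" using * e comm[of g e] by simp
    finally have "(g \<cdot> h) \<cdot> (h' \<cdot> g') = e" .
    moreover have "e \<cdot> (g \<cdot> h) = g \<cdot> h" "e \<cdot> (h' \<cdot> g') = h' \<cdot> g'"
      using * e by (simp_all flip: assoc)
    ultimately show "g \<cdot> h \<in> G" unfolding G_def using * by blast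
  qed
  ultimately show "\<exists>G. group_in X m G \<and> x \<in> G" by blast
qed

end

section \<open>Idempotent ultrafilters\<close>

text \<open>Demanding \<open>X \<in> F\<close> rules out the empty family and, as members are
  nonempty, the empty carrier, so every such filter has an ultrafilter above it.\<close>

definition proper_filter :: "'a set \<Rightarrow> 'a set set \<Rightarrow> bool" where
  "proper_filter X F \<longleftrightarrow> upfamily X F \<and> X \<in> F \<and> (\<forall>A\<in>F. \<forall>B\<in>F. A \<inter> B \<in> F)"

definition ultra :: "'a set \<Rightarrow> 'a set set \<Rightarrow> bool" where
  "ultra X p \<longleftrightarrow> proper_filter X p \<and> (\<forall>A. A \<subseteq> X \<longrightarrow> A \<in> p \<or> X - A \<in> p)"

lemma proper_filterD:
  assumes "proper_filter X F"
  shows "upfamily X F" "X \<in> F" "\<And>A B. A \<in> F \<Longrightarrow> B \<in> F \<Longrightarrow> A \<inter> B \<in> F"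
    "\<And>A. A \<in> F \<Longrightarrow> A \<subseteq> X" "\<And>A. A \<in> F \<Longrightarrow> A \<noteq> {}"
    "\<And>A B. A \<in> F \<Longrightarrow> A \<subseteq> B \<Longrightarrow> B \<subseteq> X \<Longrightarrow> B \<in> F"
  using assms unfolding proper_filter_def
  by (blast, blast, blast, metis upfamily_sub, metis upfamily_nonempty, metis upfamily_mono)

lemma proper_filter_Int:
  assumes "proper_filter X F" "A \<subseteq> X" "B \<subseteq> X"
  shows "A \<inter> B \<in> F \<longleftrightarrow> A \<in> F \<and> B \<in> F"
  using proper_filterD(3)[OF assms(1)] proper_filterD(6)[OF assms(1), of "A \<inter> B"] assms(2,3)
  by (meson Int_lower1 Int_lower2)

lemma ultraD: "ultra X p \<Longrightarrow> proper_filter X p" "ultra X p \<Longrightarrow> A \<subseteq> X \<Longrightarrow> A \<in> p \<or> X - A \<in> p"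
  unfolding ultra_def by auto

lemma ultra_lam: "ultra X p \<Longrightarrow> p \<in> lam X"
proof (rule lamI)
  assume p: "ultra X p"
  note f = proper_filterD[OF ultraD(1)[OF p]]
  show "linked_up X p" unfolding linked_up_def using f(1) f(5)[OF f(3)] by simp
  show "A \<in> p \<or> X - A \<in> p" if "A \<subseteq> X" for A using ultraD(2)[OF p that] .
qed

lemma ultra_maximal:
  assumes "ultra X p" "proper_filter X F" "p \<subseteq> F"
  shows "F = p"
proof -
  have "A \<in> p" if "A \<in> F" for A
    using that ultraD(2)[OF assms(1), of A] proper_filterD[OF assms(2)] assms(3)
    by (metis Diff_disjoint subsetD)
  with assms(3) show ?thesis by blast
qed

text \<open>\<open>G\<close> need only be closed under intersection, so images of filters can be
  adjoined directly. The explicit form of \<open>H\<close> is what later shows that it is the least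
  such filter.\<close>

lemma proper_filter_extend:
  assumes F: "proper_filter X F" and G: "G \<subseteq> Pow X" "X \<in> G" "\<And>A B. A \<in> G \<Longrightarrow> B \<in> G \<Longrightarrow> A \<inter> B \<in> G"
    and meet: "\<And>A B. A \<in> F \<Longrightarrow> B \<in> G \<Longrightarrow> A \<inter> B \<noteq> {}"
  obtains H where "proper_filter X H" "F \<subseteq> H" "G \<subseteq> H"
    "\<And>E. E \<in> H \<longleftrightarrow> E \<subseteq> X \<and> (\<exists>A\<in>F. \<exists>B\<in>G. A \<inter> B \<subseteq> E)"
proof
  define H where "H = {E. E \<subseteq> X \<and> (\<exists>A\<in>F. \<exists>B\<in>G. A \<inter> B \<subseteq> E)}"
  show "E \<in> H \<longleftrightarrow> E \<subseteq> X \<and> (\<exists>A\<in>F. \<exists>B\<in>G. A \<inter> B \<subseteq> E)" for E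
    unfolding H_def by simp
  note f = proper_filterD[OF F]
  show "F \<subseteq> H" using f(4) G(2) unfolding H_def by blast
  then have "X \<in> H" using f(2) by blast
  show "G \<subseteq> H" using f(2) G(1) unfolding H_def by blast
  show "proper_filter X H"
    unfolding proper_filter_def upfamily_def
  proof (intro conjI ballI allI impI)
    show "H \<subseteq> Pow X" unfolding H_def by auto
    show "X \<in> H" by fact
    show "E \<noteq> {}" if "E \<in> H" for E using that meet unfolding H_def by fastforce
    show "E' \<in> H" if E: "E \<in> H" "E \<subseteq> E' \<and> E' \<subseteq> X" for E E'
    proof -
      obtain A B where "A \<in> F" "B \<in> G" "A \<inter> B \<subseteq> E" using E(1) unfolding H_def by auto
      moreover from this have "A \<inter> B \<subseteq> E'" using E(2) by (meson subset_trans)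
      ultimately show ?thesis using E(2) unfolding H_def by blast
    qed
    fix E E' assume "E \<in> H" "E' \<in> H"
    then obtain A B A' B' where *: "E \<subseteq> X" "A \<in> F" "B \<in> G" "A \<inter> B \<subseteq> E" "A' \<in> F" "B' \<in> G" "A' \<inter> B' \<subseteq> E'"
      unfolding H_def by auto
    then have "(A \<inter> A') \<inter> (B \<inter> B') \<subseteq> E \<inter> E'" by auto
    moreover have "E \<inter> E' \<subseteq> X" "A \<inter> A' \<in> F" "B \<inter> B' \<in> G" using * f(3) G(3) by auto
    ultimately show "E \<inter> E' \<in> H" unfolding H_def by blast
  qed
qed

lemma proper_filter_insert:
  assumes F: "proper_filter X F" and A: "A \<subseteq> X" "\<And>B. B \<in> F \<Longrightarrow> B \<inter> A \<noteq> {}"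
  obtains H where "proper_filter X H" "F \<subseteq> H" "A \<in> H"
proof -
  have "{X, A} \<subseteq> Pow X" "X \<in> {X, A}" using A by auto
  moreover have "B \<inter> C \<in> {X, A}" if "B \<in> {X, A}" "C \<in> {X, A}" for B C using that A by auto
  moreover have "B \<inter> C \<noteq> {}" if "B \<in> F" "C \<in> {X, A}" for B C
    using that A proper_filterD(4,5)[OF F that(1)] by (auto simp: Int_absorb2)
  ultimately obtain H where "proper_filter X H" "F \<subseteq> H" "{X, A} \<subseteq> H"
    by (rule proper_filter_extend[OF F])
  then show ?thesis using that by blast
qed

lemma proper_filter_chain:
  assumes "C \<noteq> {}" "subset.chain \<A> C" "\<And>F. F \<in> \<A> \<Longrightarrow> proper_filter X F"
  shows "proper_filter X (\<Union>C)"
proof -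
  have C: "proper_filter X F" if "F \<in> C" for F
    using assms that unfolding subset.chain_def by blast
  show ?thesis
    unfolding proper_filter_def upfamily_def
  proof (intro conjI ballI allI impI)
    show "\<Union>C \<subseteq> Pow X" using C proper_filterD(4) by fastforce
    show "X \<in> \<Union>C" using C proper_filterD(2) assms(1) by fastforce
    show "A \<noteq> {}" if "A \<in> \<Union>C" for A using C proper_filterD(5) that by fastforce
    show "B \<in> \<Union>C" if "A \<in> \<Union>C" "A \<subseteq> B \<and> B \<subseteq> X" for A B
    proof -
      obtain F where "F \<in> C" "A \<in> F" using \<open>A \<in> \<Union>C\<close> by blast
      then show ?thesis using proper_filterD(6)[OF C, of F A B] that(2) by (intro UnionI[of F]) auto
    qed
    fix A B assume "A \<in> \<Union>C" "B \<in> \<Union>C"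
    then obtain F where "F \<in> C" "A \<in> F" "B \<in> F"
      using assms(2) unfolding subset.chain_def by blast
    then show "A \<inter> B \<in> \<Union>C" using C proper_filterD(3) by blast
  qed
qed

text \<open>A maximal filter above \<open>F\<close> decides \<open>A\<close>: if the complement is
  not a member, every member meets \<open>A\<close>, and \<open>A\<close> could be adjoined.\<close>

lemma ultra_extend:
  assumes F: "proper_filter X F"
  obtains p where "ultra X p" "F \<subseteq> p"
proof -
  define \<A> where "\<A> = {G. proper_filter X G \<and> F \<subseteq> G}"
  have "\<exists>M\<in>\<A>. \<forall>G\<in>\<A>. M \<subseteq> G \<longrightarrow> G = M"
  proof (rule subset_Zorn_nonempty)
    show "\<A> \<noteq> {}" using F unfolding \<A>_def by blast
    show "\<Union>C \<in> \<A>" if C: "C \<noteq> {}" "subset.chain \<A> C" for C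
      using proper_filter_chain[OF C] C unfolding \<A>_def subset.chain_def by blast
  qed
  then obtain M where M: "proper_filter X M" "F \<subseteq> M"
    and max: "\<And>G. proper_filter X G \<Longrightarrow> M \<subseteq> G \<Longrightarrow> G = M"
    unfolding \<A>_def by (auto intro: subset_trans)
  have "A \<in> M \<or> X - A \<in> M" if A: "A \<subseteq> X" for A
  proof (rule ccontr)
    assume n: "\<not> ?thesis"
    have "B \<inter> A \<noteq> {}" if "B \<in> M" for B
    proof
      assume "B \<inter> A = {}"
      then have "B \<subseteq> X - A" using proper_filterD(4)[OF M(1) that] by blast
      then show False using n proper_filterD(6)[OF M(1) that] by blast
    qed
    then obtain H where "proper_filter X H" "M \<subseteq> H" "A \<in> H"
      using proper_filter_insert[OF M(1) A] by blast
    then show False using max n by blast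
  qed
  then show ?thesis using that[of M] M unfolding ultra_def by blast
qed

text \<open>A filter is the intersection of the ultrafilters above it: otherwise the complement of
  \<open>A\<close> could be adjoined and the result extended.\<close>

lemma ultra_separate:
  assumes F: "proper_filter X F" and A: "A \<subseteq> X" "\<And>p. ultra X p \<Longrightarrow> F \<subseteq> p \<Longrightarrow> A \<in> p"
  shows "A \<in> F"
proof (rule ccontr)
  assume n: "A \<notin> F"
  have "B \<inter> (X - A) \<noteq> {}" if "B \<in> F" for B
  proof
    assume "B \<inter> (X - A) = {}"
    then have "B \<subseteq> A" using proper_filterD(4)[OF F that] by blast
    then show False using n A proper_filterD(6)[OF F that] by blast
  qed
  then obtain H where H: "proper_filter X H" "F \<subseteq> H" "X - A \<in> H"
    using proper_filter_insert[OF F, of "X - A"] by blast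
  obtain p where p: "ultra X p" "H \<subseteq> p" using ultra_extend[OF H(1)] .
  then have "A \<in> p" "X - A \<in> p" using A(2) H by auto
  then have "A \<inter> (X - A) \<in> p" using proper_filterD(3)[OF ultraD(1)[OF p(1)]] by blast
  then show False using proper_filterD(5)[OF ultraD(1)[OF p(1)]] by fastforce
qed

context sgrp
begin

lemma pre_top: "x \<in> X \<Longrightarrow> pre x X = X"
  by auto

lemma pre_Int:
  assumes "proper_filter X q"
  shows "{x \<in> X. pre x (A \<inter> B) \<in> q} = {x \<in> X. pre x A \<in> q} \<inter> {x \<in> X. pre x B \<in> q}"
proof -
  have e: "pre x (A \<inter> B) = pre x A \<inter> pre x B" for x by auto
  have "pre x A \<inter> pre x B \<in> q \<longleftrightarrow> pre x A \<in> q \<and> pre x B \<in> q" for x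
    by (rule proper_filter_Int[OF assms]) auto
  then show ?thesis unfolding e by auto
qed

lemma um_proper_filter:
  assumes F: "proper_filter X F" and G: "proper_filter X G"
  shows "proper_filter X (F \<star> G)"
proof -
  note f = proper_filterD[OF F] and g = proper_filterD[OF G]
  note iff = um_iff[OF f(1) g(1)]
  have "{x \<in> X. pre x X \<in> G} = X" using g(2) by (auto simp: pre_top)
  then have "X \<in> F \<star> G" using f(2) by (simp add: iff)
  moreover have "A \<inter> B \<in> F \<star> G" if "A \<in> F \<star> G" "B \<in> F \<star> G" for A B
  proof -
    have "{x \<in> X. pre x A \<in> G} \<inter> {x \<in> X. pre x B \<in> G} \<in> F"
      using that f(3) by (simp add: iff)
    then have "{x \<in> X. pre x (A \<inter> B) \<in> G} \<in> F" by (simp only: pre_Int[OF G])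
    moreover have "A \<inter> B \<subseteq> X" using that(1) unfolding iff by blast
    ultimately show ?thesis unfolding iff by simp
  qed
  ultimately show ?thesis
    using um_upfamily[OF f(1) g(1)] unfolding proper_filter_def by blast
qed

lemma um_ultra:
  assumes "ultra X p" "ultra X q"
  shows "ultra X (p \<star> q)"
proof (cases "X = {}")
  case True
  then show ?thesis
    using assms proper_filterD(2,5)[OF ultraD(1)] by blast
next
  case False
  then show ?thesis
    using um_proper_filter[OF assms[THEN ultraD(1)]]
      lam_dichotomy[OF False um_lam[OF assms[THEN ultra_lam]]] unfolding ultra_def by blast
qed

text \<open>In closed-set terms, right multiplication by \<open>q\<close> maps the set of
  \<open>F\<close> onto the set of \<open>F \<star> q\<close>. A factor \<open>p\<close> of
  \<open>r\<close> must contain all \<open>T A\<close> with \<open>A \<in> r\<close>. These are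
  compatible with \<open>F\<close>: a member of \<open>F\<close> missing \<open>T B\<close> would
  put \<open>X - B\<close> into \<open>F \<star> q\<close> and thus into \<open>r\<close>.\<close>

lemma ultra_factor:
  assumes F: "proper_filter X F" and q: "ultra X q" and r: "ultra X r" "F \<star> q \<subseteq> r"
  obtains p where "ultra X p" "F \<subseteq> p" "p \<star> q = r"
proof -
  define T where "T A = {x \<in> X. pre x A \<in> q}" for A
  define G where "G = T ` r"
  have fq: "proper_filter X q" and fr: "proper_filter X r" using q r ultraD by auto
  note iff = um_iff[OF proper_filterD(1)[OF F] proper_filterD(1)[OF fq], folded T_def]
  have TI: "T (A \<inter> B) = T A \<inter> T B" for A B
    unfolding T_def by (rule pre_Int[OF fq])
  have TX: "T X = X" unfolding T_def using proper_filterD(2)[OF fq] by (auto simp: pre_top)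
  have "A \<inter> T B \<noteq> {}" if "A \<in> F" "B \<in> r" for A B
  proof
    assume e: "A \<inter> T B = {}"
    have B: "B \<subseteq> X" using proper_filterD(4)[OF fr that(2)] .
    have "A \<subseteq> T (X - B)"
    proof
      fix x assume "x \<in> A"
      then have x: "x \<in> X" "pre x B \<notin> q" using e proper_filterD(4)[OF F that(1)] unfolding T_def by auto
      have "X - pre x B \<in> q" using ultraD(2)[OF q, of "pre x B"] x by auto
      moreover have "X - pre x B = pre x (X - B)" using x by auto
      ultimately show "x \<in> T (X - B)" unfolding T_def using x by simp
    qed
    then have "T (X - B) \<in> F" using proper_filterD(6)[OF F that(1)] unfolding T_def by auto
    then have "X - B \<in> r" using r(2) iff by blast
    then have "B \<inter> (X - B) \<in> r" using proper_filterD(3)[OF fr that(2)] by blast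
    then show False using proper_filterD(5)[OF fr] by fastforce
  qed
  then have meet: "A \<inter> B \<noteq> {}" if "A \<in> F" "B \<in> G" for A B using that unfolding G_def by blast
  have GX: "X \<in> G" using TX proper_filterD(2)[OF fr] unfolding G_def by (metis imageI)
  have GInt: "A \<inter> B \<in> G" if AB: "A \<in> G" "B \<in> G" for A B
  proof -
    obtain A' B' where "A = T A'" "B = T B'" "A' \<in> r" "B' \<in> r" using AB unfolding G_def by auto
    then show ?thesis using TI[of A' B'] proper_filterD(3)[OF fr, of A' B'] unfolding G_def by (metis imageI)
  qed
  have GP: "G \<subseteq> Pow X" unfolding G_def T_def by auto
  obtain H where H: "proper_filter X H" "F \<subseteq> H" "G \<subseteq> H"
    proof (rule proper_filter_extend[OF F GP GX GInt meet], goal_cases)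
    case (5 H)
    show ?case by (rule 5(1)) (fact 5)+
  qed
  obtain p where p: "ultra X p" "H \<subseteq> p" using ultra_extend[OF H(1)] .
  have "r \<subseteq> p \<star> q"
  proof
    fix A assume A: "A \<in> r"
    then have "T A \<in> p" using H p unfolding G_def by blast
    then show "A \<in> p \<star> q"
      using um_iff[OF proper_filterD(1)[OF ultraD(1)[OF p(1)]] proper_filterD(1)[OF fq]]
        proper_filterD(4)[OF fr A] unfolding T_def by blast
  qed
  then have "p \<star> q = r"
    using ultra_maximal[OF r(1)] ultraD(1)[OF um_ultra[OF p(1) q]] by blast
  then show ?thesis using that p H by blast
qed

text \<open>Ellis' lemma. A filter \<open>F\<close> stands for the closed set of ultrafilters containing it, and the
  hypothesis says that this closed set is a subsemigroup.\<close>

lemma idempotent_ultra: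
  assumes F0: "proper_filter X F0"
    and sub: "\<And>p q. ultra X p \<Longrightarrow> ultra X q \<Longrightarrow> F0 \<subseteq> p \<Longrightarrow> F0 \<subseteq> q \<Longrightarrow> F0 \<subseteq> p \<star> q"
  obtains p where "ultra X p" "F0 \<subseteq> p" "p \<star> p = p"
proof -
  \<comment> \<open>\<open>S\<close> describes closed subsemigroups. Larger filters are smaller
    closed sets, so a maximal filter is a minimal closed subsemigroup \<open>K\<close>.\<close>
  define S where "S F \<longleftrightarrow> proper_filter X F \<and> F0 \<subseteq> F \<and>
    (\<forall>p q. ultra X p \<and> ultra X q \<and> F \<subseteq> p \<and> F \<subseteq> q \<longrightarrow> F \<subseteq> p \<star> q)" for F
  have "\<exists>M\<in>Collect S. \<forall>G\<in>Collect S. M \<subseteq> G \<longrightarrow> G = M"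
  proof (rule subset_Zorn_nonempty)
    show "Collect S \<noteq> {}" using F0 sub unfolding S_def by blast
    show "\<Union>C \<in> Collect S" if C: "C \<noteq> {}" "subset.chain (Collect S) C" for C
    proof -
      have SC: "S F" if "F \<in> C" for F using C(2) that unfolding subset.chain_def by blast
      have "proper_filter X (\<Union>C)"
        using proper_filter_chain[OF C] unfolding S_def by blast
      moreover have "F0 \<subseteq> \<Union>C" using SC C(1) unfolding S_def by blast
      moreover have "\<Union>C \<subseteq> p \<star> q" if "ultra X p" "ultra X q" "\<Union>C \<subseteq> p" "\<Union>C \<subseteq> q" for p q
      proof (rule Union_least)
        fix F assume "F \<in> C"
        then show "F \<subseteq> p \<star> q" using that SC[of F] unfolding S_def by (meson Union_upper subset_trans)
      qed
      ultimately show ?thesis unfolding S_def by blast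
    qed
  qed
  then obtain F where F: "S F" and max: "\<And>G. S G \<Longrightarrow> F \<subseteq> G \<Longrightarrow> G = F" by blast
  have fF: "proper_filter X F" and F0F: "F0 \<subseteq> F"
    and Fsub: "\<And>p q. ultra X p \<Longrightarrow> ultra X q \<Longrightarrow> F \<subseteq> p \<Longrightarrow> F \<subseteq> q \<Longrightarrow> F \<subseteq> p \<star> q"
    using F unfolding S_def by auto
  obtain q where q: "ultra X q" "F \<subseteq> q" using ultra_extend[OF fF] .
  have fq: "proper_filter X q" using ultraD(1)[OF q(1)] .
  have ulam: "upfamily X p" if "ultra X p" for p using proper_filterD(1)[OF ultraD(1)[OF that]] .
  have FFq: "F \<subseteq> F \<star> q"
  proof
    fix A assume A: "A \<in> F"
    have "{x \<in> X. pre x A \<in> q} \<in> F"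
    proof (rule ultra_separate[OF fF])
      fix p assume p: "ultra X p" "F \<subseteq> p"
      then have "A \<in> p \<star> q" using Fsub q A by blast
      then show "{x \<in> X. pre x A \<in> q} \<in> p" using um_iff[OF ulam[OF p(1)] ulam[OF q(1)]] by blast
    qed auto
    then show "A \<in> F \<star> q"
      using um_iff[OF proper_filterD(1)[OF fF] ulam[OF q(1)]] proper_filterD(4)[OF fF A] by blast
  qed
  \<comment> \<open>\<open>K \<star> q\<close> is a closed subsemigroup inside \<open>K\<close>, so
    it is all of \<open>K\<close>; in particular \<open>q = p \<star> q\<close> for some
    \<open>p\<close> in \<open>K\<close>.\<close>
  have "S (F \<star> q)"
    unfolding S_def
  proof (intro conjI allI impI)
    show "proper_filter X (F \<star> q)" using um_proper_filter[OF fF fq] .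
    show "F0 \<subseteq> F \<star> q" using F0F FFq by blast
    fix r s assume rs: "ultra X r \<and> ultra X s \<and> F \<star> q \<subseteq> r \<and> F \<star> q \<subseteq> s"
    obtain p where p: "ultra X p" "F \<subseteq> p" "p \<star> q = r" using ultra_factor[OF fF q(1), of r] rs by blast
    obtain p' where p': "ultra X p'" "F \<subseteq> p'" "p' \<star> q = s" using ultra_factor[OF fF q(1), of s] rs by blast
    have "F \<subseteq> p \<star> q \<star> p'"
      using Fsub[OF um_ultra[OF p(1) q(1)] p'(1) Fsub[OF p(1) q(1) p(2) q(2)] p'(2)] .
    then have "F \<star> q \<subseteq> (p \<star> q \<star> p') \<star> q" by (rule um_mono) simp
    also have "\<dots> = r \<star> s"
      using um_assoc[of "p \<star> q" p' q] ulam p p' q um_ultra by auto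
    finally show "F \<star> q \<subseteq> r \<star> s" .
  qed
  then have "F \<star> q = F" using max FFq by blast
  then obtain p where p: "ultra X p" "F \<subseteq> p" "p \<star> q = q" using ultra_factor[OF fF q(1) q(1)] q by metis
  define T where "T A = {x \<in> X. pre x A \<in> q}" for A
  have Tiff: "p' \<star> q = q \<longleftrightarrow> T ` q \<subseteq> p'" if "ultra X p'" for p'
  proof
    assume e: "p' \<star> q = q"
    show "T ` q \<subseteq> p'" using um_iff[OF ulam[OF that] ulam[OF q(1)]] unfolding e T_def by blast
  next
    assume "T ` q \<subseteq> p'"
    then have "q \<subseteq> p' \<star> q"
      using um_iff[OF ulam[OF that] ulam[OF q(1)]] proper_filterD(4)[OF fq] unfolding T_def by blast
    then show "p' \<star> q = q"
      using ultra_maximal[OF q(1)] ultraD(1)[OF um_ultra[OF that q(1)]] by blast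
  qed
  have Tp: "T ` q \<subseteq> p" using Tiff p by blast
  have TI: "T A \<inter> T B = T (A \<inter> B)" for A B
    unfolding T_def by (rule pre_Int[OF fq, symmetric])
  have "T X = X" unfolding T_def using proper_filterD(2)[OF fq] by (auto simp: pre_top)
  then have TX: "X \<in> T ` q" using proper_filterD(2)[OF fq] by (metis imageI)
  have TInt: "A \<inter> B \<in> T ` q" if AB: "A \<in> T ` q" "B \<in> T ` q" for A B
  proof -
    obtain A' B' where "A = T A'" "B = T B'" "A' \<in> q" "B' \<in> q" using AB by auto
    then show ?thesis using TI[of A' B'] proper_filterD(3)[OF fq, of A' B'] by (metis imageI)
  qed
  have TP: "T ` q \<subseteq> Pow X" unfolding T_def by auto
  have Tmeet: "A \<inter> B \<noteq> {}" if "A \<in> F" "B \<in> T ` q" for A B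
  proof -
    have "A \<in> p" "B \<in> p" using that p(2) Tp by auto
    then show ?thesis using proper_filterD(5)[OF ultraD(1)[OF p(1)] proper_filterD(3)[OF ultraD(1)[OF p(1)]]] by simp
  qed
  obtain H where H: "proper_filter X H" "F \<subseteq> H" "T ` q \<subseteq> H"
    "\<And>E. E \<in> H \<longleftrightarrow> E \<subseteq> X \<and> (\<exists>A\<in>F. \<exists>B\<in>T ` q. A \<inter> B \<subseteq> E)"
    proof (rule proper_filter_extend[OF fF TP TX TInt Tmeet], goal_cases)
    case (5 H)
    show ?case by (rule 5(1)) (fact 5)+
  qed
  have least: "H \<subseteq> p'" if "ultra X p'" "F \<subseteq> p'" "T ` q \<subseteq> p'" for p'
  proof
    fix E assume "E \<in> H"
    then have "E \<subseteq> X" "\<exists>A\<in>F. \<exists>B\<in>T ` q. A \<inter> B \<subseteq> E" by (simp_all only: H(4))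
    moreover from this obtain A B where "A \<in> F" "B \<in> T ` q" "A \<inter> B \<subseteq> E" by auto
    moreover from this have "A \<in> p'" "B \<in> p'" using that(2,3) by auto
    ultimately have "E \<subseteq> X" "A \<in> p'" "B \<in> p'" "A \<inter> B \<subseteq> E" by auto
    then show "E \<in> p'"
      using proper_filterD(3)[OF ultraD(1)[OF that(1)], of A B]
        proper_filterD(6)[OF ultraD(1)[OF that(1)], of "A \<inter> B" E] by simp
  qed
  \<comment> \<open>\<open>H\<close> stands for the elements of \<open>K\<close> fixing
    \<open>q\<close> from the left. They form a nonempty closed subsemigroup, so by minimality they
    are all of \<open>K\<close>, including \<open>q\<close> itself.\<close>
  have "S H"
    unfolding S_def
  proof (intro conjI allI impI)
    show "proper_filter X H" "F0 \<subseteq> H" using H F0F by auto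
    fix r s assume rs: "ultra X r \<and> ultra X s \<and> H \<subseteq> r \<and> H \<subseteq> s"
    then have "r \<star> q = q" "s \<star> q = q" using Tiff H(3) by (meson subset_trans)+
    then have "(r \<star> s) \<star> q = q" using um_assoc[of r s q] ulam rs q by auto
    moreover have u: "ultra X (r \<star> s)" using um_ultra rs by blast
    ultimately have "T ` q \<subseteq> r \<star> s" using Tiff by blast
    moreover have "F \<subseteq> r \<star> s" using Fsub rs H(2) by (meson subset_trans)
    ultimately show "H \<subseteq> r \<star> s" using least u by blast
  qed
  then have "T ` q \<subseteq> q" using max H q by blast
  then have "q \<star> q = q" using Tiff q by blast
  then show ?thesis using that q F0F by blast
qed

end

section \<open>Sequences forbidden by commuting idempotents\<close>

text \<open>Products of terms with strictly increasing indices from \<open>I\<close>. The first and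
  last index are recorded because they are what distinguishes the two orders of
  multiplication.\<close>

inductive oprod :: "('a \<Rightarrow> 'a \<Rightarrow> 'a) \<Rightarrow> (nat \<Rightarrow> 'a) \<Rightarrow> nat set \<Rightarrow> nat \<Rightarrow> nat \<Rightarrow> 'a \<Rightarrow> bool"
  for m x I where
  oprod_single: "i \<in> I \<Longrightarrow> oprod m x I i i (x i)"
| oprod_snoc: "oprod m x I i j a \<Longrightarrow> j < k \<Longrightarrow> k \<in> I \<Longrightarrow> oprod m x I i k (m a (x k))"

lemma oprod_index: "oprod m x I i j a \<Longrightarrow> i \<in> I \<and> j \<in> I \<and> i \<le> j"
  by (induction rule: oprod.induct) auto

lemma oprod_mono: "oprod m x I i j a \<Longrightarrow> I \<subseteq> J \<Longrightarrow> oprod m x J i j a"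
  by (induction rule: oprod.induct) (auto intro: oprod.intros)

text \<open>The exponent is shifted, \<open>pw m x n\<close> being the power with
  \<open>n + 1\<close> factors, since there need be no identity. This accounts for the
  \<open>Suc\<close> in \<open>pw_add\<close>.\<close>

primrec pw :: "('a \<Rightarrow> 'a \<Rightarrow> 'a) \<Rightarrow> 'a \<Rightarrow> nat \<Rightarrow> 'a" where
  "pw m x 0 = x"
| "pw m x (Suc n) = m (pw m x n) x"

context sgrp
begin

lemma pw_closed [simp, intro]: "x \<in> X \<Longrightarrow> pw m x n \<in> X"
  by (induction n) auto

lemma pw_add: "x \<in> X \<Longrightarrow> pw m x a \<cdot> pw m x b = pw m x (Suc (a + b))"
  by (induction b) (auto simp flip: assoc)

lemma oprod_closed: "oprod m x I i j a \<Longrightarrow> (\<And>n. x n \<in> X) \<Longrightarrow> a \<in> X"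
  by (induction rule: oprod.induct) auto

lemma oprod_append:
  assumes x: "\<And>n. x n \<in> X" and a: "oprod m x I i j a" and b: "oprod m x I k l b" and "j < k"
  shows "oprod m x I i l (a \<cdot> b)"
  using b \<open>j < k\<close>
proof (induction rule: oprod.induct)
  case (oprod_single k)
  then show ?case using a by (intro oprod.oprod_snoc) auto
next
  case (oprod_snoc k l b n)
  have "a \<in> X" "b \<in> X" using a oprod_snoc.hyps(1) oprod_closed x by blast+
  then have "a \<cdot> (b \<cdot> x n) = a \<cdot> b \<cdot> x n" using x by (simp add: assoc)
  then show ?case using oprod_snoc by (auto intro: oprod.oprod_snoc)
qed

text \<open>The filter generated by the tails \<open>P k\<close> is a closed subsemigroup: a product
  ending at \<open>j\<close> may be followed by any product starting at \<open>Suc j\<close> or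
  later, and the first index does not change.\<close>

lemma idempotent_ultra_oprod:
  assumes x: "\<And>n. x n \<in> X" and I: "infinite I"
  obtains p where "ultra X p" "p \<star> p = p" "\<And>k. {a. \<exists>i j. k \<le> i \<and> oprod m x I i j a} \<in> p"
proof -
  define P where "P k = {a. \<exists>i j. k \<le> i \<and> oprod m x I i j a}" for k
  define F where "F = {A. A \<subseteq> X \<and> (\<exists>k. P k \<subseteq> A)}"
  have PX: "P k \<subseteq> X" for k unfolding P_def using oprod_closed x by blast
  have PF: "P k \<in> F" for k unfolding F_def using PX by blast
  have Pne: "P k \<noteq> {}" for k
  proof -
    obtain i where "k \<le> i" "i \<in> I" using I unfolding finite_nat_set_iff_bounded by (meson not_less)
    then show ?thesis unfolding P_def using oprod_single by fastforce
  qed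
  have Pmono: "P k \<subseteq> P l" if "l \<le> k" for k l
    unfolding P_def using that order_trans by blast
  have F: "proper_filter X F"
    unfolding proper_filter_def upfamily_def
  proof (intro conjI ballI allI impI)
    show "F \<subseteq> Pow X" unfolding F_def by auto
    show "A \<noteq> {}" if "A \<in> F" for A using that Pne unfolding F_def by blast
    show "B \<in> F" if "A \<in> F" "A \<subseteq> B \<and> B \<subseteq> X" for A B
      using that order_trans unfolding F_def by blast
    show "X \<in> F" using PX unfolding F_def by blast
    fix A B assume "A \<in> F" "B \<in> F"
    then obtain k l where *: "A \<subseteq> X" "P k \<subseteq> A" "P l \<subseteq> B" unfolding F_def by auto
    then have "P (max k l) \<subseteq> A \<inter> B" using Pmono[of k "max k l"] Pmono[of l "max k l"] by auto
    then show "A \<inter> B \<in> F" using * unfolding F_def by auto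
  qed
  have "F \<subseteq> p \<star> q" if p: "ultra X p" and q: "ultra X q" and Fp: "F \<subseteq> p" and Fq: "F \<subseteq> q" for p q
  proof
    fix A assume "A \<in> F"
    then obtain k where A: "A \<subseteq> X" "P k \<subseteq> A" unfolding F_def by auto
    note fp = ultraD(1)[OF p] and fq = ultraD(1)[OF q]
    have "P k \<subseteq> {a \<in> X. pre a A \<in> q}"
    proof
      fix a assume a: "a \<in> P k"
      then obtain i j where ij: "k \<le> i" "oprod m x I i j a" unfolding P_def by auto
      have "P (Suc j) \<subseteq> pre a A"
      proof
        fix b assume b: "b \<in> P (Suc j)"
        then obtain k' l where "Suc j \<le> k'" "oprod m x I k' l b" unfolding P_def by auto
        then have "oprod m x I i l (a \<cdot> b)" using oprod_append[OF x ij(2)] by auto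
        then have "a \<cdot> b \<in> P k" using ij(1) unfolding P_def by auto
        then show "b \<in> pre a A" using A b PX by auto
      qed
      moreover have "P (Suc j) \<in> q" using PF Fq by auto
      ultimately have "pre a A \<in> q" using proper_filterD(6)[OF fq, of "P (Suc j)" "pre a A"] by auto
      then show "a \<in> {a \<in> X. pre a A \<in> q}" using a PX by auto
    qed
    moreover have "P k \<in> p" using PF Fp by auto
    ultimately have "{a \<in> X. pre a A \<in> q} \<in> p"
      using proper_filterD(6)[OF fp, of "P k" "{a \<in> X. pre a A \<in> q}"] by auto
    then show "A \<in> p \<star> q"
      using um_iff[OF proper_filterD(1)[OF fp] proper_filterD(1)[OF fq]] A by simp
  qed
  then obtain p where "ultra X p" "F \<subseteq> p" "p \<star> p = p" by (rule idempotent_ultra[OF F])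
  then show ?thesis using that[of p] PF unfolding P_def by blast
qed

end

locale icsgrp = sgrp +
  assumes ic: "idempotents_commute (lam X) (upmult X m)"
begin

lemma idempotents_swap:
  "U \<in> lam X \<Longrightarrow> V \<in> lam X \<Longrightarrow> U \<star> U = U \<Longrightarrow> V \<star> V = V \<Longrightarrow> U \<star> V = V \<star> U"
  using ic unfolding idempotents_commute_def by blast

lemma idem_comm:
  assumes "e \<in> X" "f \<in> X" "e \<cdot> e = e" "f \<cdot> f = f"
  shows "e \<cdot> f = f \<cdot> e"
  using idempotents_swap[of "point e" "point f"] assms by (simp add: point_um point_inj)

text \<open>In the convolution of an idempotent carried by the even-indexed products and one carried by
  the odd-indexed products, the order of the factors can be read off the extreme indices.\<close>

lemma no_oprod_sequence:
  assumes x: "\<And>n. x n \<in> X"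
    and disj: "\<And>i j i' j' a. oprod m x UNIV i j a \<Longrightarrow> oprod m x UNIV i' j' a \<Longrightarrow>
      even i \<Longrightarrow> odd j \<Longrightarrow> odd i' \<Longrightarrow> even j' \<Longrightarrow> False"
  shows False
proof -
  \<comment> \<open>The convolution \<open>p \<star> q\<close> is carried by products that start in
    \<open>I\<close> and end in \<open>J\<close>, since almost every right factor starts after the
    left one has ended.\<close>
  have sep: "{a. \<exists>i j. i \<in> I \<and> j \<in> J \<and> oprod m x UNIV i j a} \<in> p \<star> q"
    if p: "ultra X p" "\<And>k. {a. \<exists>i j. k \<le> i \<and> oprod m x I i j a} \<in> p"
      and q: "ultra X q" "\<And>k. {a. \<exists>i j. k \<le> i \<and> oprod m x J i j a} \<in> q" for I J p q
  proof -
    define A where "A = {a. \<exists>i j. i \<in> I \<and> j \<in> J \<and> oprod m x UNIV i j a}"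
    note fp = ultraD(1)[OF p(1)] and fq = ultraD(1)[OF q(1)]
    have AX: "A \<subseteq> X" unfolding A_def using oprod_closed x by blast
    have "{a. \<exists>i j. 0 \<le> i \<and> oprod m x I i j a} \<subseteq> {a \<in> X. pre a A \<in> q}"
    proof
      fix a assume "a \<in> {a. \<exists>i j. 0 \<le> i \<and> oprod m x I i j a}"
      then obtain i j where ij: "oprod m x I i j a" by auto
      have "{a. \<exists>i j'. Suc j \<le> i \<and> oprod m x J i j' a} \<subseteq> pre a A"
      proof
        fix b assume "b \<in> {a. \<exists>i j'. Suc j \<le> i \<and> oprod m x J i j' a}"
        then obtain k l where kl: "Suc j \<le> k" "oprod m x J k l b" by auto
        have "oprod m x UNIV i l (a \<cdot> b)"
          by (rule oprod_append[OF x oprod_mono[OF ij] oprod_mono[OF kl(2)]]) (use kl in auto)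
        then show "b \<in> pre a A"
          unfolding A_def using oprod_index[OF ij] oprod_index[OF kl(2)] oprod_closed[OF kl(2) x] by auto
      qed
      then have "pre a A \<in> q" by (rule proper_filterD(6)[OF fq q(2)]) auto
      then show "a \<in> {a \<in> X. pre a A \<in> q}" using oprod_closed[OF ij x] by auto
    qed
    then have "{a \<in> X. pre a A \<in> q} \<in> p" by (rule proper_filterD(6)[OF fp p(2)]) auto
    then show ?thesis
      using um_iff[OF proper_filterD(1)[OF fp] proper_filterD(1)[OF fq]] AX unfolding A_def by simp
  qed
  have inf: "infinite {n::nat. even n}" "infinite {n::nat. odd n}"
    unfolding finite_nat_set_iff_bounded by (metis even_Suc less_SucI less_irrefl mem_Collect_eq)+
  obtain p where p: "ultra X p" "p \<star> p = p" "\<And>k. {a. \<exists>i j. k \<le> i \<and> oprod m x {n. even n} i j a} \<in> p"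
    proof (rule idempotent_ultra_oprod[of x, OF x inf(1)], goal_cases)
    case (1 p)
    show ?case by (rule 1(1)) (fact 1)+
  qed
  obtain q where q: "ultra X q" "q \<star> q = q" "\<And>k. {a. \<exists>i j. k \<le> i \<and> oprod m x {n. odd n} i j a} \<in> q"
    proof (rule idempotent_ultra_oprod[of x, OF x inf(2)], goal_cases)
    case (1 p)
    show ?case by (rule 1(1)) (fact 1)+
  qed
  note pq = sep[OF p(1,3) q(1,3)] and qp = sep[OF q(1,3) p(1,3)]
  have "p \<star> q = q \<star> p"
    by (rule idempotents_swap[OF ultra_lam[OF p(1)] ultra_lam[OF q(1)] p(2) q(2)])
  note linked_meet[OF lam_linked[OF ultra_lam[OF um_ultra[OF p(1) q(1)]]] pq qp[folded this]]
  then show False using disj by blast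
qed

text \<open>A sequence is chosen greedily so that each product reveals its last index. By
  cancellation each equation \<open>a \<cdot> y = c\<close> has at most one solution, so only
  finitely many choices of the next term are bad.\<close>

lemma no_infinite_cancellative:
  assumes Z: "Z \<subseteq> X" "infinite Z" "\<And>a b. a \<in> Z \<Longrightarrow> b \<in> Z \<Longrightarrow> a \<cdot> b \<in> Z"
    and canc: "\<And>a b c. a \<in> Z \<Longrightarrow> b \<in> Z \<Longrightarrow> c \<in> Z \<Longrightarrow> a \<cdot> b = a \<cdot> c \<Longrightarrow> b = c"
  shows False
proof -
  define P where "P s \<longleftrightarrow> finite (fst s) \<and> fst s \<subseteq> Z \<and> snd s \<in> Z \<and> snd s \<notin> fst s \<and>
    (\<forall>a\<in>fst s. a \<cdot> snd s \<notin> fst s)" for s :: "'a set \<times> 'a"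
  have ex: "\<exists>y. P (F, y)" if F: "finite F" "F \<subseteq> Z" for F
  proof -
    have "finite {y \<in> Z. a \<cdot> y \<in> F}" if "a \<in> F" for a
    proof (rule finite_imageD)
      show "finite (m a ` {y \<in> Z. a \<cdot> y \<in> F})"
        using F(1) by (rule finite_subset[rotated]) auto
      show "inj_on (m a) {y \<in> Z. a \<cdot> y \<in> F}" using canc[of a] that F(2) by (auto intro!: inj_onI)
    qed
    then have "finite (F \<union> (\<Union>a\<in>F. {y \<in> Z. a \<cdot> y \<in> F}))" using F by auto
    then have "infinite (Z - (F \<union> (\<Union>a\<in>F. {y \<in> Z. a \<cdot> y \<in> F})))" using Z(2) by auto
    then obtain y where "y \<in> Z - (F \<union> (\<Union>a\<in>F. {y \<in> Z. a \<cdot> y \<in> F}))"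
      using infinite_imp_nonempty by blast
    then show ?thesis unfolding P_def using F by auto
  qed
  \<comment> \<open>A state pairs a finite set containing all ordered products of the earlier terms
    with the next term.\<close>
  have "\<exists>s. \<forall>n. P (s n) \<and> fst (s (Suc n)) = fst (s n) \<union> {snd (s n)} \<union> (\<lambda>a. a \<cdot> snd (s n)) ` fst (s n)"
  proof (rule dependent_nat_choice)
    show "\<exists>s. P s" using ex[of "{}"] by auto
    fix s :: "'a set \<times> 'a" and n :: nat assume s: "P s"
    then have "\<exists>y. P (fst s \<union> {snd s} \<union> (\<lambda>a. a \<cdot> snd s) ` fst s, y)"
      by (intro ex) (auto simp: P_def intro: Z(3))
    then show "\<exists>t. P t \<and> fst t = fst s \<union> {snd s} \<union> (\<lambda>a. a \<cdot> snd s) ` fst s" by fastforce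
  qed
  then obtain s where s: "\<And>n. P (s n)"
    and step: "\<And>n. fst (s (Suc n)) = fst (s n) \<union> {snd (s n)} \<union> (\<lambda>a. a \<cdot> snd (s n)) ` fst (s n)"
    by blast
  define x where "x n = snd (s n)" for n
  define F where "F n = fst (s n)" for n
  have F1: "F (Suc n) = F n \<union> {x n} \<union> (\<lambda>a. a \<cdot> x n) ` F n" for n
    using step unfolding x_def F_def by simp
  have F2: "x n \<in> Z" "x n \<notin> F n" "\<And>a. a \<in> F n \<Longrightarrow> a \<cdot> x n \<notin> F n" for n
    using s unfolding x_def F_def P_def by auto
  have Fmono: "F i \<subseteq> F j" if "i \<le> j" for i j
    using that by (rule lift_Suc_mono_le[of F, rotated]) (auto simp: F1)
  \<comment> \<open>The last index of a product is the stage at which its value enters the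
    increasing sets \<open>F\<close>, so it is determined by the value.\<close>
  have key: "a \<in> F (Suc j) \<and> a \<notin> F j" if "oprod m x UNIV i j a" for i j a
    using that
  proof (induction rule: oprod.induct)
    case (oprod_single i)
    then show ?case using F1 F2 by auto
  next
    case (oprod_snoc i j a k)
    then have "a \<in> F k" using Fmono[of "Suc j" k] by auto
    then show ?case using F1 F2 by auto
  qed
  show False
  proof (rule no_oprod_sequence)
    show "x n \<in> X" for n using F2 Z(1) by auto
    fix i j i' j' a
    assume a: "oprod m x UNIV i j a" "oprod m x UNIV i' j' a" and par: "odd j" "even j'"
    have "j = j'" using key[OF a(1)] key[OF a(2)] Fmono[of "Suc j" j'] Fmono[of "Suc j'" j]
      by (metis Suc_leI linorder_neqE_nat subsetD)
    then show False using par by simp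
  qed
qed

text \<open>Otherwise the powers of \<open>x\<close> would form an infinite cancellative
  subsemigroup.\<close>

lemma power_repeats:
  assumes x: "x \<in> X"
  obtains i k where "pw m x (Suc (i + k)) = pw m x i"
proof -
  have "\<not> inj (pw m x)"
  proof
    assume i: "inj (pw m x)"
    show False
    proof (rule no_infinite_cancellative)
      show "infinite (range (pw m x))" using i finite_imageD infinite_UNIV_nat by blast
      show "range (pw m x) \<subseteq> X" using x by auto
      show "a \<cdot> b \<in> range (pw m x)" if ab: "a \<in> range (pw m x)" "b \<in> range (pw m x)" for a b
      proof -
        obtain n k where "a = pw m x n" "b = pw m x k" using ab by auto
        then show ?thesis using pw_add[OF x] by (metis rangeI)
      qed
      show "b = c" if "a \<in> range (pw m x)" "b \<in> range (pw m x)" "c \<in> range (pw m x)" "a \<cdot> b = a \<cdot> c" for a b c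
        using that pw_add[OF x] i by (auto simp: inj_eq simp del: pw.simps)
    qed
  qed
  then obtain i j where "pw m x j = pw m x i" "i < j"
    unfolding inj_def by (metis linorder_neqE_nat)
  moreover from this obtain k where "j = Suc (i + k)" using less_imp_Suc_add by blast
  ultimately show ?thesis using that by metis
qed

end

section \<open>The chain of idempotents\<close>

text \<open>All that regularity is used for. In \<open>U = U \<star> B \<star> U\<close> each
  \<open>x \<in> M\<close> has a \<open>B\<close>-large set of good middle factors, and linkedness
  of \<open>B\<close> makes any two of these sets share a \<open>y\<close>. The case
  \<open>x = x'\<close> merely says that some \<open>y\<close> exists.\<close>

lemma (in sgrp) regular_N2:
  assumes r: "regular_in (lam X) (N2 X) (upmult X m)" and U: "U \<in> lam X" and S: "S \<in> U"
  shows "\<exists>M\<in>U. M \<subseteq> X \<and> (\<forall>x\<in>M. \<forall>x'\<in>M.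
      \<exists>y\<in>X. {z \<in> X. x \<cdot> y \<cdot> z \<in> S} \<in> U \<and> {z \<in> X. x' \<cdot> y \<cdot> z \<in> S} \<in> U)"
proof -
  obtain B where B: "linked_up X B" "U = (U \<star> B) \<star> U"
    using r U unfolding regular_in_def N2_def by blast
  define M where "M = {x \<in> X. pre x {t \<in> X. pre t S \<in> U} \<in> B}"
  note u = lam_upfamily[OF U] and b = linked_upfamily[OF B(1)]
  have "S \<in> (U \<star> B) \<star> U" using S B(2) by simp
  then have "M \<in> U"
    unfolding um_iff[OF um_upfamily[OF u b] u] um_iff[OF u b] M_def by simp
  moreover have "M \<subseteq> X" unfolding M_def by blast
  moreover have "\<exists>y\<in>X. {z \<in> X. x \<cdot> y \<cdot> z \<in> S} \<in> U \<and> {z \<in> X. x' \<cdot> y \<cdot> z \<in> S} \<in> U"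
    if "x \<in> M" "x' \<in> M" for x x'
  proof -
    have "pre x {t \<in> X. pre t S \<in> U} \<in> B" "pre x' {t \<in> X. pre t S \<in> U} \<in> B"
      using that unfolding M_def by auto
    from linked_meet[OF B(1) this] show ?thesis by auto
  qed
  ultimately show ?thesis by (intro bexI[of _ M]) auto
qed

text \<open>The preperiod is cancelled. Stating this for a general carrier lets it apply to powers
  in \<open>lam X\<close>.\<close>

lemma cancellative_pw:
  assumes T: "cancellative_subsemigroup S n T" "x \<in> T" and s: "semigroup_on S n"
    and eq: "pw n x (Suc (i + k)) = pw n x i"
  shows "pw n x (Suc k) = x"
proof (cases i)
  case 0
  then show ?thesis using eq by simp
next
  case (Suc j)
  interpret sgrp S n by unfold_locales (rule s)
  have TS: "T \<subseteq> S" and TT: "\<And>a b. a \<in> T \<Longrightarrow> b \<in> T \<Longrightarrow> n a b \<in> T"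
    and canc: "\<And>a b c. a \<in> T \<Longrightarrow> b \<in> T \<Longrightarrow> c \<in> T \<Longrightarrow> n a b = n a c \<Longrightarrow> b = c"
    using T(1) unfolding cancellative_subsemigroup_def by meson+
  have x: "x \<in> S" using TS T(2) by (rule subsetD)
  have pT: "pw n x l \<in> T" for l using T(2) TT by (induction l) simp_all
  have "n (pw n x j) (pw n x (Suc k)) = n (pw n x j) (pw n x 0)"
    using eq pw_add[OF x] Suc by (simp del: pw.simps)
  from canc[OF pT pT pT this] show ?thesis by simp
qed

context sgrp
begin

lemma lam_semigroup: "semigroup_on (lam X) (upmult X m)"
  unfolding semigroup_on_def using um_lam um_lam_assoc by simp

lemma point_pw: "x \<in> X \<Longrightarrow> pw (upmult X m) (point x) n = point (pw m x n)"
  by (induction n) (simp_all add: point_um)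

end

context icsgrp
begin

definition E where "E = {e \<in> X. e \<cdot> e = e}"

lemma E_D: "e \<in> E \<Longrightarrow> e \<in> X" "e \<in> E \<Longrightarrow> e \<cdot> e = e"
  unfolding E_def by auto

lemma E_mult: "e \<in> E \<Longrightarrow> f \<in> E \<Longrightarrow> e \<cdot> f \<in> E"
  unfolding E_def using idem_comm assoc by (simp) (metis closed)

lemma E_comm: "e \<in> E \<Longrightarrow> f \<in> E \<Longrightarrow> e \<cdot> f = f \<cdot> e"
  unfolding E_def using idem_comm by simp

lemma E_absorb:
  assumes "e \<in> E" "f \<in> E"
  shows "e \<cdot> (e \<cdot> f) = e \<cdot> f" "(e \<cdot> f) \<cdot> f = e \<cdot> f" "(e \<cdot> f) \<cdot> e = e \<cdot> f" "f \<cdot> (e \<cdot> f) = e \<cdot> f"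
proof -
  show 1: "e \<cdot> (e \<cdot> f) = e \<cdot> f" using assms E_D by (simp flip: assoc)
  show 2: "(e \<cdot> f) \<cdot> f = e \<cdot> f" using assms E_D by (simp add: assoc)
  show "(e \<cdot> f) \<cdot> e = e \<cdot> f" using 1 E_comm[OF E_mult[OF assms] assms(1)] by simp
  show "f \<cdot> (e \<cdot> f) = e \<cdot> f" using 2 E_comm[OF E_mult[OF assms] assms(2)] by simp
qed

lemma E_trans:
  assumes "e \<in> X" "f \<in> X" "g \<in> X" "e \<cdot> f = e" "f \<cdot> g = f"
  shows "e \<cdot> g = e"
  using assms by (metis assoc)

end

text \<open>Condition (3). The disjunction is kept until \<open>regular\<close> reduces its first
  alternative to the second.\<close>

locale rsgrp = icsgrp +
  assumes sr: "sub_clifford_on (lam X) (upmult X m) \<or> regular_in (lam X) (N2 X) (upmult X m)"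
begin

text \<open>For incomparable \<open>e\<close>, \<open>f\<close> the majority of \<open>e\<close>, \<open>f\<close>, \<open>e \<cdot> f\<close> has square \<open>point (e \<cdot> f)\<close>.\<close>

lemma E_chain:
  assumes e: "e \<in> E" and f: "f \<in> E"
  shows "e \<cdot> f = e \<or> e \<cdot> f = f"
proof (rule ccontr)
  assume n: "\<not> ?thesis"
  define g where "g = e \<cdot> f"
  have X: "e \<in> X" "f \<in> X" "g \<in> X" using e f E_D unfolding g_def by auto
  have ge: "e \<cdot> g = g" "g \<cdot> e = g" "f \<cdot> g = g" "g \<cdot> f = g" "e \<cdot> f = g" "f \<cdot> e = g" "g \<cdot> g = g"
    "e \<cdot> e = e" "f \<cdot> f = f"
    using E_absorb[OF e f] E_comm[OF e f] E_D(2)[OF E_mult[OF e f]] E_D(2) e f unfolding g_def by auto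
  have ne: "g \<noteq> e" "g \<noteq> f" using n unfolding g_def by auto
  define U where "U = majority e f g"
  have U: "U \<in> lam X" unfolding U_def using X by simp
  show False
    using sr
  proof
    assume "sub_clifford_on (lam X) (upmult X m)"
    then obtain T where T: "U \<in> T" "T \<subseteq> lam X" "\<And>a b. a \<in> T \<Longrightarrow> b \<in> T \<Longrightarrow> a \<star> b \<in> T"
      "\<And>a b c. a \<in> T \<Longrightarrow> b \<in> T \<Longrightarrow> c \<in> T \<Longrightarrow> a \<star> b = a \<star> c \<Longrightarrow> b = c"
      using U unfolding sub_clifford_on_def cancellative_subsemigroup_def by (metis (no_types))
    have UU: "U \<star> U = point g"
      by (rule lam_eqI'[symmetric])
        (use X ge in \<open>auto simp: U_def um_lam in_um in_majority in_point\<close>)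
    \<comment> \<open>Cancelling \<open>U\<close> would make it idempotent, but its square is
      principal and \<open>U\<close> is not.\<close>
    have "U \<star> (U \<star> U) = U \<star> U"
      unfolding UU by (rule lam_eqI'[symmetric])
        (use X ge in \<open>auto simp: U_def um_lam in_um in_majority in_point\<close>)
    then have "U \<star> U = U" using T by metis
    moreover have "{g} \<in> point g" using X by (simp add: in_point)
    ultimately have "{g} \<in> U" using UU by metis
    then show False unfolding U_def using X ne by (simp add: in_majority)
  next
    assume "regular_in (lam X) (N2 X) (upmult X m)"
    moreover have "{e, f} \<in> U" unfolding U_def using X by (simp add: in_majority)
    ultimately obtain M where M: "M \<in> U" "M \<subseteq> X"
      "\<forall>x\<in>M. \<forall>x'\<in>M. \<exists>y\<in>X. {z \<in> X. x \<cdot> y \<cdot> z \<in> {e, f}} \<in> U \<and> {z \<in> X. x' \<cdot> y \<cdot> z \<in> {e, f}} \<in> U"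
      using regular_N2[OF _ U] by meson
    \<comment> \<open>No \<open>w\<close> in \<open>{e, f}\<close> is fixed by both idempotents on
      the same side, whereas any product with \<open>g\<close> at its left or right end is; so such
      products miss \<open>{e, f}\<close>.\<close>
    have left: "w \<cdot> f \<noteq> w \<or> w \<cdot> e \<noteq> w" "f \<cdot> w \<noteq> w \<or> e \<cdot> w \<noteq> w" if "w \<in> {e, f}" for w
      using that ge ne by auto
    have xg: "g \<cdot> y \<cdot> z \<notin> {e, f}" if "y \<in> X" "z \<in> X" for y z
    proof
      assume "g \<cdot> y \<cdot> z \<in> {e, f}"
      moreover have "e \<cdot> (g \<cdot> y \<cdot> z) = g \<cdot> y \<cdot> z" "f \<cdot> (g \<cdot> y \<cdot> z) = g \<cdot> y \<cdot> z"
        using X that ge by (simp_all flip: assoc)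
      ultimately show False using left by metis
    qed
    have zg: "x \<cdot> y \<cdot> g \<notin> {e, f}" if "x \<in> X" "y \<in> X" for x y
    proof
      assume "x \<cdot> y \<cdot> g \<in> {e, f}"
      moreover have "(x \<cdot> y \<cdot> g) \<cdot> e = x \<cdot> y \<cdot> g" "(x \<cdot> y \<cdot> g) \<cdot> f = x \<cdot> y \<cdot> g"
        using X that ge by (simp_all add: assoc)
      ultimately show False using left by metis
    qed
    have zf: "f \<in> {z \<in> X. e \<cdot> y \<cdot> z \<in> {e, f}}" if "{z \<in> X. e \<cdot> y \<cdot> z \<in> {e, f}} \<in> U" "y \<in> X" for y
      using that zg[of e y] X unfolding U_def by (auto simp: in_majority)
    have "g \<notin> M"
    proof
      assume "g \<in> M"
      then obtain y where y: "y \<in> X" "{z \<in> X. g \<cdot> y \<cdot> z \<in> {e, f}} \<in> U" using M(3) by meson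
      then have "{z \<in> X. g \<cdot> y \<cdot> z \<in> {e, f}} \<noteq> {}" using upfamily_nonempty[OF lam_upfamily[OF U]] by blast
      then show False using xg y by blast
    qed
    \<comment> \<open>With \<open>g\<close> excluded both as left and as right factor, majority
      voting forces the left factor \<open>e\<close> and the right factor \<open>f\<close>. The
      value \<open>e \<cdot> y \<cdot> f\<close> is fixed by \<open>e\<close> on the left and by
      \<open>f\<close> on the right, which neither \<open>e\<close> nor \<open>f\<close> is.\<close>
    then have "e \<in> M" using M(1,2) unfolding U_def by (auto simp: in_majority)
    then obtain y where y: "y \<in> X" "{z \<in> X. e \<cdot> y \<cdot> z \<in> {e, f}} \<in> U" using M(3) by meson
    then have w: "e \<cdot> y \<cdot> f \<in> {e, f}" using zf by blast
    have "e \<cdot> (e \<cdot> y \<cdot> f) = e \<cdot> y \<cdot> f" "(e \<cdot> y \<cdot> f) \<cdot> f = e \<cdot> y \<cdot> f"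
      using X y ge by (metis assoc closed)+
    then show False using w ge ne by auto
  qed
qed

text \<open>Order idempotents by \<open>e \<cdot> f = e\<close>. An infinite chain contains an
  infinite strictly increasing or decreasing sequence; an ordered product is then its first,
  respectively its last, term, and both are forbidden.\<close>

lemma E_finite: "finite E"
proof (rule ccontr)
  assume inf: "infinite E"
  have no: False
    if s: "\<And>n::nat. s n \<in> E" and dist: "\<And>i j. i < j \<Longrightarrow> s i \<noteq> s j"
      and mono: "(\<forall>i j. i < j \<longrightarrow> s i \<cdot> s j = s i) \<or> (\<forall>i j. i < j \<longrightarrow> s i \<cdot> s j = s j)" for s
  proof -
    have d: "i = j" if "s i = s j" for i j using that dist by (metis linorder_neqE_nat)
    from mono have "(\<forall>i j a. oprod m s UNIV i j a \<longrightarrow> a = s i) \<or> (\<forall>i j a. oprod m s UNIV i j a \<longrightarrow> a = s j)"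
    proof
      assume m: "\<forall>i j. i < j \<longrightarrow> s i \<cdot> s j = s i"
      have "a = s i" if "oprod m s UNIV i j a" for i j a
        using that
      proof (induction rule: oprod.induct)
        case (oprod_snoc i j a k)
        then show ?case using m oprod_index[OF oprod_snoc(1)] by auto
      qed simp
      then show ?thesis by blast
    next
      assume m: "\<forall>i j. i < j \<longrightarrow> s i \<cdot> s j = s j"
      have "a = s j" if "oprod m s UNIV i j a" for i j a
        using that by (induction rule: oprod.induct) (use m in auto)
      then show ?thesis by blast
    qed
    then have o: "i = i' \<or> j = j'" if "oprod m s UNIV i j a" "oprod m s UNIV i' j' a" for i j i' j' a
      using that d by metis
    show False
      by (rule no_oprod_sequence[of s]) (use s E_D o in blast)+
  qed
  show False
  proof (cases "\<forall>K\<subseteq>E. K \<noteq> {} \<longrightarrow> (\<exists>e\<in>K. \<forall>f\<in>K. e \<cdot> f = e)")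
    case True
    \<comment> \<open>In the well-ordered case least elements are removed one by one; a state is the
      remaining infinite set with its least element.\<close>
    have "\<exists>s. \<forall>n. (infinite (fst (s n)) \<and> fst (s n) \<subseteq> E \<and> snd (s n) \<in> fst (s n) \<and> (\<forall>f\<in>fst (s n). snd (s n) \<cdot> f = snd (s n))) \<and>
      fst (s (Suc n)) = fst (s n) - {snd (s n)}"
    proof (rule dependent_nat_choice)
      obtain e where "e \<in> E" "\<forall>f\<in>E. e \<cdot> f = e" using True inf by (metis finite.emptyI subset_refl)
      then show "\<exists>s. infinite (fst s) \<and> fst s \<subseteq> E \<and> snd s \<in> fst s \<and> (\<forall>f\<in>fst s. snd s \<cdot> f = snd s)"
        using inf by (intro exI[of _ "(E, e)"]) auto
      fix s :: "'a set \<times> 'a" and n :: nat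
      assume s: "infinite (fst s) \<and> fst s \<subseteq> E \<and> snd s \<in> fst s \<and> (\<forall>f\<in>fst s. snd s \<cdot> f = snd s)"
      define K where "K = fst s - {snd s}"
      have K: "infinite K" "K \<subseteq> E" using s unfolding K_def by auto
      then obtain e where "e \<in> K" "\<forall>f\<in>K. e \<cdot> f = e" using True by (metis finite.emptyI)
      then show "\<exists>t. (infinite (fst t) \<and> fst t \<subseteq> E \<and> snd t \<in> fst t \<and> (\<forall>f\<in>fst t. snd t \<cdot> f = snd t)) \<and> fst t = fst s - {snd s}"
        using K unfolding K_def[symmetric] by (intro exI[of _ "(K, e)"]) auto
    qed
    then obtain s where s: "\<And>n. fst (s n) \<subseteq> E" "\<And>n. snd (s n) \<in> fst (s n)"
      "\<And>n f. f \<in> fst (s n) \<Longrightarrow> snd (s n) \<cdot> f = snd (s n)" "\<And>n. fst (s (Suc n)) = fst (s n) - {snd (s n)}"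
      by blast
    have mono: "fst (s j) \<subseteq> fst (s i)" if "i \<le> j" for i j
      using that by (rule lift_Suc_antimono_le[of "\<lambda>n. fst (s n)", rotated]) (use s(4) in blast)
    have mem: "snd (s j) \<in> fst (s i) - {snd (s i)}" if "i < j" for i j
      using mono[of "Suc i" j] s(2)[of j] that s(4)[of i] by auto
    show False
    proof (rule no[of "\<lambda>n. snd (s n)"], goal_cases)
      case 1 show ?case using s(1,2) by (meson subsetD)
    next
      case (2 i j) show ?case using mem[OF 2] by auto
    next
      case 3
      have "snd (s i) \<cdot> snd (s j) = snd (s i)" if "i < j" for i j using mem[OF that] s(3)[of "snd (s j)" i] by simp
      then show ?case by simp
    qed
  next
    case False
    then obtain K where K: "K \<subseteq> E" "K \<noteq> {}" "\<And>e. e \<in> K \<Longrightarrow> \<exists>f\<in>K. e \<cdot> f \<noteq> e"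
      by (simp only: not_all not_imp bex_simps ball_simps) auto
    have "\<exists>s. \<forall>n. s n \<in> K \<and> (s n \<cdot> s (Suc n) = s (Suc n) \<and> s (Suc n) \<noteq> s n)"
    proof (rule dependent_nat_choice)
      show "\<exists>x. x \<in> K" using K by blast
      fix e and n :: nat assume e: "e \<in> K"
      then obtain f where f: "f \<in> K" "e \<cdot> f \<noteq> e" using K by blast
      then have "e \<cdot> f = f" using E_chain[of e f] K(1) e by blast
      then show "\<exists>f. f \<in> K \<and> (e \<cdot> f = f \<and> f \<noteq> e)" using f by metis
    qed
    then obtain s where s: "\<And>n. s n \<in> K" "\<And>n. s n \<cdot> s (Suc n) = s (Suc n)" "\<And>n. s (Suc n) \<noteq> s n" by blast
    have sE: "s n \<in> E" for n using s K by blast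
    have le: "s i \<cdot> s j = s j" if "i < j" for i j
      using that
    proof (induction rule: less_Suc_induct)
      case (1 i)
      then show ?case using s by blast
    next
      case (2 i j k)
      then show ?case using sE E_D(1) assoc by metis
    qed
    have "s i \<noteq> s j" if "i < j" for i j
    proof
      assume "s i = s j"
      moreover have "j = Suc i \<or> Suc i < j" using that by auto
      ultimately have "s (Suc i) \<cdot> s i = s i" using le s(3)[of i] by metis
      then show False using s(2)[of i] E_comm[OF sE sE, of i "Suc i"] s(3)[of i] by simp
    qed
    then show False using no[of s] sE le by blast
  qed
qed

section \<open>Reduction to finite unions of groups\<close>

text \<open>A repetition among powers gives only an eventual period. Cancellation removes the
  preperiod in the sub-Clifford case. In the regular case a generalized inverse must do so, and
  comparability of the two idempotents \<open>x \<cdot> b\<close> and \<open>b \<cdot> x\<close>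
  decides on which side it cancels.\<close>

lemma torsion:
  assumes x: "x \<in> X"
  obtains k where "pw m x (Suc k) = x"
proof -
  obtain i k where ik: "pw m x (Suc (i + k)) = pw m x i" using power_repeats[OF x] .
  show ?thesis
    using sr
  proof
    assume "sub_clifford_on (lam X) (upmult X m)"
    then obtain T where "cancellative_subsemigroup (lam X) (upmult X m) T" "point x \<in> T"
      using point_lam[OF x] unfolding sub_clifford_on_def by meson
    moreover have "pw (upmult X m) (point x) (Suc (i + k)) = pw (upmult X m) (point x) i"
      using ik by (simp only: point_pw[OF x])
    ultimately have "point (pw m x (Suc k)) = point x"
      using cancellative_pw[OF _ _ lam_semigroup] point_pw[OF x] by metis
    then show ?thesis using that point_inj x by (metis pw_closed)
  next
    assume r: "regular_in (lam X) (N2 X) (upmult X m)"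
    have "{x} \<in> point x" using x by (simp add: in_point)
    from regular_N2[OF r point_lam[OF x] this]
    obtain M where M: "M \<in> point x" "\<forall>t\<in>M. \<forall>t'\<in>M. \<exists>y\<in>X. {z \<in> X. t \<cdot> y \<cdot> z \<in> {x}} \<in> point x \<and>
        {z \<in> X. t' \<cdot> y \<cdot> z \<in> {x}} \<in> point x"
      by meson
    then have "x \<in> M" unfolding point_def by blast
    with M(2) obtain y where "y \<in> X" "{z \<in> X. x \<cdot> y \<cdot> z \<in> {x}} \<in> point x" by blast
    then have y: "y \<in> X" "x \<cdot> y \<cdot> x = x" unfolding point_def by auto
    \<comment> \<open>Passing from \<open>y\<close> to \<open>y \<cdot> x \<cdot> y\<close> makes
      the inverse relation mutual.\<close>
    define b where "b = y \<cdot> x \<cdot> y"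
    define g where "g = x \<cdot> b"
    define f where "f = b \<cdot> x"
    have b: "b \<in> X" "x \<cdot> b \<cdot> x = x" "b \<cdot> x \<cdot> b = b"
    proof -
      show bX: "b \<in> X" unfolding b_def using x y by simp
      have "x \<cdot> b \<cdot> x = (x \<cdot> y \<cdot> x) \<cdot> y \<cdot> x" unfolding b_def using x y(1) by (simp add: assoc)
      then show 1: "x \<cdot> b \<cdot> x = x" using y by simp
      have "b \<cdot> x \<cdot> b = y \<cdot> (x \<cdot> b \<cdot> x) \<cdot> y" unfolding b_def using x y(1) by (simp add: assoc)
      then show "b \<cdot> x \<cdot> b = b" using 1 unfolding b_def by simp
    qed
    have gf: "g \<in> E" "f \<in> E" unfolding E_def g_def f_def using x b by (auto simp flip: assoc)
    have units: "g \<cdot> x = x" "x \<cdot> f = x" "f \<cdot> b = b" "b \<cdot> g = b"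
      unfolding g_def f_def using x b by (auto simp flip: assoc)
    note X = x b(1) E_D(1)[OF gf(1)] E_D(1)[OF gf(2)]
    define c where "c n = pw m b n" for n
    have cX: "c n \<in> X" for n unfolding c_def using b by simp
    have c_Suc: "c (Suc n) = b \<cdot> c n" for n
      using pw_add[OF b(1), of 0 n] unfolding c_def by simp
    have p_Suc: "pw m x (Suc n) = x \<cdot> pw m x n" for n using pw_add[OF x, of 0 n] by simp
    have "g \<cdot> f = g \<or> g \<cdot> f = f" using E_chain gf by blast
    then have "pw m x (Suc k) = x"
    proof
      assume gf': "g \<cdot> f = g"
      then have fg: "f \<cdot> g = g" using E_comm gf by metis
      have fx: "f \<cdot> x = x" using units fg X by (metis assoc)
      have bf: "b \<cdot> f = b" using units gf' X by (metis assoc)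
      have fp: "f \<cdot> pw m x n = pw m x n" for n using fx p_Suc X x by (cases n) (auto simp flip: assoc)
      \<comment> \<open>Powers of \<open>b\<close> are left inverses of powers of \<open>x\<close>
        relative to \<open>f\<close>, which acts as a left unit here; the other case is the mirror
        image with \<open>g\<close>.\<close>
      have cx: "c n \<cdot> pw m x n = f" for n
      proof (induction n)
        case (Suc n)
        have "c (Suc n) \<cdot> pw m x (Suc n) = c n \<cdot> (b \<cdot> x) \<cdot> pw m x n"
          using p_Suc cX X unfolding c_def by (simp add: assoc del: pw.simps(2)) (simp add: assoc)
        also have "\<dots> = c n \<cdot> (f \<cdot> pw m x n)" using X cX x unfolding f_def by (simp add: assoc)
        finally show ?case using Suc fp by simp
      qed (simp add: c_def f_def)
      have "c i \<cdot> (pw m x i \<cdot> pw m x k) = c i \<cdot> pw m x i" using ik pw_add[OF x] by simp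
      then have "f \<cdot> pw m x k = f" using cx cX x by (metis assoc pw_closed)
      then show ?thesis using fp fx by simp
    next
      assume gf': "g \<cdot> f = f"
      then have fg: "f \<cdot> g = f" using E_comm gf by metis
      have xg: "x \<cdot> g = x" using units fg X by (metis assoc)
      have pg: "pw m x n \<cdot> g = pw m x n" for n using xg X x by (cases n) (auto simp: assoc)
      have xc: "pw m x n \<cdot> c n = g" for n
      proof (induction n)
        case (Suc n)
        have "pw m x (Suc n) \<cdot> c (Suc n) = pw m x n \<cdot> (x \<cdot> b) \<cdot> c n"
          using c_Suc cX X by (simp add: assoc)
        also have "\<dots> = pw m x n \<cdot> g \<cdot> c n" unfolding g_def ..
        finally show ?case using Suc pg by simp
      qed (simp add: c_def g_def)
      have "(pw m x k \<cdot> pw m x i) \<cdot> c i = pw m x i \<cdot> c i" using ik pw_add[OF x] by (simp add: add.commute)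
      then have "pw m x k \<cdot> g = g" using xc cX x by (metis assoc pw_closed)
      then have "pw m x k = g" using pg by simp
      then show ?thesis using units(1) by simp
    qed
    then show ?thesis using that by blast
  qed
qed

text \<open>For idempotent \<open>e\<close> this is the maximal subgroup with identity
  \<open>e\<close>, that is, Green's H-class of \<open>e\<close>.\<close>

definition hcls where
  "hcls e = {x \<in> X. e \<cdot> x = x \<and> x \<cdot> e = x \<and> (\<exists>y\<in>X. e \<cdot> y = y \<and> y \<cdot> e = y \<and> x \<cdot> y = e \<and> y \<cdot> x = e)}"

lemma hclsD: "x \<in> hcls e \<Longrightarrow> x \<in> X" "x \<in> hcls e \<Longrightarrow> e \<cdot> x = x" "x \<in> hcls e \<Longrightarrow> x \<cdot> e = x"
  unfolding hcls_def by auto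

lemma hcls_inverse:
  assumes "x \<in> hcls e"
  obtains y where "y \<in> hcls e" "x \<cdot> y = e" "y \<cdot> x = e"
  using assms unfolding hcls_def by blast

lemma hcls_id: "e \<in> E \<Longrightarrow> e \<in> hcls e"
  unfolding hcls_def E_def by auto

lemma hcls_mult:
  assumes x: "x \<in> hcls e" and y: "y \<in> hcls e"
  shows "x \<cdot> y \<in> hcls e"
proof -
  obtain x' where x': "x' \<in> hcls e" "x \<cdot> x' = e" "x' \<cdot> x = e" using hcls_inverse[OF x] .
  obtain y' where y': "y' \<in> hcls e" "y \<cdot> y' = e" "y' \<cdot> y = e" using hcls_inverse[OF y] .
  note D = x y x'(1) y'(1)
  note X = D[THEN hclsD(1)] and L = D[THEN hclsD(2)] and R = D[THEN hclsD(3)]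
  have eX: "e \<in> X" using X x' by auto
  have "(x \<cdot> y) \<cdot> (y' \<cdot> x') = x \<cdot> (y \<cdot> y') \<cdot> x'" using X by (simp add: assoc)
  then have 1: "(x \<cdot> y) \<cdot> (y' \<cdot> x') = e" using y' x' R by simp
  have "(y' \<cdot> x') \<cdot> (x \<cdot> y) = y' \<cdot> (x' \<cdot> x) \<cdot> y" using X by (simp add: assoc)
  then have 2: "(y' \<cdot> x') \<cdot> (x \<cdot> y) = e" using y' x' R by simp
  have 3: "e \<cdot> (x \<cdot> y) = x \<cdot> y" "e \<cdot> (y' \<cdot> x') = y' \<cdot> x'" using X L eX by (simp_all flip: assoc)
  have 4: "(x \<cdot> y) \<cdot> e = x \<cdot> y" "(y' \<cdot> x') \<cdot> e = y' \<cdot> x'" using X R eX by (simp_all add: assoc)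
  show ?thesis unfolding hcls_def using 1 2 3 4 X by blast
qed

lemma hcls_cancel:
  assumes "a \<in> hcls e" "b \<in> hcls e" "c \<in> hcls e" "a \<cdot> b = a \<cdot> c"
  shows "b = c"
proof -
  obtain a' where a': "a' \<in> hcls e" "a' \<cdot> a = e" using hcls_inverse[OF assms(1)] by metis
  then have "a' \<cdot> (a \<cdot> b) = e \<cdot> b" "a' \<cdot> (a \<cdot> c) = e \<cdot> c"
    using assms hclsD(1) by (metis assoc)+
  then show ?thesis using assms hclsD(2) by metis
qed

lemma hcls_cancel_right:
  assumes "a \<in> hcls e" "b \<in> hcls e" "c \<in> hcls e" "b \<cdot> a = c \<cdot> a"
  shows "b = c"
proof -
  obtain a' where a': "a' \<in> hcls e" "a \<cdot> a' = e" using hcls_inverse[OF assms(1)] by metis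
  then have "(b \<cdot> a) \<cdot> a' = b \<cdot> e" "(c \<cdot> a) \<cdot> a' = c \<cdot> e"
    using assms hclsD(1) by (metis assoc)+
  then show ?thesis using assms hclsD(3) by metis
qed

lemma hcls_finite: "finite (hcls e)"
  using no_infinite_cancellative[of "hcls e"] hclsD(1) hcls_mult hcls_cancel by blast

text \<open>Torsion makes \<open>e = pw m x k\<close> a unit for all powers of \<open>x\<close>, and
  therefore idempotent.\<close>

lemma hcls_cover:
  assumes x: "x \<in> X"
  obtains e where "e \<in> E" "x \<in> hcls e"
proof -
  obtain k where k: "pw m x (Suc k) = x" using torsion[OF x] .
  define e where "e = pw m x k"
  have e: "e \<in> X" "e \<cdot> x = x" unfolding e_def using x k by auto
  have ep: "e \<cdot> pw m x n = pw m x n" for n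
    using e x by (induction n) (auto simp flip: assoc)
  have "e \<cdot> pw m x n = pw m x n \<cdot> e" for n
    unfolding e_def using pw_add[OF x] by (simp add: add.commute)
  then have pe: "pw m x n \<cdot> e = pw m x n" for n using ep by simp
  have "e \<in> E" unfolding E_def using ep[of k] e unfolding e_def by simp
  moreover have "x \<in> hcls e"
    unfolding hcls_def
  \<comment> \<open>The inverse is the power with \<open>2 * k + 1\<close> factors; the shorter
    choice with \<open>k\<close> factors would not exist for \<open>k = 0\<close>.\<close>
  proof (intro CollectI conjI bexI[of _ "pw m x (k + k)"] x ep pe e pw_closed)
    show "x \<cdot> e = x" using pe[of 0] by simp
    have "pw m x 0 \<cdot> pw m x (k + k) = pw m x k \<cdot> pw m x k" "pw m x (k + k) \<cdot> pw m x 0 = pw m x k \<cdot> pw m x k"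
      using pw_add[OF x] by (simp_all del: pw.simps)
    moreover have "pw m x k \<cdot> pw m x k = e" using ep[of k] unfolding e_def by simp
    ultimately show "x \<cdot> pw m x (k + k) = e" "pw m x (k + k) \<cdot> x = e" by simp_all
  qed
  ultimately show ?thesis by (rule that)
qed

lemma X_eq: "X = (\<Union>e\<in>E. hcls e)"
proof
  show "X \<subseteq> (\<Union>e\<in>E. hcls e)"
  proof
    fix x assume "x \<in> X"
    then obtain e where "e \<in> E" "x \<in> hcls e" by (rule hcls_cover)
    then show "x \<in> (\<Union>e\<in>E. hcls e)" by (rule UN_I)
  qed
  show "(\<Union>e\<in>E. hcls e) \<subseteq> X" using hclsD(1) by auto
qed

lemma X_finite: "finite X"
  by (subst X_eq) (use E_finite hcls_finite in simp)

text \<open>Both \<open>e \<cdot> x\<close> and \<open>x \<cdot> e\<close> lie in subgroups whose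
  identities are below \<open>e\<close>. Hence \<open>e\<close> acts trivially on either side of
  each, and both equal \<open>e \<cdot> x \<cdot> e\<close>.\<close>

lemma E_central:
  assumes e: "e \<in> E" and x: "x \<in> X"
  shows "e \<cdot> x = x \<cdot> e"
proof -
  note eX = E_D[OF e]
  obtain g where g: "g \<in> E" "e \<cdot> x \<in> hcls g" using hcls_cover[of "e \<cdot> x"] eX x by auto
  obtain z where z: "z \<in> X" "(e \<cdot> x) \<cdot> z = g" using hcls_inverse[OF g(2)] hclsD(1) by metis
  have "e \<cdot> g = g" using z eX x by (metis assoc closed)
  then have ge: "g \<cdot> e = g" using E_comm[OF e g(1)] by simp
  have 1: "(e \<cdot> x) \<cdot> e = e \<cdot> x"
    using hclsD(3)[OF g(2)] ge eX x E_D(1)[OF g(1)] by (metis assoc closed)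
  obtain f where f: "f \<in> E" "x \<cdot> e \<in> hcls f" using hcls_cover[of "x \<cdot> e"] eX x by auto
  obtain w where w: "w \<in> X" "w \<cdot> (x \<cdot> e) = f" using hcls_inverse[OF f(2)] hclsD(1) by metis
  have "f \<cdot> e = f" using w eX x by (metis assoc closed)
  then have ef: "e \<cdot> f = f" using E_comm[OF e f(1)] by simp
  have "e \<cdot> (x \<cdot> e) = x \<cdot> e"
    using hclsD(2)[OF f(2)] ef eX x E_D(1)[OF f(1)] by (metis assoc closed)
  then show ?thesis using 1 eX x by (simp add: assoc)
qed

lemma hcls_disjoint:
  assumes "x \<in> hcls e" "x \<in> hcls f" "e \<in> E" "f \<in> E"
  shows "e = f"
proof -
  obtain y where y: "y \<in> X" "x \<cdot> y = e" using hcls_inverse[OF assms(1)] hclsD(1) by metis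
  obtain z where z: "z \<in> X" "x \<cdot> z = f" using hcls_inverse[OF assms(2)] hclsD(1) by metis
  have "f \<cdot> e = e" using y hclsD[OF assms(2)] E_D[OF assms(4)] by (metis assoc)
  moreover have "e \<cdot> f = f" using z hclsD[OF assms(1)] E_D[OF assms(3)] by (metis assoc)
  ultimately show ?thesis using E_comm assms by metis
qed

text \<open>Since \<open>e\<close> is central, multiplication by it is a homomorphism from the upper
  group to the lower one.\<close>

lemma hcls_restrict:
  assumes e: "e \<in> E" and f: "f \<in> E" and ef: "e \<cdot> f = e" and x: "x \<in> hcls f"
  shows "e \<cdot> x \<in> hcls e"
proof -
  obtain y where y: "y \<in> hcls f" "x \<cdot> y = f" "y \<cdot> x = f" using hcls_inverse[OF x] .
  note X = E_D(1)[OF e] hclsD(1)[OF x] hclsD(1)[OF y(1)]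
  have 1: "(e \<cdot> u) \<cdot> (e \<cdot> v) = e \<cdot> (u \<cdot> v)" if "u \<in> X" "v \<in> X" for u v
  proof -
    have "(e \<cdot> u) \<cdot> (e \<cdot> v) = (e \<cdot> e) \<cdot> (u \<cdot> v)"
      using E_central[OF e that(1)] X that by (metis assoc closed)
    then show ?thesis using E_D(2)[OF e] by simp
  qed
  have 2: "e \<cdot> (e \<cdot> u) = e \<cdot> u" "(e \<cdot> u) \<cdot> e = e \<cdot> u" if "u \<in> X" for u
    using that X E_D(2)[OF e] E_central[OF e that] by (metis assoc)+
  show ?thesis
    unfolding hcls_def using X 1[of x y] 1[of y x] 2 y ef
    by (intro CollectI conjI bexI[of _ "e \<cdot> y"]) auto
qed

text \<open>Finiteness of \<open>X\<close> makes \<open>lam X\<close> finite, so powers of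
  \<open>U\<close> repeat, and cancellation brings the repetition back to \<open>U\<close> itself; a
  power of \<open>U\<close> then serves as the middle factor.\<close>

lemma regular: "regular_in (lam X) (N2 X) (upmult X m)"
proof (cases "regular_in (lam X) (N2 X) (upmult X m)")
  case False
  then have sc: "sub_clifford_on (lam X) (upmult X m)" using sr by blast
  interpret L: sgrp "lam X" "upmult X m" by unfold_locales (rule lam_semigroup)
  have fin: "finite (lam X)"
  proof (rule finite_subset)
    show "lam X \<subseteq> Pow (Pow X)" using upfamily_sub[OF lam_upfamily] by blast
  qed (use X_finite in simp)
  show ?thesis
    unfolding regular_in_def
  proof
    fix U assume U: "U \<in> lam X"
    then obtain T where T: "cancellative_subsemigroup (lam X) (upmult X m) T" "U \<in> T"
      using sc unfolding sub_clifford_on_def by meson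
    have "\<not> inj (pw (upmult X m) U)"
    proof
      assume i: "inj (pw (upmult X m) U)"
      have "range (pw (upmult X m) U) \<subseteq> lam X" using U by auto
      then have "finite (range (pw (upmult X m) U))" using fin finite_subset by blast
      then show False using finite_imageD[OF _ i] infinite_UNIV_nat by blast
    qed
    then obtain i j where "pw (upmult X m) U j = pw (upmult X m) U i" "i < j"
      unfolding inj_def by (metis linorder_neqE_nat)
    moreover from this obtain k where "j = Suc (i + k)" using less_imp_Suc_add by blast
    ultimately have k: "pw (upmult X m) U (Suc k) = U"
      using cancellative_pw[OF T lam_semigroup] by metis
    show "\<exists>V\<in>N2 X. U = U \<star> V \<star> U"
    proof (cases k)
      case 0
      then have "U = U \<star> U \<star> U" using k by simp
      then show ?thesis using U lam_N2 by blast
    next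
      case (Suc l)
      have "pw (upmult X m) U (Suc (Suc l)) = U \<star> pw (upmult X m) U l \<star> U"
        using L.pw_add[OF U, of 0 l] by simp
      then show ?thesis using k Suc L.pw_closed[OF U, of l] lam_N2 by (metis subsetD)
    qed
  qed
qed

section \<open>Maximal linked systems that are not regular\<close>

lemma regular_obtain:
  assumes "U \<in> lam X" "S \<in> U"
  obtains M where "M \<in> U" "M \<subseteq> X" "\<forall>x\<in>M. \<forall>x'\<in>M.
      \<exists>y\<in>X. {z \<in> X. x \<cdot> y \<cdot> z \<in> S} \<in> U \<and> {z \<in> X. x' \<cdot> y \<cdot> z \<in> S} \<in> U"
  using regular_N2[OF regular assms] by meson

text \<open>A map \<open>z \<mapsto> x \<cdot> y \<cdot> z\<close> that keeps one point of the group
  inside it is translation by the group element \<open>x \<cdot> y \<cdot> e\<close>, although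
  \<open>y\<close> may lie elsewhere.\<close>

lemma hcls_translate:
  assumes x: "x \<in> hcls e" and z: "z \<in> hcls e" and y: "y \<in> X" and xyz: "x \<cdot> y \<cdot> z \<in> hcls e"
  shows "x \<cdot> y \<cdot> e \<in> hcls e" "\<And>z. z \<in> hcls e \<Longrightarrow> x \<cdot> y \<cdot> e \<cdot> z = x \<cdot> y \<cdot> z"
proof -
  obtain z' where z': "z' \<in> hcls e" "z \<cdot> z' = e" using hcls_inverse[OF z] by metis
  note X = hclsD(1)[OF x] hclsD(1)[OF z] hclsD(1)[OF z'(1)] y
  then have eX: "e \<in> X" using z' by (metis closed)
  have "(x \<cdot> y \<cdot> z) \<cdot> z' = x \<cdot> y \<cdot> e" using X eX z'(2) by (simp add: assoc)
  then show "x \<cdot> y \<cdot> e \<in> hcls e" using hcls_mult[OF xyz z'(1)] by simp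
  show "x \<cdot> y \<cdot> e \<cdot> z = x \<cdot> y \<cdot> z" if "z \<in> hcls e" for z
    using hclsD[OF that] X eX by (simp add: assoc)
qed

text \<open>If \<open>U = U \<star> B \<star> U\<close>, then for \<open>U\<close>-many \<open>x\<close> there are \<open>B\<close>-many \<open>y\<close> such that \<open>S\<close> pulled back along
  \<open>x \<cdot> y\<close> lies in \<open>U\<close>. Rigidity forces \<open>x \<cdot> y \<cdot> e = e\<close>, while linkedness of \<open>B\<close> supplies one \<open>y\<close> for two
  different \<open>x\<close>.\<close>

lemma rigid_not_regular:
  assumes U: "U \<in> lam X" and supp: "\<And>A. A \<in> U \<Longrightarrow> A \<inter> hcls e \<in> U" and S: "S \<in> U" "S \<subseteq> hcls e"
    and np: "\<And>p. {p} \<notin> U" and rigid: "\<And>g. g \<in> hcls e \<Longrightarrow> {z \<in> hcls e. g \<cdot> z \<in> S} \<in> U \<Longrightarrow> g = e"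
  shows False
proof -
  obtain M where M: "M \<in> U" "M \<subseteq> X" "\<forall>x\<in>M. \<forall>x'\<in>M.
      \<exists>y\<in>X. {z \<in> X. x \<cdot> y \<cdot> z \<in> S} \<in> U \<and> {z \<in> X. x' \<cdot> y \<cdot> z \<in> S} \<in> U"
    by (rule regular_obtain[OF U S(1)])
  have ne: "A \<noteq> {}" if "A \<in> U" for A using upfamily_nonempty[OF lam_upfamily[OF U] that] .
  have "M \<inter> hcls e \<in> U" using supp M(1) by simp
  then obtain x where x: "x \<in> M" "x \<in> hcls e" using ne by blast
  \<comment> \<open>Absence of singletons is what provides two distinct left factors for the shared
    \<open>y\<close>.\<close>
  have "M \<inter> hcls e \<noteq> {x}" using np \<open>M \<inter> hcls e \<in> U\<close> by metis
  then obtain x' where x': "x' \<in> M" "x' \<in> hcls e" "x' \<noteq> x" using x by blast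
  obtain y where y: "y \<in> X" "{z \<in> X. x \<cdot> y \<cdot> z \<in> S} \<in> U" "{z \<in> X. x' \<cdot> y \<cdot> z \<in> S} \<in> U"
    using M(3) x(1) x'(1) by meson
  have key: "u \<cdot> y \<cdot> e = e" if u: "u \<in> hcls e" and Z: "{z \<in> X. u \<cdot> y \<cdot> z \<in> S} \<in> U" for u
  proof -
    have Z': "{z \<in> X. u \<cdot> y \<cdot> z \<in> S} \<inter> hcls e \<in> U" using supp Z by simp
    then obtain z where z: "z \<in> hcls e" "u \<cdot> y \<cdot> z \<in> S" using ne by blast
    note t = hcls_translate[OF u z(1) y(1) subsetD[OF S(2) z(2)]]
    have "{z \<in> X. u \<cdot> y \<cdot> z \<in> S} \<inter> hcls e = {z \<in> hcls e. u \<cdot> y \<cdot> e \<cdot> z \<in> S}"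
      using t(2) hclsD(1) by auto
    then show ?thesis using rigid[OF t(1)] Z' by simp
  qed
  have 1: "x \<cdot> y \<cdot> e = e" "x' \<cdot> y \<cdot> e = e" using key x x' y by auto
  obtain i where i: "i \<in> hcls e" "i \<cdot> x = e" "x \<cdot> i = e" using hcls_inverse[OF x(2)] by metis
  obtain i' where i': "i' \<in> hcls e" "i' \<cdot> x' = e" "x' \<cdot> i' = e" using hcls_inverse[OF x'(2)] by metis
  note X = hclsD(1)[OF x(2)] hclsD(1)[OF x'(2)] hclsD(1)[OF i(1)] hclsD(1)[OF i'(1)]
  have eX: "e \<in> X" using X i by auto
  \<comment> \<open>The single element \<open>e \<cdot> y \<cdot> e\<close> is thus the inverse of
    both \<open>x\<close> and \<open>x'\<close>.\<close>
  have "e \<cdot> y \<cdot> e = i \<cdot> (x \<cdot> y \<cdot> e)" "e \<cdot> y \<cdot> e = i' \<cdot> (x' \<cdot> y \<cdot> e)"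
    using i i' X y(1) eX by (metis assoc closed)+
  then have "i = i'" using 1 hclsD(3)[OF i(1)] hclsD(3)[OF i'(1)] by simp
  then have "x' = x" using hcls_cancel[OF i(1) x(2) x'(2)] i i' by simp
  then show False using x' by simp
qed

text \<open>A further element \<open>b\<close> would make \<open>majority e a b\<close> rigid for
  \<open>{e, a}\<close>: a nontrivial translation bringing two of \<open>e\<close>,
  \<open>a\<close>, \<open>b\<close> into that set must be by the inverse of \<open>a\<close>, and
  then \<open>b\<close> is \<open>a\<close> or \<open>a \<cdot> a\<close>.\<close>

lemma group_bound_noninvolution:
  assumes e: "e \<in> E" and a: "a \<in> hcls e" "a \<cdot> a \<noteq> e" "a' \<in> hcls e" "a \<cdot> a' = e"
    and b: "b \<in> hcls e"
  shows "b \<in> {e, a, a', a \<cdot> a}"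
proof (rule ccontr)
  assume n: "\<not> ?thesis"
  note eh = hcls_id[OF e]
  note X = E_D(1)[OF e] hclsD(1)[OF a(1)] hclsD(1)[OF a(3)] hclsD(1)[OF b]
  have canc: "u \<cdot> v = u \<cdot> w \<longleftrightarrow> v = w" if "u \<in> hcls e" "v \<in> hcls e" "w \<in> hcls e" for u v w
    using hcls_cancel that by blast
  have aa: "a \<cdot> a \<in> hcls e" using hcls_mult a by blast
  have ae: "a \<noteq> e" using a(2) E_D(2)[OF e] by auto
  have a1: "a \<cdot> a \<noteq> a" using canc[of a a e] a eh ae hclsD(3)[OF a(1)] by simp
  have a2: "a \<cdot> b \<noteq> e" "a \<cdot> b \<noteq> a"
    using canc[of a b a'] canc[of a b e] a b eh n hclsD(3)[OF a(1)] by auto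
  show False
  proof (rule rigid_not_regular[of "majority e a b" e "{e, a}"])
    show "majority e a b \<in> lam X" using X by simp
    show "{e, a} \<in> majority e a b" "{e, a} \<subseteq> hcls e" using X a eh by (simp_all add: in_majority)
    show "A \<inter> hcls e \<in> majority e a b" if "A \<in> majority e a b" for A
      using that a b eh unfolding majority_def by auto
    show "{p} \<notin> majority e a b" for p using n ae unfolding majority_def by auto
    fix g assume g: "g \<in> hcls e" "{z \<in> hcls e. g \<cdot> z \<in> {e, a}} \<in> majority e a b"
    show "g = e"
    proof (rule ccontr)
      assume ge: "g \<noteq> e"
      have g': "g \<cdot> e = g" using hclsD(3) g(1) .
      have "g \<noteq> a" using g a1 a2 a(2) g' ge unfolding majority_def by auto
      then have gab: "g \<cdot> a \<in> {e, a}" "g \<cdot> b \<in> {e, a}"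
        using g(2) ge g' unfolding majority_def by auto
      have "g \<cdot> a \<noteq> a" using hcls_cancel_right[OF a(1) g(1) eh] ge hclsD(2)[OF a(1)] by metis
      then have ga: "g \<cdot> a = e" using gab by simp
      have "a \<cdot> (g \<cdot> b) = (a \<cdot> g) \<cdot> b" using X hclsD(1)[OF g(1)] by (simp add: assoc)
      moreover have "a \<cdot> g = e"
      proof -
        have "g \<cdot> (a \<cdot> g) = g \<cdot> e" using ga g X hclsD[OF g(1)] by (simp flip: assoc)
        then show ?thesis using canc[OF g(1) hcls_mult[OF a(1) g(1)] eh] by simp
      qed
      ultimately have "a \<cdot> (g \<cdot> b) = b" using hclsD(2)[OF b] by simp
      then have "b = a \<or> b = a \<cdot> a" using gab(2) hclsD(3)[OF a(1)] by auto
      then show False using n by auto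
    qed
  qed
qed

lemma hcls_involutions_comm:
  assumes inv: "\<And>x. x \<in> hcls e \<Longrightarrow> x \<cdot> x = e" and u: "u \<in> hcls e" and v: "v \<in> hcls e"
  shows "u \<cdot> v = v \<cdot> u"
proof (rule hcls_cancel_right[OF hcls_mult[OF u v] hcls_mult[OF u v] hcls_mult[OF v u]])
  have "(v \<cdot> u) \<cdot> (u \<cdot> v) = v \<cdot> (u \<cdot> u) \<cdot> v" using u v hclsD(1) by (simp add: assoc)
  also have "\<dots> = e" using inv u v hclsD(3) by simp
  finally show "(u \<cdot> v) \<cdot> (u \<cdot> v) = (v \<cdot> u) \<cdot> (u \<cdot> v)" using inv[OF hcls_mult[OF u v]] by simp
qed

text \<open>Three points always translate into a four-element subgroup, where systems are regular by
  \<open>V4_lam\<close>, so a \<open>star\<close> on four points is needed. Translating by one of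
  \<open>a\<close>, \<open>b\<close>, \<open>c\<close> moves none of them into
  \<open>{a, b, c}\<close>; any other translation has to permute these three, which only the trivial
  one does.\<close>

lemma group_bound_involutions:
  assumes e: "e \<in> E" and inv: "\<And>x. x \<in> hcls e \<Longrightarrow> x \<cdot> x = e"
    and a: "a \<in> hcls e" and b: "b \<in> hcls e" and c: "c \<in> hcls e" and ab: "a \<noteq> e" "b \<noteq> e" "a \<noteq> b"
  shows "c \<in> {e, a, b, a \<cdot> b}"
proof (rule ccontr)
  assume n: "\<not> ?thesis"
  note eh = hcls_id[OF e]
  note X = E_D(1)[OF e] hclsD(1)[OF a] hclsD(1)[OF b] hclsD(1)[OF c]
  have sol: "u \<cdot> v = w \<longleftrightarrow> u = w \<cdot> v" if "u \<in> hcls e" "v \<in> hcls e" "w \<in> hcls e" for u v w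
    using inv[OF that(2)] that hclsD assoc by metis
  have sol': "u \<cdot> v = w \<longleftrightarrow> v = u \<cdot> w" if "u \<in> hcls e" "v \<in> hcls e" "w \<in> hcls e" for u v w
    using inv[OF that(1)] that hclsD assoc by metis
  have comm: "u \<cdot> v = v \<cdot> u" if "u \<in> hcls e" "v \<in> hcls e" for u v
    by (rule hcls_involutions_comm[of e]) (use inv that in simp_all)
  have abc: "c \<noteq> e" "c \<noteq> a" "c \<noteq> b" "c \<noteq> a \<cdot> b" using n by auto
  have np: "u \<cdot> v \<noteq> e" "u \<cdot> v \<noteq> u" "u \<cdot> v \<noteq> v"
    if "u \<in> hcls e" "v \<in> hcls e" "u \<noteq> e" "v \<noteq> e" "u \<noteq> v" for u v
    using that sol[OF that(1,2) eh] sol'[OF that(1,2,1)] sol[OF that(1,2,2)]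
      inv[OF that(1)] inv[OF that(2)] hclsD(2)[OF that(2)] by metis+
  have prods: "a \<cdot> b \<notin> {e, a, b, c}" "a \<cdot> c \<notin> {e, a, b, c}" "b \<cdot> c \<notin> {e, a, b, c}"
    using np[OF a b] np[OF a c] np[OF b c] ab abc sol'[OF a c b] sol'[OF b c a] comm[OF a b] by auto
  have comms: "b \<cdot> a = a \<cdot> b" "c \<cdot> a = a \<cdot> c" "c \<cdot> b = b \<cdot> c" using comm a b c by auto
  show False
  proof (rule rigid_not_regular[of "star e a b c" e "{a, b, c}"])
    show "star e a b c \<in> lam X" using X by simp
    show "{a, b, c} \<in> star e a b c" "{a, b, c} \<subseteq> hcls e" using X a b c by (simp_all add: in_star)
    show "A \<inter> hcls e \<in> star e a b c" if "A \<in> star e a b c" for A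
      using that a b c eh unfolding star_def by auto
    show "{p} \<notin> star e a b c" for p using abc ab unfolding star_def by auto
    fix g assume g: "g \<in> hcls e" "{z \<in> hcls e. g \<cdot> z \<in> {a, b, c}} \<in> star e a b c"
    have g': "g \<cdot> e = g" using hclsD(3) g(1) .
    show "g = e"
    proof (cases "g \<in> {a, b, c}")
      case True
      have "a \<notin> {z \<in> hcls e. g \<cdot> z \<in> {a, b, c}}" "b \<notin> {z \<in> hcls e. g \<cdot> z \<in> {a, b, c}}"
        "c \<notin> {z \<in> hcls e. g \<cdot> z \<in> {a, b, c}}"
        using True prods comms inv[OF a] inv[OF b] inv[OF c] ab abc by auto
      then show ?thesis using g(2) unfolding star_def by blast
    next
      case False
      then have G: "g \<cdot> a \<in> {a, b, c}" "g \<cdot> b \<in> {a, b, c}" "g \<cdot> c \<in> {a, b, c}"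
        using g(2) g' unfolding star_def by auto
      have "g \<cdot> c = a \<cdot> (b \<cdot> c)" if "g = a \<cdot> b" using that X by (simp add: assoc)
      moreover have "g \<cdot> b = a \<cdot> (b \<cdot> c)" if "g = a \<cdot> c" using that X comms by (simp add: assoc)
      moreover have "a \<cdot> (b \<cdot> c) \<noteq> a" "a \<cdot> (b \<cdot> c) \<noteq> b" "a \<cdot> (b \<cdot> c) \<noteq> c"
        using sol'[OF a hcls_mult[OF b c] a] sol'[OF a hcls_mult[OF b c] b] sol'[OF a hcls_mult[OF b c] c]
          prods inv[OF a] hcls_cancel[OF b c a] hcls_cancel_right[OF c b a] comms ab abc by auto
      moreover have "g = e \<or> g = a \<cdot> b \<or> g = a \<cdot> c"
        using G(1) sol[OF g(1) a a] sol[OF g(1) a b] sol[OF g(1) a c] inv[OF a] comms by auto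
      ultimately show ?thesis using G by auto
    qed
  qed
qed

text \<open>For two such elements \<open>majority a b f\<close> is not regular. Values with left
  factor in the lower group never equal \<open>f\<close>, so two of \<open>a\<close>,
  \<open>b\<close>, \<open>f\<close> must be sent to \<open>a\<close>; as \<open>f\<close> acts
  there like \<open>e\<close>, this contradicts cancellation in the group.\<close>

lemma lower_group_small:
  assumes e: "e \<in> E" and f: "f \<in> E" and ef: "e \<cdot> f = e" "e \<noteq> f"
    and a: "a \<in> hcls e" "a \<noteq> e" and b: "b \<in> hcls e" "b \<noteq> e"
  shows "a = b"
proof (rule ccontr)
  assume ab: "a \<noteq> b"
  define U where "U = majority a b f"
  note X = E_D(1)[OF e] E_D(1)[OF f] hclsD(1)[OF a(1)] hclsD(1)[OF b(1)]
  have U: "U \<in> lam X" "{a, f} \<in> U" unfolding U_def using X by (auto simp: in_majority)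
  obtain M where M: "M \<in> U" "M \<subseteq> X" "\<forall>x\<in>M. \<forall>x'\<in>M.
      \<exists>y\<in>X. {z \<in> X. x \<cdot> y \<cdot> z \<in> {a, f}} \<in> U \<and> {z \<in> X. x' \<cdot> y \<cdot> z \<in> {a, f}} \<in> U"
    by (rule regular_obtain[OF U])
  have "a \<in> M \<or> b \<in> M" using M(1) unfolding U_def majority_def by blast
  then obtain x where x: "x \<in> M" "x \<in> hcls e" using a b by blast
  then obtain y where y: "y \<in> X" "{z \<in> X. x \<cdot> y \<cdot> z \<in> {a, f}} \<in> U" using M(3) by meson
  note xX = hclsD(1)[OF x(2)]
  have only_a: "x \<cdot> y \<cdot> z = a" if "x \<cdot> y \<cdot> z \<in> {a, f}" "z \<in> X" for z
  proof -
    have "e \<cdot> (x \<cdot> y \<cdot> z) = x \<cdot> y \<cdot> z" using X xX y(1) that hclsD(2)[OF x(2)] by (simp flip: assoc)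
    then show ?thesis using that ef by auto
  qed
  have two: "x \<cdot> y \<cdot> a = a \<and> x \<cdot> y \<cdot> b = a \<or> x \<cdot> y \<cdot> a = a \<and> x \<cdot> y \<cdot> f = a \<or> x \<cdot> y \<cdot> b = a \<and> x \<cdot> y \<cdot> f = a"
    using y(2) only_a X unfolding U_def majority_def by blast
  then have "x \<cdot> y \<cdot> a \<in> hcls e \<or> x \<cdot> y \<cdot> b \<in> hcls e" using a by auto
  then have t: "x \<cdot> y \<cdot> e \<in> hcls e" "\<And>z. z \<in> hcls e \<Longrightarrow> x \<cdot> y \<cdot> e \<cdot> z = x \<cdot> y \<cdot> z"
    using hcls_translate[OF x(2) a(1) y(1)] hcls_translate[OF x(2) b(1) y(1)] by metis+
  have "x \<cdot> y \<cdot> e = a" if "x \<cdot> y \<cdot> f = a"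
  proof -
    have "f \<cdot> e = e" using E_comm e f ef by metis
    then have "x \<cdot> y \<cdot> e = (x \<cdot> y \<cdot> f) \<cdot> e" using xX X y(1) by (simp add: assoc)
    then show ?thesis using that hclsD(3)[OF a(1)] by simp
  qed
  then have "x \<cdot> y \<cdot> f = a \<Longrightarrow> x \<cdot> y \<cdot> e \<cdot> e = a"
    using hclsD(3)[OF t(1)] by simp
  then consider "x \<cdot> y \<cdot> e \<cdot> a = x \<cdot> y \<cdot> e \<cdot> b" | "x \<cdot> y \<cdot> e \<cdot> a = x \<cdot> y \<cdot> e \<cdot> e" | "x \<cdot> y \<cdot> e \<cdot> b = x \<cdot> y \<cdot> e \<cdot> e"
    using two t(2)[OF a(1)] t(2)[OF b(1)] by metis
  then show False
    using hcls_cancel[OF t(1)] a b ab hcls_id[OF e] by cases blast+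
qed

text \<open>The witness is \<open>majority e h g\<close>. The factor \<open>e\<close> can never
  produce \<open>h\<close> or \<open>g\<close>, so \<open>h\<close> must be both a left and a right
  factor, along with \<open>g\<close> on the right.\<close>

lemma middle_group_trivial:
  assumes e: "e \<in> E" and f: "f \<in> E" and g: "g \<in> E"
    and ef: "e \<cdot> f = e" "e \<noteq> f" and fg: "f \<cdot> g = f" "f \<noteq> g" and h: "h \<in> hcls f"
  shows "h = f"
proof (rule ccontr)
  assume hf: "h \<noteq> f"
  define U where "U = majority e h g"
  note X = E_D(1)[OF e] E_D(1)[OF f] E_D(1)[OF g] hclsD(1)[OF h]
  have U: "U \<in> lam X" "{h, g} \<in> U" unfolding U_def using X by (auto simp: in_majority)
  obtain M where M: "M \<in> U" "M \<subseteq> X" "\<forall>x\<in>M. \<forall>x'\<in>M.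
      \<exists>y\<in>X. {z \<in> X. x \<cdot> y \<cdot> z \<in> {h, g}} \<in> U \<and> {z \<in> X. x' \<cdot> y \<cdot> z \<in> {h, g}} \<in> U"
    by (rule regular_obtain[OF U])
  obtain h' where h': "h' \<in> X" "h \<cdot> h' = f" using hcls_inverse[OF h] hclsD(1) by metis
  have eh: "e \<cdot> h \<noteq> h"
  proof
    assume "e \<cdot> h = h"
    then have "e \<cdot> f = f" using h' X by (metis assoc)
    then show False using ef by simp
  qed
  have eg: "e \<cdot> g = e" using E_trans[OF X(1-3) ef(1) fg(1)] .
  have "e \<noteq> g" using ef fg E_comm[OF e f] by metis
  have left: "e \<cdot> w \<noteq> w" if "w \<in> {h, g}" for w using that eh eg \<open>e \<noteq> g\<close> by auto
  have "e \<notin> M"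
  proof
    assume "e \<in> M"
    then obtain y where y: "y \<in> X" "{z \<in> X. e \<cdot> y \<cdot> z \<in> {h, g}} \<in> U" using M(3) by meson
    then obtain z where "z \<in> X" "e \<cdot> y \<cdot> z \<in> {h, g}"
      using upfamily_nonempty[OF lam_upfamily[OF U(1)]] by blast
    moreover from this have "e \<cdot> (e \<cdot> y \<cdot> z) = e \<cdot> y \<cdot> z"
      using X y(1) E_D(2)[OF e] by (simp flip: assoc)
    ultimately show False using left by metis
  qed
  then have "h \<in> M" using M(1) unfolding U_def majority_def by blast
  then obtain y where y: "y \<in> X" "{z \<in> X. h \<cdot> y \<cdot> z \<in> {h, g}} \<in> U" using M(3) by meson
  have "h \<cdot> y \<cdot> e \<notin> {h, g}"
  proof
    assume a: "h \<cdot> y \<cdot> e \<in> {h, g}"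
    have "e \<cdot> (h \<cdot> y \<cdot> e) = h \<cdot> y \<cdot> e"
      using E_central[OF e, of "h \<cdot> y \<cdot> e"] X y(1) E_D(2)[OF e] by (simp add: assoc)
    then show False using left a by metis
  qed
  then have hy: "h \<cdot> y \<cdot> h \<in> {h, g}" "h \<cdot> y \<cdot> g \<in> {h, g}"
    using y(2) unfolding U_def majority_def by auto
  have "f \<cdot> (h \<cdot> y \<cdot> z) = h \<cdot> y \<cdot> z" if "z \<in> X" for z
    using X y(1) that hclsD(2)[OF h] by (simp flip: assoc)
  \<comment> \<open>Values starting with \<open>h\<close> lie below \<open>f\<close>, so
    \<open>g\<close> is never hit. Comparing the two right factors gives
    \<open>h \<cdot> y \<cdot> f = h\<close>, and hence \<open>h \<cdot> h = h\<close>.\<close>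
  then have hy': "h \<cdot> y \<cdot> h = h" "h \<cdot> y \<cdot> g = h" using hy fg X by (metis insertE empty_iff)+
  have "g \<cdot> f = f" using E_comm[OF g f] fg by simp
  then have "(h \<cdot> y \<cdot> g) \<cdot> f = h \<cdot> y \<cdot> f" using X y(1) by (simp add: assoc)
  then have "h \<cdot> y \<cdot> f = h" using hy' hclsD(3)[OF h] by simp
  moreover have "h \<cdot> y \<cdot> h = (h \<cdot> y \<cdot> f) \<cdot> h" using X y(1) hclsD(2)[OF h] by (simp add: assoc)
  ultimately have "h \<cdot> h = h \<cdot> f" using hy' hclsD(3)[OF h] by simp
  then show False using hcls_cancel[OF h h hcls_id[OF f]] hf by simp
qed

end

section \<open>Idempotent maximal linked systems that do not commute\<close>

context icsgrp
begin

text \<open>For two zeros \<open>c\<close>, \<open>d\<close> of the group \<open>{f, h}\<close>, the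
  majorities \<open>?U c\<close> and \<open>?U d\<close> are right zeros for each other, so
  commuting would make them equal.\<close>

lemma involution_fixed_unique:
  assumes X: "f \<in> X" "h \<in> X" "c \<in> X" "d \<in> X"
    and t: "f \<cdot> f = f" "f \<cdot> h = h" "h \<cdot> f = h" "h \<cdot> h = f" "h \<noteq> f"
    and c: "c \<cdot> f = c" "f \<cdot> c = c" "c \<cdot> h = c" "h \<cdot> c = c"
    and d: "d \<cdot> f = d" "f \<cdot> d = d" "d \<cdot> h = d" "h \<cdot> d = d"
  shows "c = d"
proof (rule ccontr)
  assume n: "c \<noteq> d"
  let ?U = "\<lambda>c. majority c f h"
  have idem: "?U c \<star> ?U d = ?U d"
    if "c \<in> X" "c \<cdot> f = c" "f \<cdot> c = c" "c \<cdot> h = c" "h \<cdot> c = c"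
      "d \<in> X" "d \<cdot> f = d" "f \<cdot> d = d" "d \<cdot> h = d" "h \<cdot> d = d" for c d
    by (rule lam_eqI'[symmetric]) (use that X t in \<open>auto simp: um_lam in_um in_majority\<close>)
  have "?U c = ?U d"
    using idempotents_swap[of "?U c" "?U d"] idem[of c d] idem[of d c] idem[of c c] idem[of d d] X c d
    by simp
  moreover have "{c, f} \<in> ?U c" using X by (simp add: in_majority)
  moreover have "d \<noteq> f" "h \<noteq> c" "c \<noteq> f" using c d t by auto
  ultimately show False using n t X by (auto simp: in_majority)
qed

text \<open>Again two right zeros: \<open>?U \<star> ?V = ?V\<close> and
  \<open>?V \<star> ?U = ?U\<close>, separated by the set \<open>{z, e}\<close>.\<close>

lemma no_zero_C3:
  assumes X: "z \<in> X" "e \<in> X" "a \<in> X" "b \<in> X"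
    and t: "z \<cdot> z = z" "z \<cdot> e = z" "z \<cdot> a = z" "z \<cdot> b = z" "e \<cdot> z = z" "a \<cdot> z = z" "b \<cdot> z = z"
      "e \<cdot> e = e" "e \<cdot> a = a" "e \<cdot> b = b" "a \<cdot> e = a" "b \<cdot> e = b"
      "a \<cdot> a = b" "a \<cdot> b = e" "b \<cdot> a = e" "b \<cdot> b = a"
    and ne: "e \<noteq> a" "e \<noteq> b" "a \<noteq> b" "z \<noteq> e" "z \<noteq> a" "z \<noteq> b"
  shows False
proof -
  let ?U = "star z e a b" and ?V = "majority e a b"
  have "?U \<star> ?U = ?U" "?V \<star> ?V = ?V" "?U \<star> ?V = ?V" "?V \<star> ?U = ?U"
    by (rule lam_eqI'[symmetric]; use X t in \<open>auto simp: um_lam in_um in_majority in_star\<close>)+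
  then have "?U = ?V" using idempotents_swap[of ?U ?V] X by simp
  moreover have "{z, e} \<in> ?U" using X by (simp add: in_star)
  ultimately show False using X ne by (auto simp: in_majority)
qed

text \<open>The star gives two votes to the identity and one each to \<open>z\<close> and the
  generators \<open>a\<close>, \<open>c\<close>; the majority uses \<open>z\<close> and the subgroup
  of order two. For the set \<open>{z, a}\<close> the good left factors are \<open>z\<close>,
  \<open>a\<close>, \<open>c\<close> in one order but only \<open>z\<close> in the other.\<close>

lemma no_zero_C4:
  assumes X: "z \<in> X" "e \<in> X" "a \<in> X" "b \<in> X" "c \<in> X"
    and t: "z \<cdot> z = z" "z \<cdot> e = z" "z \<cdot> a = z" "z \<cdot> b = z" "z \<cdot> c = z"
      "e \<cdot> z = z" "a \<cdot> z = z" "b \<cdot> z = z" "c \<cdot> z = z"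
      "e \<cdot> e = e" "e \<cdot> a = a" "e \<cdot> b = b" "e \<cdot> c = c" "a \<cdot> e = a" "b \<cdot> e = b" "c \<cdot> e = c"
      "a \<cdot> a = b" "a \<cdot> b = c" "a \<cdot> c = e" "b \<cdot> a = c" "b \<cdot> b = e" "b \<cdot> c = a" "c \<cdot> a = e" "c \<cdot> b = a" "c \<cdot> c = b"
    and ne: "e \<noteq> a" "e \<noteq> b" "e \<noteq> c" "a \<noteq> b" "a \<noteq> c" "b \<noteq> c" "z \<noteq> e" "z \<noteq> a" "z \<noteq> b" "z \<noteq> c"
  shows False
proof -
  let ?U = "star e z a c" and ?V = "majority z e b"
  have "?U \<star> ?U = ?U" "?V \<star> ?V = ?V"
    by (rule lam_eqI'[symmetric]; use X t in \<open>auto simp: um_lam in_um in_majority in_star\<close>)+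
  then have eq: "?U \<star> ?V = ?V \<star> ?U" using idempotents_swap[of ?U ?V] X by simp
  have "{z, a} \<in> ?U \<star> ?V" using X t by (simp add: in_um in_star in_majority)
  moreover have "{z, a} \<notin> ?V \<star> ?U" using X t ne by (simp add: in_um in_star in_majority)
  ultimately show False using eq by simp
qed

text \<open>For the set \<open>{z, e}\<close> the good left factors are \<open>z\<close>,
  \<open>e\<close>, \<open>a\<close> in \<open>?V \<star> ?U\<close> but only \<open>z\<close> in
  \<open>?U \<star> ?V\<close>, and \<open>z\<close> alone does not win the majority.\<close>

lemma no_zero_V4:
  assumes X: "z \<in> X" "e \<in> X" "a \<in> X" "b \<in> X" "c \<in> X"
    and t: "z \<cdot> z = z" "z \<cdot> e = z" "z \<cdot> a = z" "z \<cdot> b = z" "z \<cdot> c = z"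
      "e \<cdot> z = z" "a \<cdot> z = z" "b \<cdot> z = z" "c \<cdot> z = z"
      "e \<cdot> e = e" "e \<cdot> a = a" "e \<cdot> b = b" "e \<cdot> c = c" "a \<cdot> e = a" "b \<cdot> e = b" "c \<cdot> e = c"
      "a \<cdot> a = e" "a \<cdot> b = c" "a \<cdot> c = b" "b \<cdot> a = c" "b \<cdot> b = e" "b \<cdot> c = a" "c \<cdot> a = b" "c \<cdot> b = a" "c \<cdot> c = e"
    and ne: "e \<noteq> a" "e \<noteq> b" "e \<noteq> c" "a \<noteq> b" "a \<noteq> c" "b \<noteq> c" "z \<noteq> e" "z \<noteq> a" "z \<noteq> b" "z \<noteq> c"
  shows False
proof -
  let ?U = "majority z e a" and ?V = "star e a b c"
  have "?U \<star> ?U = ?U" "?V \<star> ?V = ?V"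
    by (rule lam_eqI'[symmetric]; use X t in \<open>auto simp: um_lam in_um in_majority in_star\<close>)+
  then have eq: "?U \<star> ?V = ?V \<star> ?U" using idempotents_swap[of ?U ?V] X by simp
  have "{z, e} \<in> ?V \<star> ?U" using X t by (simp add: in_um in_star in_majority)
  moreover have "{z, e} \<notin> ?U \<star> ?V" using X t ne by (simp add: in_um in_star in_majority)
  ultimately show False using eq by simp
qed

end

section \<open>Multiplication tables\<close>

text \<open>Isomorphism types are handled as labelled multiplication tables, which keeps complex
  numbers out of the case analysis; the lemmas on model semigroups translate them.\<close>

definition C2_table where
  "C2_table G m e a \<longleftrightarrow> G = {e, a} \<and> e \<noteq> a \<and> m e e = e \<and> m e a = a \<and> m a e = a \<and> m a a = e"

definition C3_table where
  "C3_table G m e a b \<longleftrightarrow> G = {e, a, b} \<and> e \<noteq> a \<and> e \<noteq> b \<and> a \<noteq> b \<and>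
    m e e = e \<and> m e a = a \<and> m e b = b \<and> m a e = a \<and> m b e = b \<and>
    m a a = b \<and> m a b = e \<and> m b a = e \<and> m b b = a"

definition C4_table where
  "C4_table G m e a b c \<longleftrightarrow> G = {e, a, b, c} \<and> e \<noteq> a \<and> e \<noteq> b \<and> e \<noteq> c \<and> a \<noteq> b \<and> a \<noteq> c \<and> b \<noteq> c \<and>
    m e e = e \<and> m e a = a \<and> m e b = b \<and> m e c = c \<and> m a e = a \<and> m b e = b \<and> m c e = c \<and>
    m a a = b \<and> m a b = c \<and> m a c = e \<and> m b a = c \<and> m b b = e \<and> m b c = a \<and>
    m c a = e \<and> m c b = a \<and> m c c = b"

definition V4_table where
  "V4_table G m e a b c \<longleftrightarrow> G = {e, a, b, c} \<and> e \<noteq> a \<and> e \<noteq> b \<and> e \<noteq> c \<and> a \<noteq> b \<and> a \<noteq> c \<and> b \<noteq> c \<and>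
    m e e = e \<and> m e a = a \<and> m e b = b \<and> m e c = c \<and> m a e = a \<and> m b e = b \<and> m c e = c \<and>
    m a a = e \<and> m a b = c \<and> m a c = b \<and> m b a = c \<and> m b b = e \<and> m b c = a \<and>
    m c a = b \<and> m c b = a \<and> m c c = e"

text \<open>In the next two tables \<open>e, h\<close> is the upper copy of \<open>C2\<close>; below it lie the zero \<open>z\<close>,
  respectively the isomorphic copy \<open>z, w\<close>.\<close>

definition L1C2_table where
  "L1C2_table G m z e h \<longleftrightarrow> G = {z, e, h} \<and> z \<noteq> e \<and> z \<noteq> h \<and> e \<noteq> h \<and>
    m z z = z \<and> m z e = z \<and> m z h = z \<and> m e z = z \<and> m h z = z \<and>
    m e e = e \<and> m e h = h \<and> m h e = h \<and> m h h = e"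

definition L2C2_table where
  "L2C2_table G m z w e h \<longleftrightarrow> G = {z, w, e, h} \<and> z \<noteq> w \<and> z \<noteq> e \<and> z \<noteq> h \<and> w \<noteq> e \<and> w \<noteq> h \<and> e \<noteq> h \<and>
    m z z = z \<and> m z w = w \<and> m w z = w \<and> m w w = z \<and>
    m z e = z \<and> m e z = z \<and> m z h = w \<and> m h z = w \<and> m w e = w \<and> m e w = w \<and> m w h = z \<and> m h w = z \<and>
    m e e = e \<and> m e h = h \<and> m h e = h \<and> m h h = e"

text \<open>With the ambient associativity this is a finite linear order under minimum, possibly
  empty.\<close>

definition chain_table where
  "chain_table L m \<longleftrightarrow> finite L \<and> (\<forall>x\<in>L. \<forall>y\<in>L. m x y = m y x \<and> m x y \<in> {x, y})"

text \<open>The group \<open>{b, h}\<close> sits at the bottom, so each element of \<open>L\<close>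
  acts on it as an identity. An empty \<open>L\<close> gives \<open>C2\<close>.\<close>

definition C2_chain_table where
  "C2_chain_table G m b h L \<longleftrightarrow> G = {b, h} \<union> L \<and> b \<noteq> h \<and> b \<notin> L \<and> h \<notin> L \<and> chain_table L m \<and>
    m b b = b \<and> m b h = h \<and> m h b = h \<and> m h h = b \<and>
    (\<forall>x\<in>L. m b x = b \<and> m x b = b \<and> m h x = h \<and> m x h = h)"

section \<open>Least and greatest elements of finite chains\<close>

lemma chain_least:
  assumes "finite K" "K \<noteq> {}" "\<And>x y. x \<in> K \<Longrightarrow> y \<in> K \<Longrightarrow> m x y = m y x \<and> m x y \<in> {x, y}"
    and assoc: "\<And>x y z. x \<in> K \<Longrightarrow> y \<in> K \<Longrightarrow> z \<in> K \<Longrightarrow> m (m x y) z = m x (m y z)"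
  shows "\<exists>u\<in>K. \<forall>x\<in>K. m u x = u"
  using assms
proof (induction rule: finite_ne_induct)
  case (singleton x)
  then show ?case by simp
next
  case (insert x F)
  have "\<exists>u\<in>F. \<forall>y\<in>F. m u y = u"
    by (rule insert.IH) (use insert.prems in simp_all)
  then obtain u where u: "u \<in> F" "\<forall>y\<in>F. m u y = u" by blast
  have ux: "m u x = m x u" "m u x \<in> {u, x}" using insert.prems(1)[of u x] u by auto
  show ?case
  proof (cases "m u x = u")
    case True
    then show ?thesis using u by auto
  next
    case False
    then have xu: "m u x = x" "m x u = x" using ux by auto
    have "m x y = x" if y: "y \<in> F" for y
    proof -
      have "m x y = m (m x u) y" using xu by simp
      also have "\<dots> = m x (m u y)" using insert.prems(2)[of x u y] u y by simp
      finally show ?thesis using u y xu by simp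
    qed
    moreover have "m x x = x" using insert.prems(1)[of x x] by simp
    ultimately show ?thesis by auto
  qed
qed

lemma chain_greatest:
  assumes "finite K" "K \<noteq> {}" "\<And>x y. x \<in> K \<Longrightarrow> y \<in> K \<Longrightarrow> m x y = m y x \<and> m x y \<in> {x, y}"
    and assoc: "\<And>x y z. x \<in> K \<Longrightarrow> y \<in> K \<Longrightarrow> z \<in> K \<Longrightarrow> m (m x y) z = m x (m y z)"
  shows "\<exists>u\<in>K. \<forall>x\<in>K. m x u = x"
  using assms
proof (induction rule: finite_ne_induct)
  case (singleton x)
  then show ?case by simp
next
  case (insert x F)
  have "\<exists>u\<in>F. \<forall>y\<in>F. m y u = y"
    by (rule insert.IH) (use insert.prems in simp_all)
  then obtain u where u: "u \<in> F" "\<forall>y\<in>F. m y u = y" by blast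
  have ux: "m u x = m x u" "m u x \<in> {u, x}" using insert.prems(1)[of u x] u by auto
  show ?case
  proof (cases "m u x = x")
    case True
    then show ?thesis using u ux by auto
  next
    case False
    then have xu: "m u x = u" "m x u = u" using ux by auto
    have "m y x = y" if y: "y \<in> F" for y
    proof -
      have "m y x = m (m y u) x" using u y by simp
      also have "\<dots> = m y (m u x)" using insert.prems(2)[of y u x] u y by simp
      finally show ?thesis using u y xu by simp
    qed
    moreover have "m x x = x" using insert.prems(1)[of x x] by simp
    ultimately show ?thesis by auto
  qed
qed

section \<open>Classification\<close>

context rsgrp
begin

text \<open>The two bounds leave at most four elements. With a non-involution \<open>a\<close> the
  group consists of \<open>e\<close>, \<open>a\<close>, its inverse and its square, and the type
  depends on whether the last two coincide.\<close>

lemma hcls_cases: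
  assumes e: "e \<in> E"
  shows "hcls e = {e} \<or> (\<exists>a. C2_table (hcls e) m e a) \<or> (\<exists>a b. C3_table (hcls e) m e a b) \<or>
    (\<exists>a b c. C4_table (hcls e) m e a b c) \<or> (\<exists>a b c. V4_table (hcls e) m e a b c)"
proof (cases "\<exists>a\<in>hcls e. a \<cdot> a \<noteq> e")
  case True
  then obtain a where a: "a \<in> hcls e" "a \<cdot> a \<noteq> e" by blast
  obtain c where c: "c \<in> hcls e" "a \<cdot> c = e" "c \<cdot> a = e" using hcls_inverse[OF a(1)] by metis
  define b where "b = a \<cdot> a"
  have b: "b \<in> hcls e" unfolding b_def using hcls_mult a by blast
  note eh = hcls_id[OF e]
  have G: "hcls e = {e, a, c, b}"
    using group_bound_noninvolution[OF e a c(1,2)] a c b eh unfolding b_def by blast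
  note X = E_D(1)[OF e] hclsD(1)[OF a(1)] hclsD(1)[OF b] hclsD(1)[OF c(1)]
  note units = E_D(2)[OF e] hclsD(2,3)[OF a(1)] hclsD(2,3)[OF b] hclsD(2,3)[OF c(1)]
  have ae: "e \<noteq> a" "e \<noteq> b" using a(2) units unfolding b_def by auto
  have ab: "a \<noteq> b" using hcls_cancel[OF a(1) a(1) eh] units ae unfolding b_def by auto
  have aa: "a \<cdot> a = b" "b \<cdot> a = a \<cdot> b" unfolding b_def using X by (simp_all add: assoc)
  have bb: "b \<cdot> b = a \<cdot> (a \<cdot> b)" unfolding b_def using X by (simp add: assoc)
  show ?thesis
  proof (cases "c = b")
    case True
    then have "C3_table (hcls e) m e a b"
      unfolding C3_table_def using G ae ab aa bb units c by auto
    then show ?thesis by blast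
  next
    case False
    have ec: "e \<noteq> c" "a \<noteq> c" using c a units ae by auto
    have "a \<cdot> b \<in> {e, a, c, b}" using hcls_mult[OF a(1) b] G by blast
    moreover have "a \<cdot> b \<noteq> e" using hcls_cancel[OF a(1) b c(1)] c False by auto
    moreover have "a \<cdot> b \<noteq> a" using hcls_cancel[OF a(1) b eh] units ae by auto
    moreover have "a \<cdot> b \<noteq> b" using hcls_cancel[OF a(1) b a(1)] aa ab by auto
    ultimately have abc: "a \<cdot> b = c" by simp
    have bc: "b \<cdot> c = a" "c \<cdot> b = a"
      unfolding b_def using X c units by (simp add: assoc, simp flip: assoc)
    have "c \<cdot> c = (c \<cdot> a) \<cdot> b" using abc X by (simp add: assoc)
    then have "c \<cdot> c = b" using c units by simp
    then have "C4_table (hcls e) m e a b c"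
      unfolding C4_table_def using G ae ab ec False aa bb abc bc units c by auto
    then show ?thesis by blast
  qed
next
  case False
  then have inv: "x \<cdot> x = e" if "x \<in> hcls e" for x using that by blast
  note eh = hcls_id[OF e]
  have comm: "u \<cdot> v = v \<cdot> u" if "u \<in> hcls e" "v \<in> hcls e" for u v
    by (rule hcls_involutions_comm[of e]) (use inv that in simp_all)
  show ?thesis
  proof (cases "hcls e = {e}")
    case False
    then obtain a where a: "a \<in> hcls e" "a \<noteq> e" using eh by blast
    note ua = hclsD[OF a(1)]
    show ?thesis
    proof (cases "hcls e = {e, a}")
      case True
      then have "C2_table (hcls e) m e a"
        unfolding C2_table_def using a ua inv eh by auto
      then show ?thesis by blast
    next
      case False
      then obtain b where b: "b \<in> hcls e" "b \<noteq> e" "b \<noteq> a" using a eh by blast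
      note ub = hclsD[OF b(1)]
      define c where "c = a \<cdot> b"
      have c: "c \<in> hcls e" unfolding c_def using hcls_mult a b by blast
      have G: "hcls e = {e, a, b, c}"
      proof -
        have "x \<in> {e, a, b, a \<cdot> b}" if x: "x \<in> hcls e" for x
          by (rule group_bound_involutions[OF e]) (use inv a b x in simp_all)
        then show ?thesis using a b c eh unfolding c_def by blast
      qed
      have ac: "a \<cdot> c = b" "b \<cdot> c = a" "a \<cdot> b = c"
      proof -
        show "a \<cdot> c = b" unfolding c_def using ua ub inv a(1) by (simp flip: assoc)
        have "b \<cdot> c = b \<cdot> (b \<cdot> a)" unfolding c_def using comm[OF a(1) b(1)] by simp
        then show "b \<cdot> c = a" using ua ub inv b(1) by (simp flip: assoc)
      qed (simp add: c_def)
      have ne: "c \<noteq> e" "c \<noteq> a" "c \<noteq> b"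
        using ac a b ua ub inv[OF a(1)] inv[OF b(1)] hclsD[OF c] by auto
      have "V4_table (hcls e) m e a b c"
        unfolding V4_table_def
        using G ac ne a b ua(2,3) ub(2,3) hclsD(2,3)[OF c] comm[OF a(1) b(1)] comm[OF a(1) c] comm[OF b(1) c]
          inv[OF a(1)] inv[OF b(1)] inv[OF c] inv[OF eh] by auto
      then show ?thesis by blast
    qed
  qed simp
qed

lemma E_hcls: "e \<in> E \<Longrightarrow> f \<in> E \<Longrightarrow> f \<in> hcls e \<Longrightarrow> f = e"
  using hcls_disjoint[of f e f] hcls_id by blast

text \<open>Reduces to \<open>involution_fixed_unique\<close>, where \<open>d\<close> has to be
  fixed on the left as well: cancelling \<open>d\<close> from
  \<open>d \<cdot> (c \<cdot> h) = d \<cdot> c\<close> gives \<open>c \<cdot> h = c\<close>, and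
  \<open>c\<close> is central.\<close>

lemma below_involution:
  assumes t: "t \<in> E" and h: "h \<in> hcls t" "h \<cdot> h = t" "h \<noteq> t"
    and b: "b \<in> E" "b \<cdot> t = b" "b \<cdot> h = b" and d: "d \<in> hcls c" "c \<in> E" "c \<cdot> t = c" "d \<cdot> h = d"
  shows "d = b"
proof (rule involution_fixed_unique[of t h d b, THEN sym, THEN sym])
  note X = E_D(1)[OF t] hclsD(1)[OF h(1)] E_D(1)[OF b(1)] hclsD(1)[OF d(1)] E_D(1)[OF d(2)]
  show "t \<in> X" "h \<in> X" "d \<in> X" "b \<in> X" by (fact X)+
  show "t \<cdot> t = t" "t \<cdot> h = h" "h \<cdot> t = h" "h \<cdot> h = t" "h \<noteq> t"
    using E_D(2)[OF t] hclsD[OF h(1)] h by auto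
  show dt: "d \<cdot> t = d" using hclsD(3)[OF d(1)] d X by (metis assoc)
  show td: "t \<cdot> d = d" using E_central[OF t] dt X by metis
  show "d \<cdot> h = d" by fact
  show "b \<cdot> t = b" "t \<cdot> b = b" "b \<cdot> h = b" "h \<cdot> b = b"
    using b E_central[OF b(1)] X by metis+
  have "h \<cdot> d = h \<cdot> (d \<cdot> h)" using d by simp
  have "c \<cdot> h \<in> hcls c" using hcls_restrict[OF d(2) t d(3) h(1)] .
  moreover have "d \<cdot> (c \<cdot> h) = d \<cdot> c" using d hclsD(3)[OF d(1)] X by (metis assoc)
  ultimately have "c \<cdot> h = c" using hcls_cancel[OF d(1) _ hcls_id[OF d(2)]] by blast
  then have "h \<cdot> c = c" using E_central[OF d(2)] X by metis
  then show "h \<cdot> d = d" using hclsD(2)[OF d(1)] X by (metis assoc)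
qed

text \<open>Multiplication by \<open>b\<close> maps the top group into a bottom group of order at
  most two. Groups larger than \<open>C2\<close> are mapped onto \<open>b\<close>, which makes
  \<open>b\<close> a zero for them, and the \<open>no_zero\<close> lemmas apply. For
  \<open>C2\<close> the image of the involution separates the two shapes.\<close>

lemma top_group_shape:
  assumes b: "b \<in> E" and t: "t \<in> E" and bt: "b \<noteq> t"
    and bot: "\<And>f. f \<in> E \<Longrightarrow> b \<cdot> f = b" and top: "\<And>f. f \<in> E \<Longrightarrow> f \<cdot> t = f" and nt: "hcls t \<noteq> {t}"
  shows "(\<exists>h. L1C2_table X m b t h) \<or> (\<exists>w h. L2C2_table X m b w t h)"
proof -
  note bt' = top[OF b]
  note bX = E_D(1)[OF b] and tX = E_D(1)[OF t]
  have small: "x = y" if "x \<in> hcls b" "x \<noteq> b" "y \<in> hcls b" "y \<noteq> b" for x y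
    using lower_group_small[OF b t bt' bt that] .
  have r: "b \<cdot> x \<in> hcls b" if "x \<in> hcls t" for x using hcls_restrict[OF b t bt' that] .
  have hom: "b \<cdot> (x \<cdot> y) = (b \<cdot> x) \<cdot> (b \<cdot> y)" if "x \<in> hcls t" "y \<in> hcls t" for x y
    using that hclsD(1) hclsD(3)[OF r[OF that(1)]] bX by (metis assoc closed)
  \<comment> \<open>Squares vanish in a group of order at most two.\<close>
  have sq: "b \<cdot> (x \<cdot> x) = b" if x: "x \<in> hcls t" for x
  proof (rule ccontr)
    assume n: "b \<cdot> (x \<cdot> x) \<noteq> b"
    then have "b \<cdot> x \<noteq> b" using hom[OF x x] E_D(2)[OF b] by auto
    then have "b \<cdot> (x \<cdot> x) = b \<cdot> x" using small r hcls_mult x n by blast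
    then have "(b \<cdot> x) \<cdot> (b \<cdot> x) = (b \<cdot> x) \<cdot> b"
      using hom[OF x x] hclsD(3)[OF r[OF x]] by simp
    then have "b \<cdot> x = b" using hcls_cancel[OF r[OF x] r[OF x] hcls_id[OF b]] by blast
    then show False using \<open>b \<cdot> x \<noteq> b\<close> by simp
  qed
  have bt_hcls: "b \<notin> hcls t" using E_hcls[OF t b] bt by blast
  \<comment> \<open>An involution killed by \<open>b\<close> fixes every element of the bottom
    group, and such elements are unique.\<close>
  have zero: "hcls b = {b}" if h: "h \<in> hcls t" "h \<cdot> h = t" "h \<noteq> t" "b \<cdot> h = b" for h
  proof -
    have "d = b" if d: "d \<in> hcls b" for d
    proof -
      have "d \<cdot> h = d" using hclsD(3)[OF d] h(4) hclsD(1)[OF d] hclsD(1)[OF h(1)] bX by (metis assoc)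
      then show ?thesis using below_involution[OF t h(1-3) b bt' h(4) d b bt'] by simp
    qed
    then show ?thesis using hcls_id[OF b] by blast
  qed
  have zb: "x \<cdot> b = b \<cdot> x" if "x \<in> hcls t" for x using E_central[OF b] hclsD(1)[OF that] by metis
  from hcls_cases[OF t] nt consider
    (c2) h where "C2_table (hcls t) m t h" | (c3) a a2 where "C3_table (hcls t) m t a a2"
    | (c4) a a2 a3 where "C4_table (hcls t) m t a a2 a3" | (v4) a a2 a3 where "V4_table (hcls t) m t a a2 a3"
    by blast
  then show ?thesis
  proof cases
    case c2
    then have H: "hcls t = {t, h}" "h \<noteq> t" "h \<cdot> h = t" "t \<cdot> h = h" "h \<cdot> t = h" "h \<in> hcls t"
      unfolding C2_table_def by auto
    note hX = hclsD(1)[OF H(6)]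
    \<comment> \<open>An intermediate idempotent has a trivial group, so it is fixed by
      \<open>h\<close>; then \<open>b\<close> is fixed too, and uniqueness identifies the
      two.\<close>
    have "f = b \<or> f = t" if f: "f \<in> E" for f
    proof (rule ccontr)
      assume n: "\<not> ?thesis"
      have mid: "x = f" if "x \<in> hcls f" for x
        using middle_group_trivial[OF b f t bot[OF f] _ top[OF f] _ that] n by auto
      have fh: "f \<cdot> h = f" using mid hcls_restrict[OF f t top[OF f] H(6)] by blast
      then have bh: "b \<cdot> h = b" using bot[OF f] bX E_D(1)[OF f] hX by (metis assoc)
      have "f = b" using below_involution[OF t H(6,3,2) b bt' bh hcls_id[OF f] f top[OF f] fh] .
      then show False using n by simp
    qed
    then have EE: "E = {b, t}" using b t by blast
    have X2: "X = hcls b \<union> {t, h}" using X_eq EE H(1) by auto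
    have bth: "b \<noteq> h" using bt_hcls H(6) by blast
    show ?thesis
    proof (cases "b \<cdot> h = b")
      case True
      then have "hcls b = {b}" using zero H by blast
      then have "L1C2_table X m b t h"
        unfolding L1C2_table_def using X2 H bt bth True zb[OF H(6)] E_D(2)[OF b] E_D(2)[OF t] bt' bot[OF t]
          E_central[OF b tX] by auto
      then show ?thesis by blast
    next
      case False
      define w where "w = b \<cdot> h"
      have w: "w \<in> hcls b" "w \<noteq> b" unfolding w_def using r[OF H(6)] False by auto
      then have B: "hcls b = {b, w}" using small hcls_id[OF b] by blast
      have ww: "w \<cdot> w = b" unfolding w_def using hom[OF H(6) H(6)] H bt' by simp
      have wt: "w \<cdot> t = w" "w \<cdot> h = b" unfolding w_def using bX hX tX H bt' by (simp_all add: assoc)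
      have tw: "t \<cdot> w = w" "h \<cdot> w = b"
        using E_central[OF t hclsD(1)[OF w(1)]] wt bt' zb[OF H(6)] bX hX H unfolding w_def
        by (simp, metis assoc)
      have "w \<notin> hcls t" using hcls_disjoint[OF w(1) _ b t] bt by blast
      then have "w \<noteq> t" "w \<noteq> h" using H by auto
      then have "L2C2_table X m b w t h"
        unfolding L2C2_table_def using X2 B H bt bth w ww wt tw hclsD(2,3)[OF w(1)] zb[OF H(6)]
          E_D(2)[OF b] E_D(2)[OF t] bt' E_central[OF b tX] w_def by auto
      then show ?thesis by blast
    qed
  next
    case c3
    then have a: "a \<in> hcls t" "a2 \<in> hcls t" "a \<cdot> a = a2" "a2 \<cdot> a2 = a" "hcls t = {t, a, a2}"
      unfolding C3_table_def by auto
    have ba: "b \<cdot> a = b" "b \<cdot> a2 = b" using sq[OF a(1)] sq[OF a(2)] a by auto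
    have "False"
      by (rule no_zero_C3[of b t a a2])
        (use c3 bX tX hclsD(1)[OF a(1)] hclsD(1)[OF a(2)] ba zb[OF a(1)] zb[OF a(2)] E_D(2)[OF b] bt bt'
          E_central[OF b tX] bt_hcls in \<open>auto simp: C3_table_def\<close>)
    then show ?thesis ..
  next
    case c4
    then have a: "a \<in> hcls t" "a2 \<in> hcls t" "a3 \<in> hcls t" "a \<cdot> a = a2" "a2 \<cdot> a2 = t" "a2 \<noteq> t"
      "a2 \<cdot> a = a3" "hcls t = {t, a, a2, a3}"
      unfolding C4_table_def by auto
    have "b \<cdot> a2 = b" using sq[OF a(1)] a by auto
    then have "hcls b = {b}" using zero a by blast
    then have ba: "b \<cdot> a = b" "b \<cdot> a2 = b" "b \<cdot> a3 = b" using r a by auto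
    have "False"
      by (rule no_zero_C4[of b t a a2 a3])
        (use c4 bX tX hclsD(1)[OF a(1)] hclsD(1)[OF a(2)] hclsD(1)[OF a(3)] ba zb[OF a(1)] zb[OF a(2)] zb[OF a(3)]
          E_D(2)[OF b] bt bt' E_central[OF b tX] bt_hcls in \<open>auto simp: C4_table_def\<close>)
    then show ?thesis ..
  next
    case v4
    then have a: "a \<in> hcls t" "a2 \<in> hcls t" "a3 \<in> hcls t" "a \<cdot> a = t" "a2 \<cdot> a2 = t" "a3 \<cdot> a3 = t"
      "a \<cdot> a2 = a3" "hcls t = {t, a, a2, a3}" "a \<noteq> t" "a2 \<noteq> t" "a3 \<noteq> t"
      unfolding V4_table_def by auto
    \<comment> \<open>If all three involutions had the nontrivial image, the product of two of them
      would have the trivial one.\<close>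
    have "b \<cdot> a = b \<or> b \<cdot> a2 = b \<or> b \<cdot> a3 = b"
    proof (rule ccontr)
      assume n: "\<not> ?thesis"
      then have "b \<cdot> a = b \<cdot> a2" using small r a by blast
      then have "b \<cdot> a3 = b \<cdot> (a \<cdot> a)" using hom a by metis
      then show False using sq[OF a(1)] n by simp
    qed
    then have "hcls b = {b}" using zero a by metis
    then have ba: "b \<cdot> a = b" "b \<cdot> a2 = b" "b \<cdot> a3 = b" using r a by auto
    have "False"
      by (rule no_zero_V4[of b t a a2 a3])
        (use v4 bX tX hclsD(1)[OF a(1)] hclsD(1)[OF a(2)] hclsD(1)[OF a(3)] ba zb[OF a(1)] zb[OF a(2)] zb[OF a(3)]
          E_D(2)[OF b] bt bt' E_central[OF b tX] bt_hcls in \<open>auto simp: V4_table_def\<close>)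
    then show ?thesis ..
  qed
qed

text \<open>Three situations: one idempotent, so \<open>X\<close> is a group; a nontrivial top
  group; or a trivial top group, where only the bottom group can be nontrivial and then has order
  two.\<close>

lemma shape:
  "(\<exists>a b. C2_table X m a b) \<or> (\<exists>a b c. C3_table X m a b c) \<or> (\<exists>a b c d. C4_table X m a b c d) \<or>
   (\<exists>a b c d. V4_table X m a b c d) \<or> (\<exists>a b c d. L2C2_table X m a b c d) \<or> (\<exists>a b c. L1C2_table X m a b c) \<or>
   chain_table X m \<or> (\<exists>b h L. C2_chain_table X m b h L)"
proof -
  have chainE: "e \<cdot> f = f \<cdot> e \<and> e \<cdot> f \<in> {e, f}" if "e \<in> E" "f \<in> E" for e f
    using E_chain[OF that] E_comm[OF that] by auto
  have chainK: "chain_table K m" if "K \<subseteq> E" for K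
    unfolding chain_table_def using chainE that finite_subset[OF that E_finite] by (meson subsetD)
  show ?thesis
  proof (cases "E = {}")
    case True
    then have "X = {}" using X_eq by auto
    then show ?thesis unfolding chain_table_def by simp
  next
    case False
    have "\<exists>b\<in>E. \<forall>f\<in>E. b \<cdot> f = b" "\<exists>t\<in>E. \<forall>f\<in>E. f \<cdot> t = f"
      by (rule chain_least[OF E_finite False chainE], simp_all add: assoc E_D)
        (rule chain_greatest[OF E_finite False chainE], simp_all add: assoc E_D)
    then obtain b t where b: "b \<in> E" "\<And>f. f \<in> E \<Longrightarrow> b \<cdot> f = b" and t: "t \<in> E" "\<And>f. f \<in> E \<Longrightarrow> f \<cdot> t = f"
      by blast
    show ?thesis
    proof (cases "b = t")
      case True
      have "f = b" if "f \<in> E" for f using b(2)[OF that] t(2)[OF that] E_comm[OF b(1) that] True by simp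
      then have "E = {b}" using b by blast
      then have X: "hcls b = X" using X_eq by auto
      show ?thesis
      proof (cases "X = {b}")
        case True
        then have "chain_table X m" unfolding chain_table_def using E_D(2)[OF b(1)] by simp
        then show ?thesis by blast
      next
        case False
        then show ?thesis using hcls_cases[OF b(1)] X by metis
      qed
    next
      case bt: False
      show ?thesis
      proof (cases "hcls t = {t}")
        case False
        then show ?thesis using top_group_shape[OF b(1) t(1) bt b(2) t(2)] by metis
      next
        case True
        have triv: "hcls f = {f}" if f: "f \<in> E" "f \<noteq> b" for f
        proof (cases "f = t")
          case False
          then have "x = f" if "x \<in> hcls f" for x
            using middle_group_trivial[OF b(1) f(1) t(1) b(2)[OF f(1)] _ t(2)[OF f(1)] _ that] f by auto
          then show ?thesis using hcls_id[OF f(1)] by blast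
        qed (use True in simp)
        have X: "X = hcls b \<union> (E - {b})"
        proof -
          have "X = hcls b \<union> (\<Union>f\<in>E - {b}. hcls f)" using X_eq b(1) by auto
          also have "(\<Union>f\<in>E - {b}. hcls f) = E - {b}" using triv by auto
          finally show ?thesis .
        qed
        show ?thesis
        proof (cases "hcls b = {b}")
          case True
          then have "X = E" using X b(1) by auto
          then show ?thesis using chainK by simp
        next
          case False
          then obtain h where h: "h \<in> hcls b" "h \<noteq> b" using hcls_id[OF b(1)] by blast
          have B: "hcls b = {b, h}"
            using lower_group_small[OF b(1) t(1) t(2)[OF b(1)] bt _ _ h] h hcls_id[OF b(1)] by blast
          have hh: "h \<cdot> h = b"
            using hcls_mult[OF h(1) h(1)] hcls_cancel[OF h(1) h(1) hcls_id[OF b(1)]] h hclsD(3)[OF h(1)] B by auto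
          have "h \<notin> E" using E_hcls[OF b(1) _ h(1)] h(2) by blast
          moreover have "h \<cdot> x = h \<and> x \<cdot> h = h \<and> b \<cdot> x = b \<and> x \<cdot> b = b" if x: "x \<in> E" for x
          proof -
            have bx: "b \<cdot> x = b" "x \<cdot> b = b" using b(2)[OF x] E_comm[OF b(1) x] by auto
            have "h \<cdot> x = h" "x \<cdot> h = h"
              using bx hclsD[OF h(1)] E_D(1)[OF x] E_D(1)[OF b(1)] by (metis assoc)+
            then show ?thesis using bx by simp
          qed
          ultimately have "C2_chain_table X m b h (E - {b})"
            unfolding C2_chain_table_def using X B h(2) hh hclsD(2,3)[OF h(1)] E_D(2)[OF b(1)] chainK[of "E - {b}"]
            by auto
          then show ?thesis by blast
        qed
      qed
    qed
  qed
qed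

lemma clifford: "clifford_on X m"
  unfolding clifford_on_def
proof
  fix x assume "x \<in> X"
  then obtain e where e: "e \<in> E" "x \<in> hcls e" by (rule hcls_cover)
  have "group_in X m (hcls e)"
    unfolding group_in_def
  proof (intro conjI ballI)
    show "hcls e \<subseteq> X" using hclsD(1) by blast
    show "x \<cdot> y \<in> hcls e" if "x \<in> hcls e" "y \<in> hcls e" for x y using hcls_mult that .
    have "\<exists>h\<in>hcls e. g \<cdot> h = e \<and> h \<cdot> g = e" if "g \<in> hcls e" for g
      using hcls_inverse[OF that] by metis
    then show "\<exists>e'\<in>hcls e. (\<forall>g\<in>hcls e. e' \<cdot> g = g \<and> g \<cdot> e' = g) \<and>
        (\<forall>g\<in>hcls e. \<exists>h\<in>hcls e. g \<cdot> h = e' \<and> h \<cdot> g = e')"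
      using hcls_id[OF e(1)] hclsD(2,3) by (intro bexI[of _ e]) auto
  qed
  then show "\<exists>G. group_in X m G \<and> x \<in> G" using e by blast
qed

end

section \<open>Commutative and regular superextensions\<close>

context sgrp
begin

text \<open>Infinite descent. If the least element \<open>u\<close> of \<open>M \<union> N\<close>
  is in \<open>A\<close>, it cannot belong to \<open>N\<close> and is never a witness for an element
  of \<open>N\<close>, so it can be deleted from \<open>M\<close>; dually outside \<open>A\<close>.
  The element \<open>u\<close> itself needs a witness on the other side, so the sets never become
  empty.\<close>

lemma alternating_chain:
  assumes K: "finite K" "K \<subseteq> X" "\<And>x y. x \<in> K \<Longrightarrow> y \<in> K \<Longrightarrow> x \<cdot> y = y \<cdot> x \<and> x \<cdot> y \<in> {x, y}"
    and MN: "M \<subseteq> K" "N \<subseteq> K" "M \<union> N \<noteq> {}"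
    and MA: "\<And>x. x \<in> M \<Longrightarrow> \<exists>y\<in>N. x \<cdot> y \<in> A" and NA: "\<And>y. y \<in> N \<Longrightarrow> \<exists>x\<in>M. y \<cdot> x \<notin> A"
  shows False
  using MN MA NA
proof (induction "card M + card N" arbitrary: M N rule: less_induct)
  case less
  have fin: "finite M" "finite N" using less.prems K finite_subset by blast+
  have "\<exists>u\<in>M \<union> N. \<forall>x\<in>M \<union> N. u \<cdot> x = u"
  proof (rule chain_least)
    show "finite (M \<union> N)" "M \<union> N \<noteq> {}" using fin less.prems(3) by auto
    fix x y assume xy: "x \<in> M \<union> N" "y \<in> M \<union> N"
    show "x \<cdot> y = y \<cdot> x \<and> x \<cdot> y \<in> {x, y}" using xy less.prems(1,2) K(3) by (meson Un_iff subsetD)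
    fix z assume "z \<in> M \<union> N"
    then show "x \<cdot> y \<cdot> z = x \<cdot> (y \<cdot> z)" using xy less.prems(1,2) K(2) assoc by (meson Un_iff subsetD)
  qed
  then obtain u where u: "u \<in> M \<union> N" "\<And>x. x \<in> M \<union> N \<Longrightarrow> u \<cdot> x = u" by blast
  have u': "x \<cdot> u = u" if "x \<in> M \<union> N" for x
    using u that less.prems(1,2) K(3) by (metis Un_iff subsetD)
  show False
  proof (cases "u \<in> A")
    case True
    have uN: "y \<cdot> u \<in> A" "u \<cdot> y \<in> A" if "y \<in> M \<union> N" for y using u' u(2) that True by auto
    show False
    proof (rule less.hyps[of "M - {u}" N])
      have "u \<notin> N" using less.prems(5)[of u] u(2) True by auto
      then have "u \<in> M" using u by blast
      then show "card (M - {u}) + card N < card M + card N"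
        using card_Diff1_less[OF fin(1)] by (intro add_strict_right_mono)
      show "M - {u} \<subseteq> K" "N \<subseteq> K" using less.prems by auto
      show "M - {u} \<union> N \<noteq> {}" using less.prems(4)[OF \<open>u \<in> M\<close>] by blast
      show "\<exists>y\<in>N. x \<cdot> y \<in> A" if "x \<in> M - {u}" for x using less.prems(4) that by blast
      show "\<exists>x\<in>M - {u}. y \<cdot> x \<notin> A" if y: "y \<in> N" for y
      proof -
        obtain x where "x \<in> M" "y \<cdot> x \<notin> A" using less.prems(5)[OF y] by blast
        then show ?thesis using uN[of y] y by (intro bexI[of _ x]) auto
      qed
    qed
  next
    case False
    have uM: "y \<cdot> u \<notin> A" if "y \<in> M \<union> N" for y using u' that False by auto
    show False
    proof (rule less.hyps[of M "N - {u}"])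
      have "u \<notin> M" using less.prems(4)[of u] u(2) False by auto
      then have "u \<in> N" using u by blast
      then show "card M + card (N - {u}) < card M + card N"
        using card_Diff1_less[OF fin(2)] by (intro add_strict_left_mono)
      show "M \<subseteq> K" "N - {u} \<subseteq> K" using less.prems by auto
      show "M \<union> (N - {u}) \<noteq> {}" using less.prems(5)[OF \<open>u \<in> N\<close>] by blast
      show "\<exists>x\<in>M. y \<cdot> x \<notin> A" if "y \<in> N - {u}" for y using less.prems(5) that by blast
      show "\<exists>y\<in>N - {u}. x \<cdot> y \<in> A" if x: "x \<in> M" for x
      proof -
        obtain y where "y \<in> N" "x \<cdot> y \<in> A" using less.prems(4)[OF x] by blast
        then show ?thesis using uM[of x] x by (intro bexI[of _ y]) auto
      qed
    qed
  qed
qed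

text \<open>By maximality the complement of \<open>A\<close> is in \<open>V \<star> U\<close>. The
  two sets of good left factors, \<open>M \<in> U\<close> and \<open>N \<in> V\<close>, then meet
  each other's pullbacks, which yields the alternating witnesses.\<close>

lemma um_commute_clash:
  assumes U: "U \<in> lam X" and V: "V \<in> lam X" and A: "A \<in> U \<star> V" "A \<notin> V \<star> U"
  obtains M N where "M \<subseteq> X" "N \<subseteq> X" "M \<noteq> {}" "N \<noteq> {}"
    "\<And>x. x \<in> M \<Longrightarrow> pre x A \<in> V" "\<And>y. y \<in> N \<Longrightarrow> pre y (X - A) \<in> U"
    "\<And>x. x \<in> M \<Longrightarrow> \<exists>y\<in>N. x \<cdot> y \<in> A" "\<And>y. y \<in> N \<Longrightarrow> \<exists>x\<in>M. y \<cdot> x \<notin> A"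
proof -
  note UV = um_lam[OF U V] and VU = um_lam[OF V U]
  have AX: "A \<subseteq> X" using upfamily_sub[OF lam_upfamily[OF UV] A(1)] .
  have "A \<noteq> {}" using upfamily_nonempty[OF lam_upfamily[OF UV] A(1)] .
  then have "X \<noteq> {}" using AX by blast
  then have A': "X - A \<in> V \<star> U" using lam_compl[OF _ VU AX] A(2) by blast
  define M where "M = {x \<in> X. pre x A \<in> V}"
  define N where "N = {y \<in> X. pre y (X - A) \<in> U}"
  have M: "M \<in> U" using A(1) in_um[OF U V AX] unfolding M_def by simp
  have N: "N \<in> V" using A' in_um[OF V U, of "X - A"] unfolding N_def by simp
  show ?thesis
  proof (rule that[of M N])
    show "M \<subseteq> X" "N \<subseteq> X" unfolding M_def N_def by auto
    show "M \<noteq> {}" "N \<noteq> {}" using M N U V upfamily_nonempty[OF lam_upfamily] by auto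
    show "pre x A \<in> V" if "x \<in> M" for x using that unfolding M_def by simp
    show "pre y (X - A) \<in> U" if "y \<in> N" for y using that unfolding N_def by simp
    show "\<exists>y\<in>N. x \<cdot> y \<in> A" if "x \<in> M" for x
    proof -
      have "pre x A \<in> V" using that unfolding M_def by simp
      from linked_meet[OF lam_linked[OF V] this N] show ?thesis by auto
    qed
    show "\<exists>x\<in>M. y \<cdot> x \<notin> A" if "y \<in> N" for y
    proof -
      have "pre y (X - A) \<in> U" using that unfolding N_def by simp
      from linked_meet[OF lam_linked[OF U] this M] show ?thesis by auto
    qed
  qed
qed

lemma commutative_lamI:
  assumes "\<And>U V A. U \<in> lam X \<Longrightarrow> V \<in> lam X \<Longrightarrow> A \<in> U \<star> V \<Longrightarrow> A \<in> V \<star> U"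
  shows "commutative_on (lam X) (upmult X m)"
  unfolding commutative_on_def
proof (intro ballI)
  fix U V assume "U \<in> lam X" "V \<in> lam X"
  then show "U \<star> V = V \<star> U" using assms by (intro lam_eqI') (auto simp: um_lam)
qed

text \<open>Both products test whether the set of \<open>y\<close> with
  \<open>x \<cdot> y \<in> A\<close> belongs to \<open>U\<close>.\<close>

lemma point_um_commute:
  assumes c: "commutative_on X m" and x: "x \<in> X" and U: "U \<in> lam X"
  shows "point x \<star> U = U \<star> point x"
proof -
  have "pre x A = {y \<in> X. y \<cdot> x \<in> A}" for A
    using c x unfolding commutative_on_def by (intro Collect_cong) auto
  moreover have "pre y A \<in> point x \<longleftrightarrow> y \<cdot> x \<in> A" for y A
    using x by (simp add: point_def Collect_conj_eq)
  ultimately show ?thesis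
    using x U by (intro lam_eqI') (simp_all add: um_lam in_um in_point)
qed

lemma chain_lam:
  assumes "chain_table X m"
  shows "commutative_on (lam X) (upmult X m) \<and> regular_in (lam X) (lam X) (upmult X m)"
proof
  have ch: "x \<cdot> y = y \<cdot> x \<and> x \<cdot> y \<in> {x, y}" if "x \<in> X" "y \<in> X" for x y
    using assms that unfolding chain_table_def by blast
  have fin: "finite X" using assms unfolding chain_table_def by blast
  show "commutative_on (lam X) (upmult X m)"
  proof (rule commutative_lamI, rule ccontr)
    fix U V A assume *: "U \<in> lam X" "V \<in> lam X" "A \<in> U \<star> V" "A \<notin> V \<star> U"
    show False
    proof (rule um_commute_clash[OF *], goal_cases)
      case (1 M N)
      show False
        by (rule alternating_chain[OF fin subset_refl ch 1(1,2) _ 1(7,8)]) (use 1 in auto)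
    qed
  qed
  have "U \<star> U = U" if U: "U \<in> lam X" for U
  proof (rule lam_eqI'[OF U um_lam[OF U U], symmetric])
    fix A assume A: "A \<subseteq> X" "A \<in> U"
    \<comment> \<open>Every subset of a chain is closed under multiplication, so
      \<open>A \<subseteq> pre x A\<close> for \<open>x \<in> A\<close>; all systems are
      idempotent.\<close>
    have "A \<subseteq> {x \<in> X. pre x A \<in> U}"
    proof
      fix x assume x: "x \<in> A"
      have "A \<subseteq> pre x A"
      proof
        fix y assume y: "y \<in> A"
        have xy: "x \<in> X" "y \<in> X" using x y A(1) by auto
        have "x \<cdot> y \<in> A" using ch[OF xy] x y by auto
        then show "y \<in> pre x A" using xy by simp
      qed
      then show "x \<in> {x \<in> X. pre x A \<in> U}"
        using upfamily_mono[OF lam_upfamily[OF U] A(2), of "pre x A"] x A(1) by auto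
    qed
    then show "A \<in> U \<star> U"
      using upfamily_mono[OF lam_upfamily[OF U] A(2), of "{x \<in> X. pre x A \<in> U}"] in_um[OF U U A(1)] by auto
  qed
  then show "regular_in (lam X) (lam X) (upmult X m)"
    unfolding regular_in_def by metis
qed

text \<open>The obstacle is the non-idempotent \<open>h\<close>. Its principal system is central and
  treated apart; every other system omits \<open>{h}\<close>, which is enough to confine the
  alternating choices to the chain \<open>L\<close>.\<close>

lemma C2_chain_lam:
  assumes t: "C2_chain_table X m b h L"
  shows "commutative_on (lam X) (upmult X m) \<and> regular_in (lam X) (lam X) (upmult X m)"
proof
  have X: "X = {b, h} \<union> L" and d: "b \<noteq> h" "b \<notin> L" "h \<notin> L"
    and ch: "\<And>x y. x \<in> L \<Longrightarrow> y \<in> L \<Longrightarrow> x \<cdot> y = y \<cdot> x \<and> x \<cdot> y \<in> {x, y}" and fin: "finite L"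
    and bh: "b \<cdot> b = b" "b \<cdot> h = h" "h \<cdot> b = h" "h \<cdot> h = b"
    and bL: "\<And>x. x \<in> L \<Longrightarrow> b \<cdot> x = b" "\<And>x. x \<in> L \<Longrightarrow> x \<cdot> b = b"
      "\<And>x. x \<in> L \<Longrightarrow> h \<cdot> x = h" "\<And>x. x \<in> L \<Longrightarrow> x \<cdot> h = h"
    using t unfolding C2_chain_table_def chain_table_def by auto
  have bhX: "b \<in> X" "h \<in> X" and LX: "L \<subseteq> X" using X by auto
  have cX: "commutative_on X m"
    unfolding commutative_on_def X using ch bh bL by auto
  have C: "x \<cdot> y \<in> {b, h}" "y \<cdot> x \<in> {b, h}" if "x \<in> {b, h}" "y \<in> X" for x y
    using that bh bL unfolding X by auto
  have nh: "X - {h} \<in> U" if "U \<in> lam X" "U \<noteq> point h" for U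
    using lam_pointI[OF that(1)] that lam_dichotomy[of X U "{h}"] bhX by auto
  show "commutative_on (lam X) (upmult X m)"
  proof (rule commutative_lamI, rule ccontr)
    fix U V A assume *: "U \<in> lam X" "V \<in> lam X" "A \<in> U \<star> V" "A \<notin> V \<star> U"
    have Uh: "U \<noteq> point h" and Vh: "V \<noteq> point h"
      using * point_um_commute[OF cX bhX(2)] by auto
    have Uh': "{h} \<notin> U" and Vh': "{h} \<notin> V" using lam_pointI * Uh Vh by blast+
    show False
    proof (rule um_commute_clash[OF *], goal_cases)
      case (1 M N)
      have MV: "pre x A \<noteq> {}" "pre x A \<noteq> {h}" if "x \<in> M" for x
        using 1(5)[OF that] Vh' upfamily_nonempty[OF lam_upfamily[OF *(2)]] by auto
      have NU: "pre y (X - A) \<noteq> {}" "pre y (X - A) \<noteq> {h}" if "y \<in> N" for y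
        using 1(6)[OF that] Uh' upfamily_nonempty[OF lam_upfamily[OF *(1)]] by auto
      \<comment> \<open>The hypotheses of \<open>alternating_chain\<close> after restriction to
        \<open>L\<close>: something is left, and elements of \<open>L\<close> have their witnesses
        in \<open>L\<close>.\<close>
      have "M \<inter> L \<union> N \<inter> L \<noteq> {} \<and> (\<forall>x\<in>M \<inter> L. \<forall>y\<in>N. x \<cdot> y \<in> A \<longrightarrow> y \<in> L) \<and>
        (\<forall>y\<in>N \<inter> L. \<forall>x\<in>M. y \<cdot> x \<notin> A \<longrightarrow> x \<in> L)"
      proof -
        consider (a) "b \<notin> A" "h \<notin> A" | (b) "b \<in> A" "h \<in> A" | (c) "b \<in> A" "h \<notin> A" | (d) "b \<notin> A" "h \<in> A"
          by blast
        then show ?thesis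
        proof cases
          case a
          have "x \<in> L" if "x \<in> M" for x
          proof (rule ccontr)
            assume "x \<notin> L"
            then have "x \<in> {b, h}" using that 1(1) X by auto
            then have "x \<cdot> y \<notin> A" if "y \<in> X" for y using C(1)[of x y] that a by auto
            then have "pre x A = {}" by auto
            then show False using MV[OF that] by simp
          qed
          moreover have "y \<in> L" if "x \<in> M" "y \<in> N" "x \<cdot> y \<in> A" for x y
            using C(2)[of y x] a that 1(1,2) X by blast
          ultimately show ?thesis using 1(3) by blast
        next
          case b
          have "y \<in> L" if "y \<in> N" for y
          proof (rule ccontr)
            assume "y \<notin> L"
            then have "y \<in> {b, h}" using that 1(2) X by auto
            then have "y \<cdot> x \<in> A" if "x \<in> X" for x using C(1)[of y x] that b by auto
            then have "pre y (X - A) = {}" by auto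
            then show False using NU[OF that] by simp
          qed
          moreover have "x \<in> L" if "x \<in> M" "y \<in> N" "y \<cdot> x \<notin> A" for x y
            using C(2)[of x y] b that 1(1,2) X by blast
          ultimately show ?thesis using 1(4) by blast
        next
          case c
          \<comment> \<open>When \<open>A\<close> separates \<open>b\<close> from \<open>h\<close>,
            two of the pullbacks shrink to the excluded singleton, so one group element leaves
            \<open>M\<close> and the other leaves \<open>N\<close>.\<close>
          have "pre h A = {h}" "pre b (X - A) = {h}" using c bh bL bhX unfolding X by auto
          then have MN: "h \<notin> M" "b \<notin> N" using MV NU by blast+
          have "M \<inter> L \<union> N \<inter> L \<noteq> {}"
          proof (rule ccontr)
            assume n: "\<not> ?thesis"
            obtain x y where "x \<in> M" "y \<in> N" "x \<cdot> y \<in> A" using 1(3,7) by blast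
            then have "x = b" "y = h" using n MN 1(1,2) unfolding X by blast+
            then show False using \<open>x \<cdot> y \<in> A\<close> bh c by simp
          qed
          then show ?thesis using MN c bL 1(1,2) unfolding X by auto
        next
          case d
          have "pre b A = {h}" "pre h (X - A) = {h}" using d bh bL bhX unfolding X by auto
          then have MN: "b \<notin> M" "h \<notin> N" using MV NU by blast+
          have "M \<inter> L \<union> N \<inter> L \<noteq> {}"
          proof (rule ccontr)
            assume n: "\<not> ?thesis"
            obtain x y where "x \<in> M" "y \<in> N" "y \<cdot> x \<notin> A" using 1(4,8) by blast
            then have "x = h" "y = b" using n MN 1(1,2) unfolding X by blast+
            then show False using \<open>y \<cdot> x \<notin> A\<close> bh d by simp
          qed
          then show ?thesis using MN d bL 1(1,2) unfolding X by auto
        qed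
      qed
      then show False
        using alternating_chain[OF fin LX ch, of "M \<inter> L" "N \<inter> L" A] 1(7,8) by blast
    qed
  qed
  have idem: "U \<star> U = U" if U: "U \<in> lam X" "U \<noteq> point h" for U
  proof (rule lam_eqI'[OF U(1) um_lam[OF U(1) U(1)], symmetric])
    fix A assume A: "A \<subseteq> X" "A \<in> U"
    note up = lam_upfamily[OF U(1)]
    have "A \<subseteq> {x \<in> X. pre x A \<in> U}"
    proof
      fix x assume x: "x \<in> A"
      have "pre x A \<in> U"
      \<comment> \<open>The only product of two members that can leave \<open>A\<close> is
        \<open>h \<cdot> h = b\<close>; in that case the pullback still contains
        \<open>X - {h}\<close>.\<close>
      proof (cases "x = h \<and> b \<notin> A")
        case True
        then have "X - {h} \<subseteq> pre x A" using x bh bL unfolding X by auto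
        then show ?thesis using upfamily_mono[OF up nh[OF U], of "pre x A"] by auto
      next
        case False
        have "A \<subseteq> pre x A"
        proof
          fix y assume y: "y \<in> A"
          have "x \<cdot> y \<in> A"
          proof (cases "x \<in> L \<and> y \<in> L")
            case True
            then show ?thesis using ch[of x y] x y by auto
          next
            case n: False
            have "x = b \<or> x = h \<or> x \<in> L" "y = b \<or> y = h \<or> y \<in> L" using x y A(1) X by auto
            then have "x \<cdot> y = x \<or> x \<cdot> y = y \<or> x = h \<and> x \<cdot> y = b"
              using n by (elim disjE) (simp_all add: bh bL)
            then show ?thesis using x y False by auto
          qed
          then show "y \<in> pre x A" using y A(1) by auto
        qed
        then show ?thesis using upfamily_mono[OF up A(2), of "pre x A"] by auto
      qed
      then show "x \<in> {x \<in> X. pre x A \<in> U}" using x A(1) by auto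
    qed
    then show "A \<in> U \<star> U"
      using upfamily_mono[OF up A(2), of "{x \<in> X. pre x A \<in> U}"] in_um[OF U(1) U(1) A(1)] by auto
  qed
  have "U = U \<star> U \<star> U" if "U \<in> lam X" for U
  proof (cases "U = point h")
    case True
    then show ?thesis using bhX by (simp add: point_um bh)
  next
    case False
    then show ?thesis using idem that by simp
  qed
  then show "regular_in (lam X) (lam X) (upmult X m)"
    unfolding regular_in_def by blast
qed

section \<open>Maximal linked systems on three and four points\<close>

lemma lam_two_sets:
  assumes U: "U \<in> lam X" and A: "A \<subseteq> X" "B \<subseteq> X" "A \<union> B = X" "X \<noteq> {}"
  shows "A \<in> U \<or> B \<in> U"
proof -
  have "X - A \<subseteq> B" using A by blast
  then show ?thesis
    using lam_dichotomy[OF A(4) U A(1)] upfamily_mono[OF lam_upfamily[OF U], of "X - A" B] A(2) by blast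
qed

lemma lam_majorityI:
  assumes U: "U \<in> lam X" "{p, q} \<in> U" "{p, r} \<in> U" "{q, r} \<in> U"
  shows "U = majority p q r"
proof (rule lam_eqI'[symmetric])
  show "majority p q r \<in> lam X" using U upfamily_sub[OF lam_upfamily[OF U(1)]] by auto
  fix A assume "A \<subseteq> X" "A \<in> majority p q r"
  then have "{p, q} \<subseteq> A \<or> {p, r} \<subseteq> A \<or> {q, r} \<subseteq> A" unfolding majority_def by auto
  then show "A \<in> U" using U(2-4) upfamily_mono[OF lam_upfamily[OF U(1)] _ _ \<open>A \<subseteq> X\<close>] by metis
qed (rule U)

lemma lam_starI:
  assumes U: "U \<in> lam X" "{p, q} \<in> U" "{p, r} \<in> U" "{p, s} \<in> U" "{q, r, s} \<in> U"
  shows "U = star p q r s"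
proof (rule lam_eqI'[symmetric])
  show "star p q r s \<in> lam X" using U upfamily_sub[OF lam_upfamily[OF U(1)]] by auto
  fix A assume "A \<subseteq> X" "A \<in> star p q r s"
  then have "{p, q} \<subseteq> A \<or> {p, r} \<subseteq> A \<or> {p, s} \<subseteq> A \<or> {q, r, s} \<subseteq> A" unfolding star_def by auto
  then show "A \<in> U" using U(2-5) upfamily_mono[OF lam_upfamily[OF U(1)] _ _ \<open>A \<subseteq> X\<close>] by metis
qed (rule U)

lemma lam_three:
  assumes X: "X = {p, q, r}" and U: "U \<in> lam X"
  shows "U = point p \<or> U = point q \<or> U = point r \<or> U = majority p q r"
proof -
  note two = lam_two_sets[OF U]
  have "{p} \<in> U \<or> {q, r} \<in> U" "{q} \<in> U \<or> {p, r} \<in> U" "{r} \<in> U \<or> {p, q} \<in> U"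
    by (rule two; use X in auto)+
  then show ?thesis using lam_pointI[OF U] lam_majorityI[OF U] by metis
qed

text \<open>Without singletons all triples are members, and each of the three partitions into two
  pairs selects one pair. Of the eight selections, four consist of pairs through a common point
  (stars) and four form a triangle (majorities).\<close>

lemma lam_four:
  assumes X: "X = {p, q, r, s}" and U: "U \<in> lam X"
  shows "(\<exists>x\<in>X. U = point x) \<or> U \<in> {majority p q r, majority p q s, majority p r s, majority q r s,
        star p q r s, star q p r s, star r p q s, star s p q r}"
proof -
  note two = lam_two_sets[OF U]
  have 1: "{p} \<in> U \<or> {q, r, s} \<in> U" "{q} \<in> U \<or> {p, r, s} \<in> U" "{r} \<in> U \<or> {p, q, s} \<in> U" "{s} \<in> U \<or> {p, q, r} \<in> U"
    by (rule two; use X in auto)+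
  have 2: "{p, q} \<in> U \<or> {r, s} \<in> U" "{p, r} \<in> U \<or> {q, s} \<in> U" "{p, s} \<in> U \<or> {q, r} \<in> U"
    by (rule two; use X in auto)+
  note maj = lam_majorityI[OF U] and st = lam_starI[OF U]
  show ?thesis
  proof (cases "{p} \<in> U \<or> {q} \<in> U \<or> {r} \<in> U \<or> {s} \<in> U")
    case True
    then have "U = point p \<or> U = point q \<or> U = point r \<or> U = point s"
      using lam_pointI[OF U, of p] lam_pointI[OF U, of q] lam_pointI[OF U, of r] lam_pointI[OF U, of s] by argo
    then show ?thesis using X by auto
  next
    case False
    then have 3: "{q, r, s} \<in> U" "{p, r, s} \<in> U" "{p, q, s} \<in> U" "{p, q, r} \<in> U" using 1 by auto
    have c: "{q, p} = {p, q}" "{r, p} = {p, r}" "{s, p} = {p, s}" "{r, q} = {q, r}" "{s, q} = {q, s}" "{s, r} = {r, s}"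
      by auto
    have "U = majority p q r \<or> U = majority p q s \<or> U = majority p r s \<or> U = majority q r s \<or>
      U = star p q r s \<or> U = star q p r s \<or> U = star r p q s \<or> U = star s p q r"
      using 2 3 maj[of p q r] maj[of p q s] maj[of p r s] maj[of q r s]
        st[of p q r s] st[of q p r s] st[of r p q s] st[of s p q r] unfolding c by argo
    then show ?thesis by simp
  qed
qed

text \<open>Principal systems are central, so only the eight others remain. Listing them explicitly
  lets the simplifier split the hypothesis into propositional checks.\<close>

lemma four_point_commutative:
  assumes cX: "commutative_on X m" and X: "X = {p, q, r, s}"
    and comm: "\<forall>U\<in>{majority p q r, majority p q s, majority p r s, majority q r s,
        star p q r s, star q p r s, star r p q s, star s p q r}.
      \<forall>V\<in>{majority p q r, majority p q s, majority p r s, majority q r s,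
        star p q r s, star q p r s, star r p q s, star s p q r}. U \<star> V = V \<star> U"
  shows "commutative_on (lam X) (upmult X m)"
  unfolding commutative_on_def
proof (intro ballI)
  fix U V assume UV: "U \<in> lam X" "V \<in> lam X"
  have p: "point x \<star> W = W \<star> point x" if "x \<in> X" "W \<in> lam X" for x W
    using point_um_commute[OF cX that] .
  consider x where "x \<in> X" "U = point x" | x where "x \<in> X" "V = point x" |
    "U \<in> {majority p q r, majority p q s, majority p r s, majority q r s,
        star p q r s, star q p r s, star r p q s, star s p q r}"
    "V \<in> {majority p q r, majority p q s, majority p r s, majority q r s,
        star p q r s, star q p r s, star r p q s, star s p q r}"
    using lam_four[OF X UV(1)] lam_four[OF X UV(2)] by metis
  then show "U \<star> V = V \<star> U"
  proof cases
    case 1 then show ?thesis using p UV by simp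
  next
    case 2 then show ?thesis using p UV by simp
  next
    case 3 show ?thesis by (rule comm[THEN bspec, OF 3(1), THEN bspec, OF 3(2)])
  qed
qed

lemma four_point_regular:
  assumes X: "X = {p, q, r, s}" and pt: "\<And>x. x \<in> X \<Longrightarrow> \<exists>y\<in>X. x \<cdot> y \<cdot> x = x"
    and reg: "\<forall>U\<in>{majority p q r, majority p q s, majority p r s, majority q r s,
        star p q r s, star q p r s, star r p q s, star s p q r}. \<exists>W\<in>lam X. U = U \<star> W \<star> U"
  shows "regular_in (lam X) (lam X) (upmult X m)"
  unfolding regular_in_def
proof
  fix U assume U: "U \<in> lam X"
  show "\<exists>W\<in>lam X. U = U \<star> W \<star> U"
  proof (cases "\<exists>x\<in>X. U = point x")
    case True
    then obtain x where x: "x \<in> X" "U = point x" by blast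
    then obtain y where y: "y \<in> X" "x \<cdot> y \<cdot> x = x" using pt by blast
    then have "U = U \<star> point y \<star> U" using x by (simp add: point_um)
    then show ?thesis using y by blast
  next
    case False
    then show ?thesis using lam_four[OF X U] reg by blast
  qed
qed

section \<open>Regularity and commutativity for the four-point semigroups\<close>

lemma C4_lam:
  assumes "C4_table X m e a b c"
  shows "commutative_on (lam X) (upmult X m) \<and> regular_in (lam X) (lam X) (upmult X m)"
proof
  note t = assms[unfolded C4_table_def]
  have X: "X = {e, a, b, c}" using t by simp
  have tab: "e \<cdot> e = e" "e \<cdot> a = a" "e \<cdot> b = b" "e \<cdot> c = c" "a \<cdot> e = a" "b \<cdot> e = b" "c \<cdot> e = c"
    "a \<cdot> a = b" "a \<cdot> b = c" "a \<cdot> c = e" "b \<cdot> a = c" "b \<cdot> b = e" "b \<cdot> c = a"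
    "c \<cdot> a = e" "c \<cdot> b = a" "c \<cdot> c = b" using t by auto
  have in_X: "e \<in> X" "a \<in> X" "b \<in> X" "c \<in> X" using X by auto
  have cX: "commutative_on X m" unfolding commutative_on_def X using tab by auto
  show "commutative_on (lam X) (upmult X m)"
    by (rule four_point_commutative[OF cX X]; simp only: ball_simps simp_thms; intro conjI; rule lam_eqI';
        simp add: um_lam in_um in_majority in_star tab in_X; argo)
  show "regular_in (lam X) (lam X) (upmult X m)"
  proof (rule four_point_regular[OF X])
    show "\<exists>y\<in>X. x \<cdot> y \<cdot> x = x" if "x \<in> X" for x using that unfolding X by (auto simp: tab)
    \<comment> \<open>The middle factor is the original system with every point replaced by its
      group inverse, that is, with \<open>a\<close> and \<open>c\<close> exchanged.\<close>
    have inverses: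
      "majority e a b = majority e a b \<star> majority e c b \<star> majority e a b"
      "majority e a c = majority e a c \<star> majority e c a \<star> majority e a c"
      "majority e b c = majority e b c \<star> majority e b a \<star> majority e b c"
      "majority a b c = majority a b c \<star> majority c b a \<star> majority a b c"
      "star e a b c = star e a b c \<star> star e c b a \<star> star e a b c"
      "star a e b c = star a e b c \<star> star c e b a \<star> star a e b c"
      "star b e a c = star b e a c \<star> star b e c a \<star> star b e a c"
      "star c e a b = star c e a b \<star> star a e c b \<star> star c e a b"
      by (rule lam_eqI'; simp add: um_lam in_um in_majority in_star tab in_X; argo)+
    show "\<forall>U\<in>{majority e a b, majority e a c, majority e b c, majority a b c,
        star e a b c, star a e b c, star b e a c, star c e a b}. \<exists>W\<in>lam X. U = U \<star> W \<star> U"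
      by (simp only: ball_simps simp_thms, intro conjI) (rule bexI, rule inverses, simp add: in_X)+
  qed
qed

lemma V4_lam:
  assumes "V4_table X m e a b c"
  shows "commutative_on (lam X) (upmult X m) \<and> regular_in (lam X) (lam X) (upmult X m)"
proof
  note t = assms[unfolded V4_table_def]
  have X: "X = {e, a, b, c}" using t by simp
  have tab: "e \<cdot> e = e" "e \<cdot> a = a" "e \<cdot> b = b" "e \<cdot> c = c" "a \<cdot> e = a" "b \<cdot> e = b" "c \<cdot> e = c"
    "a \<cdot> a = e" "a \<cdot> b = c" "a \<cdot> c = b" "b \<cdot> a = c" "b \<cdot> b = e" "b \<cdot> c = a"
    "c \<cdot> a = b" "c \<cdot> b = a" "c \<cdot> c = e" using t by auto
  have in_X: "e \<in> X" "a \<in> X" "b \<in> X" "c \<in> X" using X by auto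
  have cX: "commutative_on X m" unfolding commutative_on_def X using tab by auto
  show "commutative_on (lam X) (upmult X m)"
    by (rule four_point_commutative[OF cX X]; simp only: ball_simps simp_thms; intro conjI; rule lam_eqI';
        simp add: um_lam in_um in_majority in_star tab in_X; argo)
  show "regular_in (lam X) (lam X) (upmult X m)"
  proof (rule four_point_regular[OF X])
    show "\<exists>y\<in>X. x \<cdot> y \<cdot> x = x" if "x \<in> X" for x using that unfolding X by (auto simp: tab)
    \<comment> \<open>Every point is its own inverse, so the system itself is the middle
      factor.\<close>
    have cubes:
      "majority e a b = majority e a b \<star> majority e a b \<star> majority e a b"
      "majority e a c = majority e a c \<star> majority e a c \<star> majority e a c"
      "majority e b c = majority e b c \<star> majority e b c \<star> majority e b c"
      "majority a b c = majority a b c \<star> majority a b c \<star> majority a b c"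
      "star e a b c = star e a b c \<star> star e a b c \<star> star e a b c"
      "star a e b c = star a e b c \<star> star a e b c \<star> star a e b c"
      "star b e a c = star b e a c \<star> star b e a c \<star> star b e a c"
      "star c e a b = star c e a b \<star> star c e a b \<star> star c e a b"
      by (rule lam_eqI'; simp add: um_lam in_um in_majority in_star tab in_X; argo)+
    show "\<forall>U\<in>{majority e a b, majority e a c, majority e b c, majority a b c,
          star e a b c, star a e b c, star b e a c, star c e a b}. \<exists>W\<in>lam X. U = U \<star> W \<star> U"
      by (simp only: ball_simps simp_thms, intro conjI) (rule bexI, rule cubes, simp add: in_X)+
  qed
qed

lemma L2C2_lam:
  assumes "L2C2_table X m z w e h"
  shows "commutative_on (lam X) (upmult X m) \<and> regular_in (lam X) (lam X) (upmult X m)"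
proof
  note t = assms[unfolded L2C2_table_def]
  have X: "X = {z, w, e, h}" using t by simp
  have tab: "z \<cdot> z = z" "z \<cdot> w = w" "w \<cdot> z = w" "w \<cdot> w = z" "z \<cdot> e = z" "e \<cdot> z = z" "z \<cdot> h = w" "h \<cdot> z = w"
    "w \<cdot> e = w" "e \<cdot> w = w" "w \<cdot> h = z" "h \<cdot> w = z" "e \<cdot> e = e" "e \<cdot> h = h" "h \<cdot> e = h" "h \<cdot> h = e"
    using t by auto
  have in_X: "z \<in> X" "w \<in> X" "e \<in> X" "h \<in> X" using X by auto
  have cX: "commutative_on X m" unfolding commutative_on_def X using tab by auto
  show "commutative_on (lam X) (upmult X m)"
    by (rule four_point_commutative[OF cX X]; simp only: ball_simps simp_thms; intro conjI; rule lam_eqI';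
        simp add: um_lam in_um in_majority in_star tab in_X; argo)
  show "regular_in (lam X) (lam X) (upmult X m)"
  proof (rule four_point_regular[OF X])
    show "\<exists>y\<in>X. x \<cdot> y \<cdot> x = x" if "x \<in> X" for x using that unfolding X by (auto simp: tab)
    \<comment> \<open>Each point lies in a group of order two, so the system again serves as its own
      middle factor.\<close>
    have cubes:
      "majority z w e = majority z w e \<star> majority z w e \<star> majority z w e"
      "majority z w h = majority z w h \<star> majority z w h \<star> majority z w h"
      "majority z e h = majority z e h \<star> majority z e h \<star> majority z e h"
      "majority w e h = majority w e h \<star> majority w e h \<star> majority w e h"
      "star z w e h = star z w e h \<star> star z w e h \<star> star z w e h"
      "star w z e h = star w z e h \<star> star w z e h \<star> star w z e h"
      "star e z w h = star e z w h \<star> star e z w h \<star> star e z w h"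
      "star h z w e = star h z w e \<star> star h z w e \<star> star h z w e"
      by (rule lam_eqI'; simp add: um_lam in_um in_majority in_star tab in_X; argo)+
    show "\<forall>U\<in>{majority z w e, majority z w h, majority z e h, majority w e h,
          star z w e h, star w z e h, star e z w h, star h z w e}. \<exists>W\<in>lam X. U = U \<star> W \<star> U"
      by (simp only: ball_simps simp_thms, intro conjI) (rule bexI, rule cubes, simp add: in_X)+
  qed
qed

section \<open>The semigroups with at most three points\<close>

lemma three_point_lam:
  assumes cX: "commutative_on X m" and X: "X = {p, q, r}" and pt: "\<And>x. x \<in> X \<Longrightarrow> \<exists>y\<in>X. x \<cdot> y \<cdot> x = x"
    and idem: "majority p q r \<star> majority p q r = majority p q r"
  shows "commutative_on (lam X) (upmult X m) \<and> regular_in (lam X) (lam X) (upmult X m)"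
proof
  have cases: "(\<exists>x\<in>X. U = point x) \<or> U = majority p q r" if "U \<in> lam X" for U
    using lam_three[OF X that] X by auto
  show "commutative_on (lam X) (upmult X m)"
    unfolding commutative_on_def using cases point_um_commute[OF cX] by metis
  show "regular_in (lam X) (lam X) (upmult X m)"
    unfolding regular_in_def
  proof
    fix U assume U: "U \<in> lam X"
    from cases[OF U] show "\<exists>W\<in>lam X. U = U \<star> W \<star> U"
    proof
      assume "\<exists>x\<in>X. U = point x"
      then obtain x where x: "x \<in> X" "U = point x" by blast
      then obtain y where y: "y \<in> X" "x \<cdot> y \<cdot> x = x" using pt by blast
      then have "U = U \<star> point y \<star> U" using x by (simp add: point_um)
      then show ?thesis using y by blast
    next
      assume "U = majority p q r"
      then show ?thesis using U idem by (intro bexI[of _ U]) simp_all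
    qed
  qed
qed

lemma C3_lam:
  assumes "C3_table X m e a b"
  shows "commutative_on (lam X) (upmult X m) \<and> regular_in (lam X) (lam X) (upmult X m)"
proof -
  note t = assms[unfolded C3_table_def]
  have X: "X = {e, a, b}" using t by simp
  have tab: "e \<cdot> e = e" "e \<cdot> a = a" "e \<cdot> b = b" "a \<cdot> e = a" "b \<cdot> e = b"
    "a \<cdot> a = b" "a \<cdot> b = e" "b \<cdot> a = e" "b \<cdot> b = a" using t by auto
  have in_X: "e \<in> X" "a \<in> X" "b \<in> X" using X by auto
  show ?thesis
  proof (rule three_point_lam[OF _ X])
    show "commutative_on X m" unfolding commutative_on_def X using tab by auto
    show "\<exists>y\<in>X. x \<cdot> y \<cdot> x = x" if "x \<in> X" for x using that unfolding X by (auto simp: tab)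
    show "majority e a b \<star> majority e a b = majority e a b"
      by (rule lam_eqI'; simp add: um_lam in_um in_majority tab in_X; argo)
  qed
qed

lemma L1C2_lam:
  assumes "L1C2_table X m z e h"
  shows "commutative_on (lam X) (upmult X m) \<and> regular_in (lam X) (lam X) (upmult X m)"
proof -
  note t = assms[unfolded L1C2_table_def]
  have X: "X = {z, e, h}" using t by simp
  have tab: "z \<cdot> z = z" "z \<cdot> e = z" "z \<cdot> h = z" "e \<cdot> z = z" "h \<cdot> z = z"
    "e \<cdot> e = e" "e \<cdot> h = h" "h \<cdot> e = h" "h \<cdot> h = e" using t by auto
  have in_X: "z \<in> X" "e \<in> X" "h \<in> X" using X by auto
  show ?thesis
  proof (rule three_point_lam[OF _ X])
    show "commutative_on X m" unfolding commutative_on_def X using tab by auto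
    show "\<exists>y\<in>X. x \<cdot> y \<cdot> x = x" if "x \<in> X" for x using that unfolding X by (auto simp: tab)
    show "majority z e h \<star> majority z e h = majority z e h"
      by (rule lam_eqI'; simp add: um_lam in_um in_majority tab in_X; argo)
  qed
qed

lemma C2_lam:
  assumes "C2_table X m e a"
  shows "commutative_on (lam X) (upmult X m) \<and> regular_in (lam X) (lam X) (upmult X m)"
proof (rule C2_chain_lam)
  show "C2_chain_table X m e a {}"
    using assms unfolding C2_table_def C2_chain_table_def chain_table_def by auto
qed

end

section \<open>The model semigroups\<close>

lemma Cyc_2: "Cyc 2 = {1, -1}"
  unfolding Cyc_def using power2_eq_1_iff by auto

lemma Cyc_4: "Cyc 4 = {1, \<i>, -1, -\<i>}"
proof -
  have "z = 1 \<or> z = -1 \<or> z = \<i> \<or> z = -\<i>" if "z ^ 4 = 1" for z :: complex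
  proof -
    have "(z\<^sup>2)\<^sup>2 = 1" using that by simp
    then have "z\<^sup>2 = 1 \<or> z\<^sup>2 = -1" by (simp only: power2_eq_1_iff)
    then have "z\<^sup>2 = 1\<^sup>2 \<or> z\<^sup>2 = \<i>\<^sup>2" by simp
    then show ?thesis unfolding power2_eq_iff by auto
  qed
  then show ?thesis unfolding Cyc_def by (auto simp: power4_eq_xxxx)
qed

text \<open>Only the algebraic relations of a primitive root are exported, so no trigonometric value
  enters the isomorphism proof.\<close>

lemma Cyc_3:
  obtains w where "Cyc 3 = {1, w, w * w}" "w * w * w = 1" "w \<noteq> 1" "w * w \<noteq> 1" "w * w \<noteq> w"
proof -
  define f where "f k = cis (2 * pi * real k / real 3)" for k :: nat
  have bij: "bij_betw f {..<3} (Cyc 3)"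
    unfolding Cyc_def f_def by (rule bij_betw_roots_unity) simp
  define w where "w = f 1"
  have f: "f 0 = 1" "f 2 = w * w"
    unfolding w_def f_def by (simp_all add: cis_mult)
  have i: "{..<3} = {0, 1, 2::nat}" by auto
  have "Cyc 3 = {1, w, w * w}"
    using bij_betw_imp_surj_on[OF bij] unfolding i by (simp add: f w_def)
  moreover have "w * w * w = 1"
  proof -
    have "w \<in> Cyc 3" using calculation by simp
    then show ?thesis unfolding Cyc_def by (simp add: power3_eq_cube)
  qed
  moreover have "inj_on f {0, 1, 2}" using bij i unfolding bij_betw_def by simp
  then have "w \<noteq> 1" "w * w \<noteq> 1" "w * w \<noteq> w"
    using f w_def by (auto simp: inj_on_def)
  ultimately show ?thesis by (rule that)
qed

text \<open>Mapping the model back into \<open>S\<close> lets a table be read off at named elements.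
  Closure of \<open>T\<close> under \<open>n\<close> is obtained along the way instead of being
  checked for each model.\<close>

lemma sg_iso_inverse:
  assumes s: "semigroup_on S m" and iso: "sg_iso S m T n"
  obtains g where "bij_betw g T S" "\<And>x y. x \<in> T \<Longrightarrow> y \<in> T \<Longrightarrow> n x y \<in> T \<and> m (g x) (g y) = g (n x y)"
proof -
  obtain h where h: "bij_betw h S T" "\<forall>x\<in>S. \<forall>y\<in>S. h (m x y) = n (h x) (h y)"
    using iso unfolding sg_iso_def by blast
  define g where "g = inv_into S h"
  have g: "g x \<in> S" "h (g x) = x" if "x \<in> T" for x
    using h(1) that unfolding g_def by (auto simp: bij_betw_def inv_into_into f_inv_into_f)
  have gh: "g (h x) = x" if "x \<in> S" for x
    using h(1) that unfolding g_def by (simp add: bij_betw_inv_into_left)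
  show ?thesis
  proof (rule that)
    show "bij_betw g T S" unfolding g_def by (rule bij_betw_inv_into[OF h(1)])
    fix x y assume xy: "x \<in> T" "y \<in> T"
    have mS: "m (g x) (g y) \<in> S" using s g(1) xy unfolding semigroup_on_def by blast
    have "h (m (g x) (g y)) = n x y" using h(2) g xy by auto
    moreover have "h (m (g x) (g y)) \<in> T" using h(1) mS bij_betw_apply by metis
    ultimately show "n x y \<in> T \<and> m (g x) (g y) = g (n x y)" using gh[OF mS] by metis
  qed
qed

text \<open>Induction removes the greatest element, so the ranks of the others do not shift.\<close>

lemma chain_rank:
  assumes "chain_table L m" "\<And>x y z. x \<in> L \<Longrightarrow> y \<in> L \<Longrightarrow> z \<in> L \<Longrightarrow> m (m x y) z = m x (m y z)"
  shows "\<exists>h. bij_betw h L (Lmin (card L)) \<and> (\<forall>x\<in>L. \<forall>y\<in>L. h (m x y) = min (h x) (h y))"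
  using assms
proof (induction "card L" arbitrary: L)
  case 0
  then show ?case unfolding chain_table_def Lmin_def by (auto simp: bij_betw_def)
next
  case (Suc k)
  have ch: "m x y = m y x \<and> m x y \<in> {x, y}" if "x \<in> L" "y \<in> L" for x y
    using Suc.prems(1) that unfolding chain_table_def by blast
  have L: "finite L" "L \<noteq> {}" using Suc.hyps(2) Suc.prems(1) unfolding chain_table_def by auto
  obtain t where t: "t \<in> L" "\<And>x. x \<in> L \<Longrightarrow> m x t = x"
    using chain_greatest[OF L ch Suc.prems(2)] by blast
  define K where "K = L - {t}"
  have K: "card K = k" "chain_table K m" "L = insert t K" "t \<notin> K"
    using Suc.hyps(2) Suc.prems(1) t(1) unfolding K_def chain_table_def by auto
  have "\<exists>h. bij_betw h K (Lmin (card K)) \<and> (\<forall>x\<in>K. \<forall>y\<in>K. h (m x y) = min (h x) (h y))"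
  proof (rule Suc.hyps(1)[OF _ K(2)])
    show "k = card K" using K(1) by simp
    show "m (m x y) z = m x (m y z)" if "x \<in> K" "y \<in> K" "z \<in> K" for x y z
      by (rule Suc.prems(2)) (use that K(3) in auto)
  qed
  then obtain h where h: "bij_betw h K (Lmin k)" "\<And>x y. x \<in> K \<Longrightarrow> y \<in> K \<Longrightarrow> h (m x y) = min (h x) (h y)"
    using K(1) by blast
  \<comment> \<open>Ranks start at zero, so the greatest of \<open>Suc k\<close> elements gets rank
    \<open>k\<close>.\<close>
  define h' where "h' = h(t := k)"
  have hk: "h x < k" if "x \<in> K" for x using h(1) that unfolding bij_betw_def Lmin_def by auto
  have h'K: "h' x = h x" if "x \<in> K" for x using that K(4) unfolding h'_def by auto
  have "bij_betw h' K (Lmin k)" using h(1) h'K by (simp cong: bij_betw_cong)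
  then have "bij_betw h' (K \<union> {t}) (Lmin k \<union> {h' t})"
    by (intro notIn_Un_bij_betw) (auto simp: K(4) h'_def Lmin_def)
  moreover have "Lmin k \<union> {h' t} = Lmin (card L)"
    unfolding h'_def Lmin_def using Suc.hyps(2) by auto
  ultimately have "bij_betw h' L (Lmin (card L))" using K(3) by simp
  moreover have "h' (m x y) = min (h' x) (h' y)" if xy: "x \<in> L" "y \<in> L" for x y
  proof -
    have ht: "h' t = k" unfolding h'_def by simp
    consider "x = t" "y = t" | "x = t" "y \<in> K" | "x \<in> K" "y = t" | "x \<in> K" "y \<in> K" using xy K(3) by blast
    then show ?thesis
    proof cases
      case 1 then show ?thesis using t by simp
    next
      case 2 then show ?thesis using t(2)[of y] ch[of t y] t(1) K(3) hk[of y] h'K[of y] ht by simp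
    next
      case 3 then show ?thesis using t(2)[of x] K(3) hk[of x] h'K[of x] ht by simp
    next
      case 4
      moreover have "m x y \<in> K" using 4 ch[of x y] K(3) by auto
      ultimately show ?thesis using h(2) h'K by simp
    qed
  qed
  ultimately show ?case by blast
qed

lemma chain_iso:
  assumes s: "semigroup_on X m"
  shows "chain_table X m \<longleftrightarrow> (\<exists>n. sg_iso X m (Lmin n) min)"
proof
  assume "chain_table X m"
  then show "\<exists>n. sg_iso X m (Lmin n) min"
    using chain_rank[of X m] s unfolding sg_iso_def semigroup_on_def by blast
next
  assume "\<exists>n. sg_iso X m (Lmin n) min"
  then obtain n h where h: "bij_betw h X (Lmin n)" "\<forall>x\<in>X. \<forall>y\<in>X. h (m x y) = min (h x) (h y)"
    unfolding sg_iso_def by blast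
  have inj: "x = y" if "x \<in> X" "y \<in> X" "h x = h y" for x y
    using h(1) that unfolding bij_betw_def inj_on_def by blast
  have "finite X" using bij_betw_finite[OF h(1)] unfolding Lmin_def by simp
  moreover have "m x y = m y x \<and> m x y \<in> {x, y}" if xy: "x \<in> X" "y \<in> X" for x y
  proof -
    have mX: "m x y \<in> X" "m y x \<in> X" using s xy unfolding semigroup_on_def by auto
    have "h (m x y) = h (m y x)" using h(2) xy by (simp add: min.commute)
    moreover have "h (m x y) = h x \<or> h (m x y) = h y" using h(2) xy by (simp add: min_def)
    ultimately show ?thesis using inj mX xy by blast
  qed
  ultimately show "chain_table X m" unfolding chain_table_def by blast
qed

lemma C2_chain_iso:
  assumes s: "semigroup_on X m"
  shows "(\<exists>b h L. C2_chain_table X m b h L) \<longleftrightarrow>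
    (\<exists>n. sg_iso X m (ord_union (Cyc 2) (Lmin n)) (ord_union_op (*) min))"
proof
  assume "\<exists>b h L. C2_chain_table X m b h L"
  then obtain b h L where t: "C2_chain_table X m b h L" by blast
  note t' = t[unfolded C2_chain_table_def]
  have X: "X = {b, h} \<union> L" and d: "b \<noteq> h" "b \<notin> L" "h \<notin> L" and ch: "chain_table L m" using t' by auto
  have "m (m x y) z = m x (m y z)" if "x \<in> L" "y \<in> L" "z \<in> L" for x y z
    using s that unfolding semigroup_on_def X by blast
  then obtain r where r: "bij_betw r L (Lmin (card L))" "\<forall>x\<in>L. \<forall>y\<in>L. r (m x y) = min (r x) (r y)"
    using chain_rank[OF ch] by blast
  define f :: "'a \<Rightarrow> complex + nat" where
    "f x = (if x = b then Inl 1 else if x = h then Inl (-1) else Inr (r x))" for x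
  have f: "f b = Inl 1" "f h = Inl (-1)" "\<And>x. x \<in> L \<Longrightarrow> f x = Inr (r x)" using d unfolding f_def by auto
  have mL: "m x y \<in> L" if "x \<in> L" "y \<in> L" for x y
    using ch that unfolding chain_table_def by fastforce
  have "bij_betw f X (ord_union (Cyc 2) (Lmin (card L)))"
    unfolding bij_betw_def
  proof
    show "inj_on f X"
      using r(1) f unfolding X bij_betw_def inj_on_def by auto
    have "f ` X = {Inl 1, Inl (-1)} \<union> f ` L" unfolding X using f by auto
    also have "f ` L = Inr ` r ` L" using f(3) by force
    also have "r ` L = Lmin (card L)" using r(1) unfolding bij_betw_def by simp
    finally show "f ` X = ord_union (Cyc 2) (Lmin (card L))" unfolding ord_union_def Cyc_2 by auto
  qed
  moreover have "f (m x y) = ord_union_op (*) min (f x) (f y)" if xy: "x \<in> X" "y \<in> X" for x y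
  proof -
    consider "x \<in> {b, h}" "y \<in> {b, h}" | "x \<in> {b, h}" "y \<in> L" | "x \<in> L" "y \<in> {b, h}" | "x \<in> L" "y \<in> L"
      using xy unfolding X by blast
    then show ?thesis
    proof cases
      case 4 then show ?thesis using f(3) mL r(2) by simp
    qed (use t' f in auto)
  qed
  ultimately show "\<exists>n. sg_iso X m (ord_union (Cyc 2) (Lmin n)) (ord_union_op (*) min)"
    unfolding sg_iso_def by blast
next
  assume "\<exists>n. sg_iso X m (ord_union (Cyc 2) (Lmin n)) (ord_union_op (*) min)"
  then obtain n where "sg_iso X m (ord_union (Cyc 2) (Lmin n)) (ord_union_op (*) min)" by blast
  then obtain g where g: "bij_betw g (ord_union (Cyc 2) (Lmin n)) X"
    and hom: "\<And>x y. x \<in> ord_union (Cyc 2) (Lmin n) \<Longrightarrow> y \<in> ord_union (Cyc 2) (Lmin n) \<Longrightarrow>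
      m (g x) (g y) = g (ord_union_op (*) min x y)"
    using sg_iso_inverse[OF s] by metis
  let ?T = "ord_union (Cyc 2) (Lmin n)"
  have T: "Inl 1 \<in> ?T" "Inl (-1) \<in> ?T" "\<And>k. k \<in> Lmin n \<Longrightarrow> Inr k \<in> ?T"
    "?T = {Inl 1, Inl (-1)} \<union> Inr ` Lmin n"
    unfolding ord_union_def Cyc_2 by auto
  have inj: "g x = g y \<longleftrightarrow> x = y" if "x \<in> ?T" "y \<in> ?T" for x y
    using g that unfolding bij_betw_def inj_on_def by blast
  have "C2_chain_table X m (g (Inl 1)) (g (Inl (-1))) (g ` Inr ` Lmin n)"
    unfolding C2_chain_table_def chain_table_def
  proof (intro conjI)
    show "X = {g (Inl 1), g (Inl (-1))} \<union> g ` Inr ` Lmin n"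
      using g T(4) unfolding bij_betw_def by auto
    show "\<forall>x\<in>g ` Inr ` Lmin n. \<forall>y\<in>g ` Inr ` Lmin n. m x y = m y x \<and> m x y \<in> {x, y}"
      using hom T(3) by (auto simp: min_def)
  qed (use hom T inj in \<open>auto simp: Lmin_def\<close>)
  then show "\<exists>b h L. C2_chain_table X m b h L" by blast
qed

lemma C2_iso:
  assumes s: "semigroup_on X m"
  shows "(\<exists>e a. C2_table X m e a) \<longleftrightarrow> sg_iso X m (Cyc 2) (*)"
proof
  assume "\<exists>e a. C2_table X m e a"
  then obtain e a where t: "C2_table X m e a" by blast
  show "sg_iso X m (Cyc 2) (*)"
    unfolding sg_iso_def Cyc_2
    by (rule exI[of _ "\<lambda>x. if x = e then 1 else -1"])
      (use t in \<open>auto simp: C2_table_def bij_betw_def\<close>)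
next
  assume "sg_iso X m (Cyc 2) (*)"
  then obtain g where g: "bij_betw g (Cyc 2) X"
    and hom: "\<And>x y. x \<in> Cyc 2 \<Longrightarrow> y \<in> Cyc 2 \<Longrightarrow> m (g x) (g y) = g (x * y)"
    using sg_iso_inverse[OF s] by metis
  have "C2_table X m (g 1) (g (-1))"
    using g hom unfolding C2_table_def Cyc_2 bij_betw_def by auto
  then show "\<exists>e a. C2_table X m e a" by blast
qed

lemma C3_iso:
  assumes s: "semigroup_on X m"
  shows "(\<exists>e a b. C3_table X m e a b) \<longleftrightarrow> sg_iso X m (Cyc 3) (*)"
proof -
  obtain w where w: "Cyc 3 = {1, w, w * w}" "w * w * w = 1" "w \<noteq> 1" "w * w \<noteq> 1" "w * w \<noteq> w"
    by (rule Cyc_3)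
  have w': "w * (w * w) = 1" "w * w * (w * w) = w" using w(2) by (simp_all flip: mult.assoc)
  show ?thesis
  proof
    assume "\<exists>e a b. C3_table X m e a b"
    then obtain e a b where t: "C3_table X m e a b" by blast
    show "sg_iso X m (Cyc 3) (*)"
      unfolding sg_iso_def w(1)
      by (rule exI[of _ "\<lambda>x. if x = e then 1 else if x = a then w else w * w"])
        (use t w w' in \<open>auto simp: C3_table_def bij_betw_def\<close>)
  next
    assume "sg_iso X m (Cyc 3) (*)"
    then obtain g where g: "bij_betw g (Cyc 3) X"
      and hom: "\<And>x y. x \<in> Cyc 3 \<Longrightarrow> y \<in> Cyc 3 \<Longrightarrow> m (g x) (g y) = g (x * y)"
      using sg_iso_inverse[OF s] by metis
    have "C3_table X m (g 1) (g w) (g (w * w))"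
      using g hom w unfolding C3_table_def bij_betw_def by (auto simp: w')
    then show "\<exists>e a b. C3_table X m e a b" by blast
  qed
qed

lemma C4_iso:
  assumes s: "semigroup_on X m"
  shows "(\<exists>e a b c. C4_table X m e a b c) \<longleftrightarrow> sg_iso X m (Cyc 4) (*)"
proof
  have i: "\<i> \<noteq> 1" "\<i> \<noteq> -1" "-\<i> \<noteq> 1" "-\<i> \<noteq> -1" "\<i> \<noteq> -\<i>" "1 \<noteq> -\<i>"
    by (auto simp: complex_eq_iff)
  {
    assume "\<exists>e a b c. C4_table X m e a b c"
    then obtain e a b c where t: "C4_table X m e a b c" by blast
    show "sg_iso X m (Cyc 4) (*)"
      unfolding sg_iso_def Cyc_4
      by (rule exI[of _ "\<lambda>x. if x = e then 1 else if x = a then \<i> else if x = b then -1 else -\<i>"])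
        (use t i in \<open>auto simp: C4_table_def bij_betw_def\<close>)
  next
    assume "sg_iso X m (Cyc 4) (*)"
    then obtain g where g: "bij_betw g (Cyc 4) X"
      and hom: "\<And>x y. x \<in> Cyc 4 \<Longrightarrow> y \<in> Cyc 4 \<Longrightarrow> m (g x) (g y) = g (x * y)"
      using sg_iso_inverse[OF s] by metis
    have "C4_table X m (g 1) (g \<i>) (g (-1)) (g (-\<i>))"
      using g hom i unfolding C4_table_def Cyc_4 bij_betw_def by auto
    then show "\<exists>e a b c. C4_table X m e a b c" by blast
  }
qed

lemma V4_iso:
  assumes s: "semigroup_on X m"
  shows "(\<exists>e a b c. V4_table X m e a b c) \<longleftrightarrow> sg_iso X m (Cyc 2 \<times> Cyc 2) (prod_op (*) (*))"
proof
  assume "\<exists>e a b c. V4_table X m e a b c"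
  then obtain e a b c where t: "V4_table X m e a b c" by blast
  show "sg_iso X m (Cyc 2 \<times> Cyc 2) (prod_op (*) (*))"
    unfolding sg_iso_def Cyc_2
    by (rule exI[of _ "\<lambda>x. if x = e then (1, 1) else if x = a then (1, -1) else if x = b then (-1, 1) else (-1, -1)"])
      (use t in \<open>auto simp: V4_table_def bij_betw_def prod_op_def\<close>)
next
  assume "sg_iso X m (Cyc 2 \<times> Cyc 2) (prod_op (*) (*))"
  then obtain g where g: "bij_betw g (Cyc 2 \<times> Cyc 2) X"
    and hom: "\<And>x y. x \<in> Cyc 2 \<times> Cyc 2 \<Longrightarrow> y \<in> Cyc 2 \<times> Cyc 2 \<Longrightarrow> m (g x) (g y) = g (prod_op (*) (*) x y)"
    using sg_iso_inverse[OF s] by metis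
  have "V4_table X m (g (1, 1)) (g (1, -1)) (g (-1, 1)) (g (-1, -1))"
    using g hom unfolding V4_table_def Cyc_2 bij_betw_def by (auto simp: prod_op_def)
  then show "\<exists>e a b c. V4_table X m e a b c" by blast
qed

lemma Lmin_small: "Lmin 1 = {0}" "Lmin 2 = {0, 1}"
  unfolding Lmin_def by auto

lemma L2C2_iso:
  assumes s: "semigroup_on X m"
  shows "(\<exists>z w e h. L2C2_table X m z w e h) \<longleftrightarrow> sg_iso X m (Lmin 2 \<times> Cyc 2) (prod_op min (*))"
proof
  assume "\<exists>z w e h. L2C2_table X m z w e h"
  then obtain z w e h where t: "L2C2_table X m z w e h" by blast
  show "sg_iso X m (Lmin 2 \<times> Cyc 2) (prod_op min (*))"
    unfolding sg_iso_def Cyc_2 Lmin_small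
    by (rule exI[of _ "\<lambda>x. if x = z then (0, 1) else if x = w then (0, -1) else if x = e then (1, 1) else (1, -1)"])
      (use t in \<open>auto simp: L2C2_table_def bij_betw_def prod_op_def\<close>)
next
  assume "sg_iso X m (Lmin 2 \<times> Cyc 2) (prod_op min (*))"
  then obtain g where g: "bij_betw g (Lmin 2 \<times> Cyc 2) X"
    and hom: "\<And>x y. x \<in> Lmin 2 \<times> Cyc 2 \<Longrightarrow> y \<in> Lmin 2 \<times> Cyc 2 \<Longrightarrow> m (g x) (g y) = g (prod_op min (*) x y)"
    using sg_iso_inverse[OF s] by metis
  have "L2C2_table X m (g (0, 1)) (g (0, -1)) (g (1, 1)) (g (1, -1))"
    using g hom unfolding L2C2_table_def Cyc_2 Lmin_small bij_betw_def by (auto simp: prod_op_def)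
  then show "\<exists>z w e h. L2C2_table X m z w e h" by blast
qed

lemma L1C2_iso:
  assumes s: "semigroup_on X m"
  shows "(\<exists>z e h. L1C2_table X m z e h) \<longleftrightarrow> sg_iso X m (ord_union (Lmin 1) (Cyc 2)) (ord_union_op min (*))"
proof
  assume "\<exists>z e h. L1C2_table X m z e h"
  then obtain z e h where t: "L1C2_table X m z e h" by blast
  show "sg_iso X m (ord_union (Lmin 1) (Cyc 2)) (ord_union_op min (*))"
    unfolding sg_iso_def Cyc_2 Lmin_small ord_union_def
    by (rule exI[of _ "\<lambda>x. if x = z then Inl 0 else if x = e then Inr 1 else Inr (-1)"])
      (use t in \<open>auto simp: L1C2_table_def bij_betw_def\<close>)
next
  assume "sg_iso X m (ord_union (Lmin 1) (Cyc 2)) (ord_union_op min (*))"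
  then obtain g where g: "bij_betw g (ord_union (Lmin 1) (Cyc 2)) X"
    and hom: "\<And>x y. x \<in> ord_union (Lmin 1) (Cyc 2) \<Longrightarrow> y \<in> ord_union (Lmin 1) (Cyc 2) \<Longrightarrow>
      m (g x) (g y) = g (ord_union_op min (*) x y)"
    using sg_iso_inverse[OF s] by metis
  have "L1C2_table X m (g (Inl 0)) (g (Inr 1)) (g (Inr (-1)))"
    using g hom unfolding L1C2_table_def Cyc_2 Lmin_small ord_union_def bij_betw_def by auto
  then show "\<exists>z e h. L1C2_table X m z e h" by blast
qed

theorem theorem1p1:
  fixes X :: "'a set" and m :: "'a \<Rightarrow> 'a \<Rightarrow> 'a"
  assumes "semigroup_on X m"
  shows
   "((commutative_on (lam X) (upmult X m) \<and> clifford_on (lam X) (upmult X m))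
       \<longleftrightarrow> inverse_on (lam X) (upmult X m))
  \<and> (inverse_on (lam X) (upmult X m)
       \<longleftrightarrow> (idempotents_commute (lam X) (upmult X m) \<and>
            (sub_clifford_on (lam X) (upmult X m) \<or> regular_in (lam X) (N2 X) (upmult X m))))
  \<and> ((idempotents_commute (lam X) (upmult X m) \<and>
            (sub_clifford_on (lam X) (upmult X m) \<or> regular_in (lam X) (N2 X) (upmult X m)))
       \<longleftrightarrow> (finite X \<and> commutative_on X m \<and> clifford_on X m \<and>
            (sg_iso X m (Cyc 2) (*) \<or> sg_iso X m (Cyc 3) (*) \<or> sg_iso X m (Cyc 4) (*) \<or>
             sg_iso X m (Cyc 2 \<times> Cyc 2) (prod_op (*) (*)) \<or>
             sg_iso X m (Lmin 2 \<times> Cyc 2) (prod_op min (*)) \<or>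
             sg_iso X m (ord_union (Lmin 1) (Cyc 2)) (ord_union_op min (*)) \<or>
             (\<exists>n::nat. sg_iso X m (Lmin n) min) \<or>
             (\<exists>n::nat. sg_iso X m (ord_union (Cyc 2) (Lmin n)) (ord_union_op (*) min)))))"
  (is "(?one \<longleftrightarrow> ?two) \<and> (?two \<longleftrightarrow> ?three) \<and> (?three \<longleftrightarrow> ?four)")
proof -
  interpret sgrp X m by unfold_locales (rule assms)
  interpret L: sgrp "lam X" "upmult X m" by unfold_locales (rule lam_semigroup)
  note isos = C2_iso[OF assms, symmetric] C3_iso[OF assms, symmetric] C4_iso[OF assms, symmetric]
    V4_iso[OF assms, symmetric] L2C2_iso[OF assms, symmetric] L1C2_iso[OF assms, symmetric]
    chain_iso[OF assms, symmetric] C2_chain_iso[OF assms, symmetric]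
  have lam: "commutative_on (lam X) (upmult X m) \<and> regular_in (lam X) (lam X) (upmult X m)"
    if "(\<exists>a b. C2_table X m a b) \<or> (\<exists>a b c. C3_table X m a b c) \<or> (\<exists>a b c d. C4_table X m a b c d) \<or>
      (\<exists>a b c d. V4_table X m a b c d) \<or> (\<exists>a b c d. L2C2_table X m a b c d) \<or> (\<exists>a b c. L1C2_table X m a b c) \<or>
      chain_table X m \<or> (\<exists>b h L. C2_chain_table X m b h L)"
    using that C2_lam C3_lam C4_lam V4_lam L2C2_lam L1C2_lam chain_lam C2_chain_lam
    by (elim disjE exE) (simp_all only:)
  have 12: ?two if ?one
    using L.commutative_clifford_inverse that by blast
  have 23: ?three if ?two
  proof -
    have "regular_in (lam X) (N2 X) (upmult X m)"
      using L.inverse_regular[OF that] lam_N2 unfolding regular_in_def by (meson subsetD)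
    then show ?thesis using L.inverse_idempotents_commute[OF that] by simp
  qed
  have 34: ?four if three: ?three
  proof -
    interpret rsgrp X m by unfold_locales (use three in auto)
    \<comment> \<open>Commutativity of \<open>X\<close> is read off at principal systems, since the
      shape already makes \<open>lam X\<close> commutative.\<close>
    note c = lam[OF shape, THEN conjunct1]
    have "commutative_on X m"
      unfolding commutative_on_def
    proof (intro ballI)
      fix x y assume xy: "x \<in> X" "y \<in> X"
      have "point x \<star> point y = point y \<star> point x"
        using c xy point_lam unfolding commutative_on_def by metis
      then show "m x y = m y x" using xy by (simp add: point_um point_inj)
    qed
    then show ?thesis unfolding isos using X_finite clifford shape by simp
  qed
  have 41: ?one if four: ?four
  proof -
    have "commutative_on (lam X) (upmult X m) \<and> regular_in (lam X) (lam X) (upmult X m)"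
      by (rule lam) (use four in \<open>unfold isos, argo\<close>)
    then show ?thesis using L.commutative_regular_clifford by simp
  qed
  show ?thesis using 12 23 34 41 by argo
qed

end
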